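(* For $\mu>0$ define $$\lambda_c(\mu):=\inf\{\lambda>\mu:\ \text{there is a thinning from }\lambda\text{ to }\mu\text{ on }[0,1]\}.$$ Then $\lambda_c(\mu)\leq \mu+1$ for all $\mu>0$, and $\lambda_c(\mu)\geq \mu+1-o(1)$ as $\mu\to\infty$.
   Context: Point processes on $[0,1]$ are viewed as random simple point measures on $[0,1]$ (finite $\{0,1,2,\dots\}$-valued measures with mass at most one at each point), with the $\sigma$-algebra generated by the maps $\nu\mapsto\nu(A)$, $A$ Borel. For $\lambda>\mu>0$, a (deterministic, Poisson) thinning from $\lambda$ to $\mu$ on $[0,1]$ is a measurable function $f$ from the set of simple point measures on $[0,1]$ to itself such that, if $\Pi$ is a homogeneous Poisson point process of intensity $\lambda$ on $[0,1]$ (with respect to Lebesgue measure), then $f(\Pi)$ is a homogeneous Poisson point process of intensity $\mu$ on $[0,1]$, and every point of $f(\Pi)$ is a point of $\Pi$ almost surely. *)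

theory Defs
  imports "HOL-Probability.Probability"
begin

abbreviation unit_borel :: "real measure" where
  "unit_borel \<equiv> restrict_space borel {0..1}"

text \<open>Finiteness is implied: every set has a natural number as its mass.\<close>

definition simple_point_measures :: "real measure set" where
  "simple_point_measures =
    {\<nu>. sets \<nu> = sets unit_borel \<and>
        (\<forall>A\<in>sets \<nu>. \<exists>n::nat. emeasure \<nu> A = of_nat n) \<and>
        (\<forall>x\<in>{0..1}. emeasure \<nu> {x} \<le> 1)}"

definition configurations :: "real measure measure" where
  "configurations =
    sigma simple_point_measures
      {{\<nu> \<in> simple_point_measures. emeasure \<nu> A \<in> B} | A B.
         A \<in> sets unit_borel \<and> B \<in> sets borel}"

definition points :: "real measure \<Rightarrow> real set" where
  "points \<nu> = {x \<in> space \<nu>. emeasure \<nu> {x} > 0}"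

text \<open>The Poisson weights are written out because the rate is zero for null sets
  \<open>A\<close>, where \<^const>\<open>poisson_pmf\<close> is not specified; since \<open>0 ^ 0 = 1\<close>, the formula
  then says that \<open>A\<close> contains no point almost surely.\<close>

definition poisson_process :: "real \<Rightarrow> 'a measure \<Rightarrow> ('a \<Rightarrow> real measure) \<Rightarrow> bool" where
  "poisson_process lam M X \<longleftrightarrow>
    prob_space M \<and>
    X \<in> measurable M configurations \<and>
    (\<forall>A\<in>sets unit_borel. \<forall>k::nat.
       measure M {\<omega> \<in> space M. emeasure (X \<omega>) A = of_nat k} =
         exp (- (lam * measure lborel A)) * (lam * measure lborel A) ^ k / fact k) \<and>
    (\<forall>(n::nat) A. (\<forall>i<n. A i \<in> sets unit_borel) \<longrightarrow> disjoint_family_on A {..<n} \<longrightarrow>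
       prob_space.indep_vars M (\<lambda>_. borel) (\<lambda>i \<omega>. emeasure (X \<omega>) (A i)) {..<n})"

text \<open>The condition on \<open>f \<circ> X\<close> depends only on the law of \<open>X\<close>, and every law of a
  random element of \<^const>\<open>configurations\<close> is realised on a sample space of type
  \<^typ>\<open>real measure\<close> by taking \<open>X\<close> to be the identity. So restricting the
  sample space to this type loses no generality.\<close>

definition thinning :: "real \<Rightarrow> real \<Rightarrow> (real measure \<Rightarrow> real measure) \<Rightarrow> bool" where
  "thinning lam \<mu> f \<longleftrightarrow>
    f \<in> measurable configurations configurations \<and>
    (\<forall>(M :: real measure measure) X. poisson_process lam M X \<longrightarrow>
       poisson_process \<mu> M (\<lambda>\<omega>. f (X \<omega>)) \<and>
       (AE \<omega> in M. points (f (X \<omega>)) \<subseteq> points (X \<omega>)))"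

text \<open>The infimum is taken in the extended reals, so that it is infinite if there is no
  thinning.\<close>

definition lambda_c :: "real \<Rightarrow> ereal" where
  "lambda_c \<mu> = (INF lam \<in> {lam. lam > \<mu> \<and> (\<exists>f. thinning lam \<mu> f)}. ereal lam)"

end

theory Submission
  imports Defs
begin

text \<open>
  Conditionally on having \<open>n\<close> points, a Poisson process on \<open>[0,1]\<close> is a set of \<open>n\<close> independent uniform
  points, whatever the intensity.

  Lower bound: if a thinning keeps all \<open>n\<close> points on an event of positive probability, this event has at
  least the same probability under the target law, so \<open>n\<close> points are at most as likely under the source as
  under the target. For \<open>n = k + 1 = \<lceil>\<lambda>\<rceil>\<close> this fails, so a point is lost almost surely, whence
  \<open>P(Poi \<lambda> \<le> k + 1) \<le> P(Poi \<mu> \<le> k)\<close>. The mean value theorem turns this into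
  \<open>\<lambda> - \<mu> \<ge> k / (k + 1) \<ge> 1 - 1 / \<mu>\<close>.

  Upper bound: for \<open>\<lambda> = \<mu> + 1\<close>, keep everything if there are at most \<open>K = \<lfloor>1 / ln (1 + 1 / \<mu>)\<rfloor>\<close> points, which
  is where \<open>n\<close> points are at least as likely under \<open>\<mu>\<close> as under \<open>\<lambda>\<close>. The remaining masses can be coupled so
  that at least one point is lost, because \<open>P(Poi \<lambda> \<le> m + 1) \<le> P(Poi \<mu> \<le> m)\<close> for \<open>m \<ge> K\<close>. To realise this
  coupling without external randomness, one needs a rule that deletes one of \<open>n\<close> uniform points so that
  the others are again uniform, and that produces a uniform variable independent of them. Take the coarsest
  dyadic level \<open>k\<close> that separates the points and let \<open>s\<close> be the fractional part of \<open>2\<^sup>k\<close> times the sum of the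
  points. Given the other points and the dyadic cell of the new one, the rank of the new point is known
  while \<open>s\<close> is uniform. So delete the point of rank \<open>\<lfloor>n s\<rfloor>\<close> and use the fractional part of \<open>n s\<close> as the
  uniform variable.
\<close>

section \<open>Simple point measures are finite configurations\<close>

text \<open>A thinning is tested on all sample spaces, and the Poisson process is given only by
  counts on disjoint sets. So the process is first identified with a single law, the mixture
  \<open>poisson_law\<close> of the laws of n uniform points; a thinning is then a map that carries
  one mixture to another and does not add points. The obstacle for the upper bound is that a map
  gets no coin flips. Randomness can only be read off the positions, and reading it off biases the
  points that carry it. The price is one point: the seed is independent of the configuration after a
  deletion, not of the configuration itself. One seed suffices, since it only decides how many
  points go; the remaining deletions are used without their seeds. A random choice thus forces the
  count to drop by at least one, and this is the shift from m to m + 1 in the comparison of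
  distribution functions. Raising the intensity by 1 raises the mean count by 1, which is just
  enough to pay for it. Among these comparisons the one at m = K takes real analysis; those for
  larger m follow from it and from the limit.\<close>

lemma sets_unit_borel_iff: "A \<in> sets unit_borel \<longleftrightarrow> A \<in> sets borel \<and> A \<subseteq> {0..1}"
  by (subst sets_restrict_space_iff) auto

lemma space_configurations [simp]: "space configurations = simple_point_measures"
  unfolding configurations_def by (rule space_measure_of) auto

lemma sets_configurations:
  "sets configurations = sigma_sets simple_point_measures
    {{\<nu> \<in> simple_point_measures. emeasure \<nu> A \<in> B} | A B. A \<in> sets unit_borel \<and> B \<in> sets borel}"
  unfolding configurations_def by (rule sets_measure_of) auto

lemma measurable_emeasure_configurations [measurable]:
  assumes A: "A \<in> sets unit_borel"
  shows "(\<lambda>\<nu>. emeasure \<nu> A) \<in> borel_measurable configurations"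
proof (rule measurableI)
  fix B :: "ennreal set" assume "B \<in> sets borel"
  then show "(\<lambda>\<nu>. emeasure \<nu> A) -` B \<inter> space configurations \<in> sets configurations"
    unfolding sets_configurations space_configurations using A
    by (intro sigma_sets.Basic) blast
qed simp

lemma measurable_configurationsI:
  assumes "\<And>\<omega>. \<omega> \<in> space M \<Longrightarrow> f \<omega> \<in> simple_point_measures"
    and "\<And>A. A \<in> sets unit_borel \<Longrightarrow> (\<lambda>\<omega>. emeasure (f \<omega>) A) \<in> borel_measurable M"
  shows "f \<in> measurable M configurations"
  unfolding configurations_def
proof (rule measurable_measure_of)
  show "f \<in> space M \<rightarrow> simple_point_measures" using assms(1) by auto
next
  fix Y assume "Y \<in> {{\<nu> \<in> simple_point_measures. emeasure \<nu> A \<in> B} |A B.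
                A \<in> sets unit_borel \<and> B \<in> sets borel}"
  then obtain A B where AB: "A \<in> sets unit_borel" "B \<in> sets borel"
    and Y: "Y = {\<nu> \<in> simple_point_measures. emeasure \<nu> A \<in> B}" by auto
  have "f -` Y \<inter> space M = (\<lambda>\<omega>. emeasure (f \<omega>) A) -` B \<inter> space M"
    using assms(1) by (auto simp: Y)
  also have "\<dots> \<in> sets M" using assms(2)[OF AB(1)] AB(2) by (rule measurable_sets)
  finally show "f -` Y \<inter> space M \<in> sets M" .
qed auto

text \<open>Counting measure on S, moved to the sigma-algebra of the unit interval. On finite
  subsets of [0,1] it is inverse to \<open>points\<close>.\<close>

definition config_of :: "real set \<Rightarrow> real measure" where
  "config_of S = distr (count_space S) unit_borel (\<lambda>x. x)"

lemma sets_config_of [simp]: "sets (config_of S) = sets unit_borel"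
  by (simp add: config_of_def)

lemma space_config_of [simp]: "space (config_of S) = {0..1}"
  by (simp add: config_of_def space_restrict_space)

lemma emeasure_config_of:
  assumes "S \<subseteq> {0..1}" "finite S" "A \<in> sets unit_borel"
  shows "emeasure (config_of S) A = of_nat (card (S \<inter> A))"
proof -
  have "emeasure (config_of S) A = emeasure (count_space S) (A \<inter> S)"
    unfolding config_of_def using assms
    by (subst emeasure_distr) (auto simp: space_restrict_space)
  also have "\<dots> = of_nat (card (S \<inter> A))"
    using assms by (subst emeasure_count_space_finite) (auto simp: Int_commute)
  finally show ?thesis .
qed

lemma singleton_in_unit_borel: "x \<in> {0..1} \<Longrightarrow> {x} \<in> sets unit_borel" for x :: real
  by (auto simp: sets_unit_borel_iff)

lemma config_of_in_simple [simp]: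
  assumes "S \<subseteq> {0..1}" "finite S"
  shows "config_of S \<in> simple_point_measures"
proof -
  have "card (S \<inter> {x}) \<le> 1" for x
    by (rule order_trans[OF card_mono[of "{x}"]]) auto
  then show ?thesis
    unfolding simple_point_measures_def using assms
    by (auto simp: emeasure_config_of singleton_in_unit_borel simp del: One_nat_def)
qed

lemma points_config_of [simp]:
  assumes "S \<subseteq> {0..1}" "finite S"
  shows "points (config_of S) = S"
proof -
  have "emeasure (config_of S) {x} > 0 \<longleftrightarrow> x \<in> S" if "x \<in> {0..1}" for x
    using assms that by (cases "x \<in> S") (auto simp: emeasure_config_of singleton_in_unit_borel)
  then show ?thesis using assms by (auto simp: points_def)
qed

lemma simple_point_measures_sets:
  "\<nu> \<in> simple_point_measures \<Longrightarrow> sets \<nu> = sets unit_borel"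
  "\<nu> \<in> simple_point_measures \<Longrightarrow> space \<nu> = {0..1}"
  using sets_eq_imp_space_eq[of \<nu> unit_borel]
  by (auto simp: simple_point_measures_def space_restrict_space)

lemma emeasure_simple_nat:
  assumes "\<nu> \<in> simple_point_measures" "A \<in> sets \<nu>"
  obtains n :: nat where "emeasure \<nu> A = of_nat n"
  using assms unfolding simple_point_measures_def by blast

lemma emeasure_simple_singleton:
  assumes "\<nu> \<in> simple_point_measures" "x \<in> points \<nu>"
  shows "emeasure \<nu> {x} = 1"
proof -
  have x: "x \<in> {0..1}" "emeasure \<nu> {x} > 0"
    using assms by (auto simp: points_def simple_point_measures_sets)
  then have "{x} \<in> sets \<nu>" using assms(1) by (simp add: simple_point_measures_sets singleton_in_unit_borel)
  then obtain n :: nat where "emeasure \<nu> {x} = of_nat n"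
    using emeasure_simple_nat[OF assms(1)] by metis
  moreover have "emeasure \<nu> {x} \<le> 1" using assms x by (auto simp: simple_point_measures_def)
  ultimately have "n = 1" using x(2) by (cases n) (auto simp flip: of_nat_Suc)
  then show ?thesis using \<open>emeasure \<nu> {x} = of_nat n\<close> by simp
qed

lemma finite_points:
  assumes \<nu>: "\<nu> \<in> simple_point_measures"
  shows "finite (points \<nu>)" "points \<nu> \<subseteq> {0..1}"
proof -
  show sub: "points \<nu> \<subseteq> {0..1}" using \<nu> by (auto simp: points_def simple_point_measures_sets)
  obtain n :: nat where n: "emeasure \<nu> {0..1} = of_nat n"
    using emeasure_simple_nat[OF \<nu> sets.top] simple_point_measures_sets(2)[OF \<nu>] by metis
  have "card F \<le> n" if F: "finite F" "F \<subseteq> points \<nu>" for F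
  proof -
    have "{x} \<in> sets \<nu>" if "x \<in> F" for x
      using that F sub \<nu> by (auto simp: simple_point_measures_sets intro!: singleton_in_unit_borel)
    then have "emeasure \<nu> F = (\<Sum>x\<in>F. emeasure \<nu> {x})"
      using F(1) by (intro emeasure_eq_sum_singleton)
    also have "\<dots> = of_nat (card F)"
      using F emeasure_simple_singleton[OF \<nu>] by (simp add: subset_iff)
    finally have "of_nat (card F) = emeasure \<nu> F" ..
    also have "\<dots> \<le> emeasure \<nu> (space \<nu>)" by (rule emeasure_space)
    also have "\<dots> = of_nat n" using n \<nu> by (simp add: simple_point_measures_sets)
    finally show ?thesis by simp
  qed
  then show "finite (points \<nu>)"
    by (rule finite_if_finite_subsets_card_bdd[THEN conjunct1]) auto
qed

text \<open>Integer values turn a mass tending to zero into a mass equal to zero, so a point measure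
  vanishes near every non-atom; compactness does the rest.\<close>

lemma emeasure_off_points:
  assumes \<nu>: "\<nu> \<in> simple_point_measures"
  shows "emeasure \<nu> ({0..1} - points \<nu>) = 0"
proof -
  let ?S = "points \<nu>"
  define P where "P u v \<longleftrightarrow> emeasure \<nu> ({u..v} \<inter> {0..1} - ?S) = 0" for u v :: real
  note sets_\<nu> = simple_point_measures_sets[OF \<nu>]
  have S: "?S \<in> sets borel" using finite_points[OF \<nu>] by (simp add: borel_closed finite_imp_closed)
  have meas: "{u..v} \<inter> {0..1} - ?S \<in> sets \<nu>" for u v
    unfolding sets_\<nu> sets_unit_borel_iff using S by auto
  have "(0::real) \<le> 1" by simp
  then have "P 0 1"
  proof (induct rule: Bolzano)
    case (trans a b c)
    have "emeasure \<nu> ({a..c} \<inter> {0..1} - ?S)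
      \<le> emeasure \<nu> (({a..b} \<inter> {0..1} - ?S) \<union> ({b..c} \<inter> {0..1} - ?S))"
      using meas by (intro emeasure_mono) auto
    also have "\<dots> \<le> emeasure \<nu> ({a..b} \<inter> {0..1} - ?S) + emeasure \<nu> ({b..c} \<inter> {0..1} - ?S)"
      using meas by (intro emeasure_subadditive) auto
    finally show ?case using trans by (simp add: P_def)
  next
    case (local x)
    define B where "B i = {x - 1 / real (Suc i)..x + 1 / real (Suc i)} \<inter> {0..1} - ?S" for i
    have B_meas: "B i \<in> sets \<nu>" for i unfolding B_def by (rule meas)
    have fin: "emeasure \<nu> (B i) \<noteq> \<infinity>" for i
      by (rule emeasure_simple_nat[OF \<nu> B_meas[of i]]) simp
    have dec: "decseq B"
    proof (rule decseq_SucI)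
      fix i
      have "1 / real (Suc (Suc i)) \<le> 1 / real (Suc i)" by (simp add: frac_le)
      then show "B (Suc i) \<subseteq> B i" unfolding B_def by auto
    qed
    have lim: "(\<lambda>i. emeasure \<nu> (B i)) \<longlonglongrightarrow> emeasure \<nu> (\<Inter>i. B i)"
      using fin dec B_meas by (intro Lim_emeasure_decseq) auto
    have "(\<Inter>i. B i) \<subseteq> {x} - ?S"
    proof
      fix y assume y: "y \<in> (\<Inter>i. B i)"
      have "\<bar>y - x\<bar> \<le> 1 / real (Suc i)" for i
      proof -
        have "y \<in> B i" using y by auto
        then show ?thesis unfolding B_def by (auto simp: abs_le_iff)
      qed
      then have "\<bar>y - x\<bar> \<le> 0"
        by (intro LIMSEQ_le_const[OF LIMSEQ_Suc[OF lim_1_over_n]]) auto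
      then have "y = x" by simp
      then show "y \<in> {x} - ?S" using y by (auto simp: B_def)
    qed
    moreover have "emeasure \<nu> ({x} - ?S) = 0"
    proof (cases "x \<in> ?S")
      case False
      then have "emeasure \<nu> {x} = 0" using local sets_\<nu>(2) by (auto simp: points_def)
      then show ?thesis using False by (simp add: Diff_triv)
    qed auto
    moreover have "{x} - ?S \<in> sets \<nu>"
      using local S by (auto simp: sets_\<nu> sets_unit_borel_iff intro!: sets.Diff)
    ultimately have "emeasure \<nu> (\<Inter>i. B i) = 0"
      using emeasure_mono[of "\<Inter>i. B i" "{x} - ?S" \<nu>] by simp
    with lim have "eventually (\<lambda>i. emeasure \<nu> (B i) < 1) sequentially"
      by (intro order_tendstoD(2)) auto
    then obtain i where i: "emeasure \<nu> (B i) < 1" by (auto simp: eventually_sequentially)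
    moreover obtain n :: nat where "emeasure \<nu> (B i) = of_nat n"
      by (rule emeasure_simple_nat[OF \<nu> B_meas[of i]])
    ultimately have B0: "emeasure \<nu> (B i) = 0" by (cases n) (auto simp flip: of_nat_Suc)
    show ?case
    proof (intro exI[of _ "1 / real (Suc i)"] conjI allI impI)
      fix u v :: real assume uv: "u \<le> x \<and> x \<le> v \<and> v - u < 1 / real (Suc i)"
      have "emeasure \<nu> ({u..v} \<inter> {0..1} - ?S) \<le> emeasure \<nu> (B i)"
        using meas uv by (intro emeasure_mono) (auto simp: B_def)
      then show "P u v" using B0 by (simp add: P_def)
    qed simp
  qed
  then show ?thesis by (simp add: P_def)
qed

text \<open>Atoms have mass one and their complement is null, so the measure is determined by its
  atoms. Equality of configurations becomes equality of finite sets.\<close>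

lemma config_of_points:
  assumes \<nu>: "\<nu> \<in> simple_point_measures"
  shows "config_of (points \<nu>) = \<nu>"
proof (rule measure_eqI)
  show "sets (config_of (points \<nu>)) = sets \<nu>" using \<nu> by (simp add: simple_point_measures_sets)
next
  fix A assume "A \<in> sets (config_of (points \<nu>))"
  then have A: "A \<in> sets unit_borel" by simp
  note S = finite_points[OF \<nu>]
  have meas: "{x} \<in> sets \<nu>" if "x \<in> points \<nu>" for x
    using that S \<nu> by (auto simp: simple_point_measures_sets intro!: singleton_in_unit_borel)
  have SB: "B \<in> sets \<nu>" if "B \<subseteq> points \<nu>" for B
    using that S \<nu> by (auto simp: simple_point_measures_sets sets_unit_borel_iff
      intro!: borel_closed finite_imp_closed intro: finite_subset)
  have "emeasure \<nu> A = emeasure \<nu> (points \<nu> \<inter> A) + emeasure \<nu> (A - points \<nu>)"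
    using A SB[of "points \<nu>"] \<nu> SB[of "points \<nu> \<inter> A"]
    by (subst plus_emeasure) (auto simp: simple_point_measures_sets intro!: arg_cong2[where f=emeasure] sets.Diff)
  also have "emeasure \<nu> (points \<nu> \<inter> A) = of_nat (card (points \<nu> \<inter> A))"
    using S meas emeasure_simple_singleton[OF \<nu>] by (subst emeasure_eq_sum_singleton) auto
  also have "emeasure \<nu> (A - points \<nu>) \<le> emeasure \<nu> ({0..1} - points \<nu>)"
    using A SB[of "points \<nu>"] \<nu> sets.top[of \<nu>] unfolding simple_point_measures_sets[OF \<nu>]
    by (intro emeasure_mono) (auto simp: sets_unit_borel_iff simple_point_measures_sets)
  then have "emeasure \<nu> (A - points \<nu>) = 0" using emeasure_off_points[OF \<nu>] by simp
  finally show "emeasure (config_of (points \<nu>)) A = emeasure \<nu> A"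
    using A S by (simp add: emeasure_config_of)
qed

lemma emeasure_eq_card_points:
  assumes "\<nu> \<in> simple_point_measures" "A \<in> sets unit_borel"
  shows "emeasure \<nu> A = of_nat (card (points \<nu> \<inter> A))"
  using emeasure_config_of[of "points \<nu>" A] finite_points[OF assms(1)] config_of_points[OF assms(1)] assms(2)
  by simp

section \<open>Uniqueness of the Poisson law\<close>

definition count_event :: "nat set \<Rightarrow> (nat \<Rightarrow> real set) \<Rightarrow> (nat \<Rightarrow> nat) \<Rightarrow> real measure set" where
  "count_event J A k = {\<nu> \<in> simple_point_measures. \<forall>i\<in>J. emeasure \<nu> (A i) = of_nat (k i)}"

lemma sets_count_event [measurable]:
  assumes "finite J" "\<And>i. i \<in> J \<Longrightarrow> A i \<in> sets unit_borel"
  shows "count_event J A k \<in> sets configurations"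
proof -
  have "{\<nu> \<in> space configurations. \<forall>i\<in>J. emeasure \<nu> (A i) = of_nat (k i)} \<in> sets configurations"
    using assms by measurable
  then show ?thesis by (simp add: count_event_def)
qed

text \<open>Counts are natural numbers, so an event that a count lies in B is a countable union of
  events that fix the count.\<close>

lemma sigma_sets_count_events:
  "sigma_sets simple_point_measures
    {count_event {..<n} A k | n A k. \<forall>i<n. A i \<in> sets unit_borel} = sets configurations"
    (is "sigma_sets _ ?G = _")
proof (rule antisym)
  have "?G \<subseteq> sets configurations" by (auto intro!: sets_count_event)
  then show "sigma_sets simple_point_measures ?G \<subseteq> sets configurations"
    using sets.sigma_sets_subset[of ?G configurations] by simp
next
  have "{\<nu> \<in> simple_point_measures. emeasure \<nu> A \<in> B} \<in> sigma_sets simple_point_measures ?G"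
    if A: "A \<in> sets unit_borel" for A B
  proof -
    have "{\<nu> \<in> simple_point_measures. emeasure \<nu> A \<in> B} =
        (\<Union>k\<in>{k. of_nat k \<in> B}. count_event {..<1} (\<lambda>_. A) (\<lambda>_. k))"
      using emeasure_eq_card_points[OF _ A] by (fastforce simp: count_event_def)
    also have "\<dots> \<in> sigma_sets simple_point_measures ?G"
    proof (rule sigma_sets_UNION)
      fix Y assume "Y \<in> (\<lambda>k. count_event {..<1} (\<lambda>_. A) (\<lambda>_. k)) ` {k. of_nat k \<in> B}"
      then show "Y \<in> sigma_sets simple_point_measures ?G" using A by (blast intro: sigma_sets.Basic)
    qed auto
    finally show ?thesis .
  qed
  then show "sets configurations \<subseteq> sigma_sets simple_point_measures ?G"
    unfolding sets_configurations by (intro sigma_sets_mono) auto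
qed

lemma Int_stable_count_events:
  "Int_stable {count_event {..<n} A k | n A k. \<forall>i<n. A i \<in> sets unit_borel}"
proof (rule Int_stableI, clarify)
  fix n m :: nat and A B :: "nat \<Rightarrow> real set" and k l :: "nat \<Rightarrow> nat"
  assume A: "\<forall>i<n. A i \<in> sets unit_borel" and B: "\<forall>i<m. B i \<in> sets unit_borel"
  define A' where "A' i = (if i < n then A i else B (i - n))" for i
  define k' where "k' i = (if i < n then k i else l (i - n))" for i
  have "count_event {..<n} A k \<inter> count_event {..<m} B l = count_event {..<n + m} A' k'"
  proof (rule antisym)
    show "count_event {..<n} A k \<inter> count_event {..<m} B l \<subseteq> count_event {..<n + m} A' k'"
      by (auto simp: count_event_def A'_def k'_def)
  next
    show "count_event {..<n + m} A' k' \<subseteq> count_event {..<n} A k \<inter> count_event {..<m} B l"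
    proof
      fix \<nu> assume "\<nu> \<in> count_event {..<n + m} A' k'"
      then have \<nu>: "\<nu> \<in> simple_point_measures"
        and eq: "\<And>i. i < n + m \<Longrightarrow> emeasure \<nu> (A' i) = of_nat (k' i)"
        by (auto simp: count_event_def)
      have "emeasure \<nu> (A i) = of_nat (k i)" if "i < n" for i
        using eq[of i] that by (simp add: A'_def k'_def)
      moreover have "emeasure \<nu> (B i) = of_nat (l i)" if "i < m" for i
        using eq[of "n + i"] that by (simp add: A'_def k'_def)
      ultimately show "\<nu> \<in> count_event {..<n} A k \<inter> count_event {..<m} B l"
        using \<nu> by (auto simp: count_event_def)
    qed
  qed
  moreover have "\<forall>i<n + m. A' i \<in> sets unit_borel" using A B by (auto simp: A'_def)
  ultimately show "\<exists>na Aa ka. count_event {..<n} A k \<inter> count_event {..<m} B l = count_event {..<na} Aa ka \<and>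
      (\<forall>i<na. Aa i \<in> sets unit_borel)" by blast
qed

text \<open>Counts over an arbitrary finite family of sets are sums of counts over the atoms of the
  algebra that it generates.\<close>

lemma count_event_eq_atoms:
  assumes A: "\<And>i. i < n \<Longrightarrow> A i \<in> sets unit_borel"
  obtains N C K where "\<And>j. j < N \<Longrightarrow> C j \<in> sets unit_borel" "disjoint_family_on C {..<N::nat}"
    "countable K" "count_event {..<n} A k = (\<Union>\<kappa>\<in>K. count_event {..<N} C \<kappa>)"
    "disjoint_family_on (count_event {..<N} C) K"
proof -
  define N where "N = card (Pow {..<n})"
  \<comment> \<open>\<open>h\<close> enumerates the subsets of the index set; \<open>C j\<close>
    collects the points that lie in exactly those \<open>A i\<close> with
    \<open>i \<in> h j\<close>.\<close>
  obtain h where h: "bij_betw h {..<N} (Pow {..<n})"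
    using ex_bij_betw_nat_finite[of "Pow {..<n}"] unfolding N_def atLeast0LessThan by auto
  define C where "C j = {x \<in> {0..1}. \<forall>i<n. x \<in> A i \<longleftrightarrow> i \<in> h j}" for j
  \<comment> \<open>Count vectors of the atoms with the prescribed sums. They are taken extensional
    so that different vectors differ at an index below \<open>N\<close>, which makes their events
    disjoint, and so that there are only countably many.\<close>
  define K where "K = {\<kappa> \<in> {..<N} \<rightarrow>\<^sub>E (UNIV :: nat set). \<forall>i<n. (\<Sum>j | j < N \<and> i \<in> h j. \<kappa> j) = k i}"
  have C_sets: "C j \<in> sets unit_borel" for j
  proof -
    have "C j = {x \<in> space unit_borel. \<forall>i\<in>{..<n}. (x \<in> A i \<inter> space unit_borel) = (i \<in> h j)}"
      by (auto simp: C_def space_restrict_space)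
    also have "\<dots> \<in> sets unit_borel"
      using A by measurable
    finally show ?thesis .
  qed
  have C_disj: "disjoint_family_on C {..<N}"
  unfolding disjoint_family_on_def
  proof (intro ballI impI)
    fix i j assume ij: "i \<in> {..<N}" "j \<in> {..<N}" "i \<noteq> j"
    then have "h i \<noteq> h j" using h by (auto simp: bij_betw_def dest: inj_onD)
    moreover have "h i \<subseteq> {..<n}" "h j \<subseteq> {..<n}" using h ij bij_betwE by blast+
    ultimately obtain l where "l < n" "l \<in> h i \<longleftrightarrow> l \<notin> h j" by blast
    then show "C i \<inter> C j = {}" by (auto simp: C_def)
  qed
  have A_eq: "A i = (\<Union>j\<in>{j. j < N \<and> i \<in> h j}. C j)" if i: "i < n" for i
  proof (rule antisym)
    show "A i \<subseteq> (\<Union>j\<in>{j. j < N \<and> i \<in> h j}. C j)"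
    proof
      fix x assume x: "x \<in> A i"
      have "{l. l < n \<and> x \<in> A l} \<in> h ` {..<N}" using h by (auto simp: bij_betw_def)
      then obtain j where "j < N" "h j = {l. l < n \<and> x \<in> A l}" by auto
      with x i A[OF i] show "x \<in> (\<Union>j\<in>{j. j < N \<and> i \<in> h j}. C j)"
        by (auto simp: C_def sets_unit_borel_iff intro!: exI[of _ j])
    qed
  qed (use i in \<open>auto simp: C_def\<close>)
  have sum_eq: "emeasure \<nu> (A i) = (\<Sum>j | j < N \<and> i \<in> h j. emeasure \<nu> (C j))"
    if "\<nu> \<in> simple_point_measures" "i < n" for \<nu> i
    unfolding A_eq[OF that(2)]
    using that(1) C_sets disjoint_family_on_mono[OF _ C_disj, of "{j. j < N \<and> i \<in> h j}"]
    by (intro sum_emeasure[symmetric]) (auto simp: simple_point_measures_sets)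
  have "count_event {..<n} A k = (\<Union>\<kappa>\<in>K. count_event {..<N} C \<kappa>)"
  proof (rule antisym; rule subsetI)
    fix \<nu> assume "\<nu> \<in> count_event {..<n} A k"
    then have \<nu>: "\<nu> \<in> simple_point_measures" and eq: "\<And>i. i < n \<Longrightarrow> emeasure \<nu> (A i) = of_nat (k i)"
      by (auto simp: count_event_def)
    have "\<exists>m::nat. emeasure \<nu> (C j) = of_nat m" for j
      using emeasure_simple_nat[OF \<nu>, of "C j"] C_sets \<nu> by (metis simple_point_measures_sets(1))
    then obtain m :: "nat \<Rightarrow> nat" where m: "\<And>j. emeasure \<nu> (C j) = of_nat (m j)" by metis
    have "(\<Sum>j | j < N \<and> i \<in> h j. m j) = k i" if "i < n" for i
    proof -
      have "of_nat (\<Sum>j | j < N \<and> i \<in> h j. m j) = (of_nat (k i) :: ennreal)"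
        using sum_eq[OF \<nu> that] eq[OF that] m by simp
      then show ?thesis by (simp only: of_nat_eq_iff)
    qed
    moreover have "(\<Sum>j | j < N \<and> i \<in> h j. restrict m {..<N} j) = (\<Sum>j | j < N \<and> i \<in> h j. m j)" for i
      by (rule sum.cong) auto
    ultimately have "restrict m {..<N} \<in> K" by (simp add: K_def)
    moreover have "\<nu> \<in> count_event {..<N} C (restrict m {..<N})"
      using \<nu> m by (auto simp: count_event_def)
    ultimately show "\<nu> \<in> (\<Union>\<kappa>\<in>K. count_event {..<N} C \<kappa>)" by blast
  next
    fix \<nu> assume "\<nu> \<in> (\<Union>\<kappa>\<in>K. count_event {..<N} C \<kappa>)"
    then obtain \<kappa> where \<kappa>: "\<kappa> \<in> K" "\<nu> \<in> simple_point_measures"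
      "\<And>j. j < N \<Longrightarrow> emeasure \<nu> (C j) = of_nat (\<kappa> j)" by (auto simp: count_event_def)
    have "emeasure \<nu> (A i) = of_nat (k i)" if i: "i < n" for i
    proof -
      have "emeasure \<nu> (A i) = (\<Sum>j | j < N \<and> i \<in> h j. of_nat (\<kappa> j))"
        using sum_eq[OF \<kappa>(2) i] \<kappa>(3) by simp
      also have "\<dots> = of_nat (\<Sum>j | j < N \<and> i \<in> h j. \<kappa> j)" by simp
      finally show ?thesis using \<kappa>(1) i by (simp add: K_def del: of_nat_sum)
    qed
    then show "\<nu> \<in> count_event {..<n} A k" using \<kappa>(2) by (auto simp: count_event_def)
  qed
  moreover have "disjoint_family_on (count_event {..<N} C) K"
  unfolding disjoint_family_on_def
  proof (intro ballI impI)
    fix \<kappa> \<kappa>' assume "\<kappa> \<in> K" "\<kappa>' \<in> K" "\<kappa> \<noteq> \<kappa>'"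
    then obtain j where "j < N" "\<kappa> j \<noteq> \<kappa>' j"
      unfolding K_def by (metis (mono_tags, lifting) PiE_ext lessThan_iff mem_Collect_eq)
    then show "count_event {..<N} C \<kappa> \<inter> count_event {..<N} C \<kappa>' = {}"
      by (auto simp: count_event_def)
  qed
  moreover have "countable K"
  proof (rule countable_subset)
    show "K \<subseteq> {..<N} \<rightarrow>\<^sub>E UNIV" by (auto simp: K_def)
  qed (intro countable_PiE, auto)
  ultimately show ?thesis using that C_sets C_disj by blast
qed

text \<open>The uniqueness theorem wants an intersection-stable generator, hence arbitrary families,
  while a Poisson process gives information on disjoint families only. The atoms of
  \<open>count_event_eq_atoms\<close> bridge the two.\<close>

lemma configurations_law_eqI:
  assumes P: "prob_space P" "sets P = sets configurations"
    and Q: "prob_space Q" "sets Q = sets configurations"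
    and eq: "\<And>n A k. \<lbrakk>\<And>i. i < n \<Longrightarrow> A i \<in> sets unit_borel; disjoint_family_on A {..<n}\<rbrakk> \<Longrightarrow>
      emeasure P (count_event {..<n} A k) = emeasure Q (count_event {..<n} A k)"
  shows "P = Q"
proof (rule measure_eqI_generator_eq[OF Int_stable_count_events])
  show "{count_event {..<n} A k |n A k. \<forall>i<n. A i \<in> sets unit_borel} \<subseteq> Pow simple_point_measures"
    by (auto simp: count_event_def)
  show "emeasure P X = emeasure Q X"
    if X: "X \<in> {count_event {..<n} A k |n A k. \<forall>i<n. A i \<in> sets unit_borel}" for X
  proof -
    obtain n A k where X: "X = count_event {..<n} A k" and A: "\<And>i. i < n \<Longrightarrow> A i \<in> sets unit_borel"
      using X by auto
    obtain N C K where C: "\<And>j. j < N \<Longrightarrow> C j \<in> sets unit_borel" "disjoint_family_on C {..<N::nat}"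
      and K: "countable K" and XK: "X = (\<Union>\<kappa>\<in>K. count_event {..<N} C \<kappa>)"
        "disjoint_family_on (count_event {..<N} C) K"
      unfolding X using count_event_eq_atoms[where A=A and n=n and k=k, OF A] by metis
    have "emeasure P X = (\<integral>\<^sup>+\<kappa>. emeasure P (count_event {..<N} C \<kappa>) \<partial>count_space K)"
      unfolding XK(1) using C K XK(2) P(2) by (intro emeasure_UN_countable) auto
    also have "\<dots> = (\<integral>\<^sup>+\<kappa>. emeasure Q (count_event {..<N} C \<kappa>) \<partial>count_space K)"
      using eq[of N C] C by (intro nn_integral_cong) simp
    also have "\<dots> = emeasure Q X"
      unfolding XK(1) using C K XK(2) Q(2) by (intro emeasure_UN_countable[symmetric]) auto
    finally show ?thesis .
  qed
  show "sets P = sigma_sets simple_point_measures {count_event {..<n} A k |n A k. \<forall>i<n. A i \<in> sets unit_borel}"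
    "sets Q = sigma_sets simple_point_measures {count_event {..<n} A k |n A k. \<forall>i<n. A i \<in> sets unit_borel}"
    by (simp_all only: P Q sigma_sets_count_events)
  \<comment> \<open>The count event of the empty family is the whole space, so it serves as the
    exhausting sequence.\<close>
  show "range (\<lambda>_::nat. simple_point_measures)
      \<subseteq> {count_event {..<n} A k |n A k. \<forall>i<n. A i \<in> sets unit_borel}"
    by (auto intro!: exI[of _ "0::nat"] simp: count_event_def)
  show "emeasure P simple_point_measures \<noteq> \<infinity>"
    using prob_space.emeasure_space_1[OF P(1)] sets_eq_imp_space_eq[OF P(2)] by simp
qed auto

text \<open>Meaningful also for \<open>a = 0\<close>, where all mass sits at 0; null sets need this
  case.\<close>

definition poisson_weight :: "real \<Rightarrow> nat \<Rightarrow> real" where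
  "poisson_weight a k = exp (- a) * a ^ k / fact k"

lemma poisson_weight_nonneg: "0 \<le> a \<Longrightarrow> 0 \<le> poisson_weight a k"
  by (simp add: poisson_weight_def)

lemma poisson_weight_sums: "poisson_weight a sums 1"
proof -
  have "(\<lambda>k. exp (- a) * (a ^ k /\<^sub>R fact k)) sums (exp (- a) * exp a)"
    by (intro sums_mult exp_converges)
  then show ?thesis
    by (simp add: poisson_weight_def[abs_def] exp_minus divide_inverse mult_ac scaleR_conv_of_real)
qed

lemma poisson_process_count_event:
  assumes X: "poisson_process lam M X"
    and A: "\<And>i. i < n \<Longrightarrow> A i \<in> sets unit_borel" "disjoint_family_on A {..<n}"
  shows "emeasure (distr M configurations X) (count_event {..<n} A k) =
    ennreal (\<Prod>i<n. poisson_weight (lam * measure lborel (A i)) (k i))"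
proof -
  interpret prob_space M using X by (simp add: poisson_process_def)
  have meas [measurable]: "X \<in> measurable M configurations" using X by (simp add: poisson_process_def)
  have "measure M {\<omega> \<in> space M. \<forall>i<n. emeasure (X \<omega>) (A i) = of_nat (k i)} =
      (\<Prod>i<n. poisson_weight (lam * measure lborel (A i)) (k i))"
  \<comment> \<open>The product rule for independent variables needs a nonempty index set; for
    \<open>n = 0\<close> both sides are 1.\<close>
  proof (cases "n = 0")
    case False
    have "indep_vars (\<lambda>_. borel) (\<lambda>i \<omega>. emeasure (X \<omega>) (A i)) {..<n}"
      using X A by (auto simp: poisson_process_def)
    then have "prob (\<Inter>i\<in>{..<n}. (\<lambda>\<omega>. emeasure (X \<omega>) (A i)) -` {of_nat (k i)} \<inter> space M) =
        (\<Prod>i\<in>{..<n}. prob ((\<lambda>\<omega>. emeasure (X \<omega>) (A i)) -` {of_nat (k i)} \<inter> space M))"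
      using False by (intro indep_varsD_finite) auto
    also have "(\<Inter>i\<in>{..<n}. (\<lambda>\<omega>. emeasure (X \<omega>) (A i)) -` {of_nat (k i)} \<inter> space M) =
        {\<omega> \<in> space M. \<forall>i<n. emeasure (X \<omega>) (A i) = of_nat (k i)}"
      using False by auto
    also have "(\<Prod>i\<in>{..<n}. prob ((\<lambda>\<omega>. emeasure (X \<omega>) (A i)) -` {of_nat (k i)} \<inter> space M)) =
        (\<Prod>i<n. poisson_weight (lam * measure lborel (A i)) (k i))"
    proof (rule prod.cong[OF refl])
      fix i assume "i \<in> {..<n}"
      moreover have "(\<lambda>\<omega>. emeasure (X \<omega>) (A i)) -` {of_nat (k i)} \<inter> space M =
          {\<omega> \<in> space M. emeasure (X \<omega>) (A i) = of_nat (k i)}" by auto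
      ultimately show "prob ((\<lambda>\<omega>. emeasure (X \<omega>) (A i)) -` {of_nat (k i)} \<inter> space M) =
          poisson_weight (lam * measure lborel (A i)) (k i)"
        using X A by (simp add: poisson_process_def poisson_weight_def)
    qed
    finally show ?thesis .
  qed (simp add: prob_space)
  moreover have "X -` count_event {..<n} A k \<inter> space M =
      {\<omega> \<in> space M. \<forall>i<n. emeasure (X \<omega>) (A i) = of_nat (k i)}"
    using measurable_space[OF meas] by (auto simp: count_event_def)
  ultimately show ?thesis using A by (simp add: emeasure_distr emeasure_eq_measure)
qed

lemma poisson_process_law_unique:
  assumes "poisson_process lam M X" "poisson_process lam N Y"
  shows "distr M configurations X = distr N configurations Y"
proof (rule configurations_law_eqI)
  show "prob_space (distr M configurations X)" "prob_space (distr N configurations Y)"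
    using assms by (auto simp: poisson_process_def intro!: prob_space.prob_space_distr)
qed (use assms in \<open>simp_all add: poisson_process_count_event\<close>)

text \<open>Independence follows from the joint weights because counts take countably many values,
  so it need only be tested on events that fix them. The index set \<open>J\<close> is arbitrary
  since independence is a statement about all subfamilies.\<close>

lemma poisson_processI:
  assumes M: "prob_space M" and X [measurable]: "X \<in> measurable M configurations"
    and joint: "\<And>J A k. \<lbrakk>finite J; \<And>i. i \<in> J \<Longrightarrow> A i \<in> sets unit_borel; disjoint_family_on A J\<rbrakk> \<Longrightarrow>
      emeasure (distr M configurations X) (count_event J A k) =
        ennreal (\<Prod>i\<in>J. poisson_weight (lam * measure lborel (A i)) (k i))"
    and lam: "lam \<ge> 0"
  shows "poisson_process lam M X"
proof -
  interpret prob_space M by fact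
  have joint': "prob {\<omega> \<in> space M. \<forall>i\<in>J. emeasure (X \<omega>) (A i) = of_nat (k i)} =
      (\<Prod>i\<in>J. poisson_weight (lam * measure lborel (A i)) (k i))"
    if J: "finite (J :: nat set)" "\<And>i. i \<in> J \<Longrightarrow> A i \<in> sets unit_borel" "disjoint_family_on A J" for J A k
  proof -
    have "X -` count_event J A k \<inter> space M = {\<omega> \<in> space M. \<forall>i\<in>J. emeasure (X \<omega>) (A i) = of_nat (k i)}"
      using measurable_space[OF X] by (auto simp: count_event_def)
    then show ?thesis using joint[OF J, of k] J lam
      by (simp add: emeasure_distr emeasure_eq_measure prod_nonneg poisson_weight_nonneg)
  qed
  have single: "prob {\<omega> \<in> space M. emeasure (X \<omega>) A = of_nat k} = poisson_weight (lam * measure lborel A) k"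
    if "A \<in> sets unit_borel" for A k
    using joint'[of "{0}" "\<lambda>_. A" "\<lambda>_. k"] that by (simp add: disjoint_family_on_def)
  have "indep_vars (\<lambda>_. borel) (\<lambda>i \<omega>. emeasure (X \<omega>) (A i)) {..<n}"
    if A: "\<And>i. i < n \<Longrightarrow> A i \<in> sets unit_borel" "disjoint_family_on A {..<n}" for n :: nat and A
  proof -
    \<comment> \<open>Two different values of one count exclude each other, so adding the empty set
      makes the family intersection stable.\<close>
    define F where "F i = insert {} (range (\<lambda>k::nat. {\<omega> \<in> space M. emeasure (X \<omega>) (A i) = of_nat k}))" for i
    have F_sets: "F i \<subseteq> events" if "i < n" for i
      using A(1)[OF that] by (auto simp: F_def)
    have "indep_sets F {..<n}"
    proof (rule indep_setsI)
      fix B J assume J: "J \<noteq> {}" "J \<subseteq> {..<n}" "finite J" and B: "\<forall>j\<in>J. B j \<in> F j"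
      show "prob (\<Inter>j\<in>J. B j) = (\<Prod>j\<in>J. prob (B j))"
      proof (cases "\<exists>j\<in>J. B j = {}")
        case True
        then have "(\<Inter>j\<in>J. B j) = {}" "(\<Prod>j\<in>J. prob (B j)) = 0" using J by force+
        then show ?thesis by simp
      next
        case False
        then have "\<forall>j\<in>J. \<exists>k. B j = {\<omega> \<in> space M. emeasure (X \<omega>) (A j) = of_nat k}"
          using B by (simp add: F_def image_iff)
        then obtain k where k: "\<And>j. j \<in> J \<Longrightarrow> B j = {\<omega> \<in> space M. emeasure (X \<omega>) (A j) = of_nat (k j)}"
          by metis
        have "(\<Inter>j\<in>J. B j) = (\<Inter>j\<in>J. {\<omega> \<in> space M. emeasure (X \<omega>) (A j) = of_nat (k j)})"
          using k by simp
        also have "\<dots> = {\<omega> \<in> space M. \<forall>j\<in>J. emeasure (X \<omega>) (A j) = of_nat (k j)}"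
          using J(1) by blast
        finally have "(\<Inter>j\<in>J. B j) = {\<omega> \<in> space M. \<forall>j\<in>J. emeasure (X \<omega>) (A j) = of_nat (k j)}" .
        moreover have "prob (B j) = poisson_weight (lam * measure lborel (A j)) (k j)" if "j \<in> J" for j
          using single[of "A j" "k j"] A(1)[of j] J that k by auto
        moreover have "disjoint_family_on A J"
          using disjoint_family_on_mono[OF J(2) A(2)] .
        ultimately show ?thesis
          using joint'[of J A k] J A(1) by (auto simp: subset_iff)
      qed
    qed (use F_sets in auto)
    moreover have "Int_stable (F i)" for i
      by (auto simp: Int_stable_def F_def)
    ultimately have "indep_sets (\<lambda>i. sigma_sets (space M) (F i)) {..<n}"
      by (rule indep_sets_sigma)
    then show ?thesis unfolding indep_vars_def2
    proof (intro conjI ballI)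
      fix i assume "i \<in> {..<n}"
      then show "random_variable borel (\<lambda>\<omega>. emeasure (X \<omega>) (A i))" using A(1)[of i] by auto
    next
      assume "indep_sets (\<lambda>i. sigma_sets (space M) (F i)) {..<n}"
      then show "indep_sets (\<lambda>i. {(\<lambda>\<omega>. emeasure (X \<omega>) (A i)) -` B \<inter> space M |B. B \<in> sets borel}) {..<n}"
      proof (rule indep_sets_mono_sets)
        fix i assume i: "i \<in> {..<n}"
        show "{(\<lambda>\<omega>. emeasure (X \<omega>) (A i)) -` B \<inter> space M |B. B \<in> sets borel} \<subseteq> sigma_sets (space M) (F i)"
        proof safe
          fix B :: "ennreal set"
          have nat: "\<exists>k::nat. emeasure (X \<omega>) (A i) = of_nat k" if "\<omega> \<in> space M" for \<omega>
            using measurable_space[OF X that] A(1)[of i] i emeasure_eq_card_points by auto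
          have "(\<lambda>\<omega>. emeasure (X \<omega>) (A i)) -` B \<inter> space M =
            (\<Union>k\<in>{k. of_nat k \<in> B}. {\<omega> \<in> space M. emeasure (X \<omega>) (A i) = of_nat k})"
            using nat by fastforce
          also have "\<dots> \<in> sigma_sets (space M) (F i)"
            by (rule sigma_sets_UNION) (auto simp: F_def intro!: sigma_sets.Basic)
          finally show "(\<lambda>\<omega>. emeasure (X \<omega>) (A i)) -` B \<inter> space M \<in> sigma_sets (space M) (F i)" .
        qed
      qed
    qed
  qed
  then show ?thesis
    using single M X unfolding poisson_process_def poisson_weight_def by auto
qed

section \<open>Independent uniform points\<close>

definition unit_uniform :: "real measure" where
  "unit_uniform = restrict_space lborel {0..1}"

lemma sets_unit_uniform [measurable_cong, simp]: "sets unit_uniform = sets unit_borel"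
  unfolding unit_uniform_def by (intro sets_restrict_space_cong) simp

lemma space_unit_uniform [simp]: "space unit_uniform = {0..1}"
  by (simp add: unit_uniform_def space_restrict_space)

lemma emeasure_unit_uniform: "A \<in> sets unit_borel \<Longrightarrow> emeasure unit_uniform A = emeasure lborel A"
  unfolding unit_uniform_def by (subst emeasure_restrict_space) (auto simp: sets_unit_borel_iff)

lemma prob_space_unit_uniform: "prob_space unit_uniform"
proof
  show "emeasure unit_uniform (space unit_uniform) = 1"
    by (simp add: emeasure_unit_uniform sets_unit_borel_iff)
qed

interpretation unit_uniform: prob_space unit_uniform
  by (rule prob_space_unit_uniform)

interpretation unit_uniform_product: product_prob_space "\<lambda>_::nat. unit_uniform" UNIV
  by unfold_locales

lemma measure_unit_uniform: "A \<in> sets unit_borel \<Longrightarrow> measure lborel A = measure unit_uniform A"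
  by (simp add: measure_def emeasure_unit_uniform)

lemma measurable_unit_uniform_borel [measurable]: "(\<lambda>x. x) \<in> borel_measurable unit_uniform"
  by (simp add: measurable_def sets_unit_borel_iff)

lemma AE_unit_uniform_notin:
  assumes "finite R" shows "AE y in unit_uniform. y \<notin> R"
proof (rule AE_I)
  show "{y \<in> space unit_uniform. \<not> y \<notin> R} \<subseteq> R \<inter> {0..1}" by auto
  have "emeasure unit_uniform (R \<inter> {0..1}) = emeasure lborel (R \<inter> {0..1})"
    using assms by (intro emeasure_unit_uniform) (auto simp: sets_unit_borel_iff intro!: borel_closed finite_imp_closed)
  then show "emeasure unit_uniform (R \<inter> {0..1}) = 0"
    using assms by (simp add: emeasure_lborel_countable countable_finite)
  show "R \<inter> {0..1} \<in> sets unit_uniform"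
    using assms by (auto simp: sets_unit_borel_iff intro!: borel_closed finite_imp_closed)
qed

lemma space_PiM_unit_uniform_image:
  "x \<in> space (PiM I (\<lambda>_. unit_uniform)) \<Longrightarrow> x ` I \<subseteq> {0..1}"
  by (auto simp: space_PiM PiE_iff)

lemma measurable_component_unit_uniform [measurable]:
  assumes "i \<in> I" shows "(\<lambda>x. x i) \<in> borel_measurable (PiM I (\<lambda>_. unit_uniform))"
proof -
  have "(\<lambda>x. x i) \<in> measurable (PiM I (\<lambda>_. unit_uniform)) unit_uniform"
    using assms by (rule measurable_component_singleton)
  then show ?thesis by (rule measurable_compose[OF _ measurable_unit_uniform_borel])
qed

lemma measurable_config_of_image [measurable]:
  fixes I :: "nat set"
  assumes I: "finite I"
  shows "(\<lambda>x. config_of (x ` I)) \<in> measurable (PiM I (\<lambda>_. unit_uniform)) configurations"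
proof (rule measurable_configurationsI)
  fix x assume "x \<in> space (PiM I (\<lambda>_. unit_uniform))"
  then show "config_of (x ` I) \<in> simple_point_measures"
    using I space_PiM_unit_uniform_image by (intro config_of_in_simple) blast+
next
  fix A assume A: "A \<in> sets unit_borel"
  have [measurable]: "A \<in> sets borel" using A by (simp add: sets_unit_borel_iff)
  \<comment> \<open>Coordinates may coincide, so the size of the image is not the number of
    coordinates in \<open>A\<close>. Each value is counted once, at the least index that takes
    it.\<close>
  define g where "g i x = (x i \<in> A \<and> (\<forall>j\<in>{j\<in>I. j < i}. x j \<noteq> x i))" for i and x :: "nat \<Rightarrow> real"
  have g: "Measurable.pred (PiM I (\<lambda>_. unit_uniform)) (g i)" if i: "i \<in> I" for i
  proof -
    have neq: "Measurable.pred (PiM I (\<lambda>_. unit_uniform)) (\<lambda>x. x j \<noteq> x i)" if "j \<in> I" for j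
      unfolding pred_def using i that by (intro borel_measurable_neq measurable_component_unit_uniform)
    have "Measurable.pred (PiM I (\<lambda>_. unit_uniform)) (\<lambda>x. x i \<in> A)"
      using measurable_component_unit_uniform[OF i] by measurable
    moreover have "Measurable.pred (PiM I (\<lambda>_. unit_uniform)) (\<lambda>x. \<forall>j\<in>{j\<in>I. j < i}. x j \<noteq> x i)"
      using I by (intro pred_intros_finite(3) neq) auto
    ultimately show ?thesis unfolding g_def pred_def by (intro sets.sets_Collect_conj)
  qed
  have card: "card (x ` I \<inter> A) = (\<Sum>i\<in>I. if g i x then 1 else 0)" for x
  proof -
    have "inj_on x {i\<in>I. g i x}"
    proof (rule inj_onI)
      fix i j assume ij: "i \<in> {i\<in>I. g i x}" "j \<in> {i\<in>I. g i x}" "x i = x j"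
      have "\<not> i < j" "\<not> j < i" using ij unfolding g_def by force+
      then show "i = j" by simp
    qed
    moreover have "x ` {i\<in>I. g i x} = x ` I \<inter> A"
    proof (intro equalityI subsetI)
      fix y assume y: "y \<in> x ` I \<inter> A"
      then have "\<exists>i. i \<in> I \<and> x i = y" by blast
      then obtain i where i: "i \<in> I \<and> x i = y" and least: "\<And>j. j < i \<Longrightarrow> \<not> (j \<in> I \<and> x j = y)"
        using exists_least_iff[of "\<lambda>i. i \<in> I \<and> x i = y"] by blast
      then have "g i x" using y unfolding g_def by blast
      then show "y \<in> x ` {i\<in>I. g i x}" using i by blast
    next
      fix y assume "y \<in> x ` {i\<in>I. g i x}"
      then show "y \<in> x ` I \<inter> A" unfolding g_def by blast
    qed
    ultimately have "card (x ` I \<inter> A) = card {i\<in>I. g i x}" by (metis card_image)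
    then show ?thesis using I by (simp add: sum.If_cases Int_def)
  qed
  have "(\<lambda>x. of_nat (\<Sum>i\<in>I. if g i x then 1 else 0) :: ennreal)
      \<in> borel_measurable (PiM I (\<lambda>_. unit_uniform))"
    using I g by measurable
  moreover have "emeasure (config_of (x ` I)) A = of_nat (\<Sum>i\<in>I. if g i x then 1 else 0)"
    if "x \<in> space (PiM I (\<lambda>_. unit_uniform))" for x
    using emeasure_config_of[OF space_PiM_unit_uniform_image[OF that] _ A] I card by simp
  ultimately show "(\<lambda>x. emeasure (config_of (x ` I)) A) \<in> borel_measurable (PiM I (\<lambda>_. unit_uniform))"
    by (simp cong: measurable_cong)
qed

text \<open>The binomial point process with \<open>card I\<close> points. A free index set makes it
  easy to single out one coordinate and integrate over it; by \<open>binomial_law_cong_card\<close>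
  only the size matters.\<close>

definition binomial_law :: "nat set \<Rightarrow> real measure measure" where
  "binomial_law I = distr (PiM I (\<lambda>_. unit_uniform)) configurations (\<lambda>x. config_of (x ` I))"

lemma sets_binomial_law [measurable_cong, simp]: "sets (binomial_law I) = sets configurations"
  by (simp add: binomial_law_def)

lemma space_binomial_law [simp]: "space (binomial_law I) = simple_point_measures"
  by (simp add: binomial_law_def)

lemma prob_space_binomial_law: "finite I \<Longrightarrow> prob_space (binomial_law I)"
  unfolding binomial_law_def
  by (intro prob_space.prob_space_distr prob_space_PiM prob_space_unit_uniform measurable_config_of_image)

lemma binomial_law_cong_card:
  assumes "finite I" "finite J" "card I = card J"
  shows "binomial_law I = binomial_law J"
proof -
  obtain f where f: "bij_betw f I J" using assms finite_same_card_bij by blast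
  then have fI: "f \<in> I \<rightarrow> J" "inj_on f I" "f ` I = J" by (auto simp: bij_betw_def)
  have [measurable]: "(\<lambda>\<omega>. \<lambda>n\<in>I. \<omega> (f n)) \<in> measurable (PiM J (\<lambda>_. unit_uniform)) (PiM I (\<lambda>_. unit_uniform))"
    using fI(1) by (intro measurable_restrict measurable_component_singleton) auto
  have "PiM I (\<lambda>_. unit_uniform) =
      distr (PiM J (\<lambda>_. unit_uniform)) (PiM I (\<lambda>_. unit_uniform)) (\<lambda>\<omega>. \<lambda>n\<in>I. \<omega> (f n))"
    using distr_PiM_reindex[of J "\<lambda>_. unit_uniform" f I] fI prob_space_unit_uniform by auto
  then have "binomial_law I = distr (distr (PiM J (\<lambda>_. unit_uniform)) (PiM I (\<lambda>_. unit_uniform))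
      (\<lambda>\<omega>. \<lambda>n\<in>I. \<omega> (f n))) configurations (\<lambda>x. config_of (x ` I))"
    by (simp add: binomial_law_def)
  also have "\<dots> = distr (PiM J (\<lambda>_. unit_uniform)) configurations (\<lambda>x. config_of (x ` J))"
    using assms by (subst distr_distr) (simp_all add: comp_def image_image flip: fI(3))
  finally show ?thesis by (simp add: binomial_law_def)
qed

text \<open>Fubini with the new point as the inner variable; this is the induction step for the
  multinomial formula.\<close>

lemma nn_integral_binomial_law_insert:
  assumes I: "finite I" "i \<notin> I" and F [measurable]: "F \<in> borel_measurable configurations"
  shows "(\<integral>\<^sup>+\<nu>. F \<nu> \<partial>binomial_law (insert i I)) =
    (\<integral>\<^sup>+x. \<integral>\<^sup>+y. F (config_of (insert y (x ` I))) \<partial>unit_uniform \<partial>PiM I (\<lambda>_. unit_uniform))"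
proof -
  have img: "(x(i := y)) ` insert i I = insert y (x ` I)" for x :: "nat \<Rightarrow> real" and y
    using I by auto
  have "(\<integral>\<^sup>+\<nu>. F \<nu> \<partial>binomial_law (insert i I)) =
      (\<integral>\<^sup>+x. F (config_of (x ` insert i I)) \<partial>PiM (insert i I) (\<lambda>_. unit_uniform))"
    unfolding binomial_law_def using I by (intro nn_integral_distr measurable_config_of_image) auto
  also have "\<dots> = (\<integral>\<^sup>+x. \<integral>\<^sup>+y. F (config_of ((x(i := y)) ` insert i I)) \<partial>unit_uniform \<partial>PiM I (\<lambda>_. unit_uniform))"
    using I by (intro unit_uniform_product.product_nn_integral_insert
      measurable_compose[OF measurable_config_of_image F]) auto
  finally show ?thesis unfolding img .
qed

text \<open>Given the earlier coordinates, the new one avoids their finite set of values almost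
  surely.\<close>

lemma AE_PiM_unit_uniform_inj:
  fixes I :: "nat set"
  assumes "finite I"
  shows "AE x in PiM I (\<lambda>_. unit_uniform). inj_on x I"
  using assms
proof induction
  case (insert i I)
  let ?Q = "\<lambda>x. inj_on x (insert i I)"
  let ?h = "\<lambda>x. if ?Q x then 0 else 1 :: ennreal"
  have eq: "Measurable.pred (PiM (insert i I) (\<lambda>_. unit_uniform)) (\<lambda>x. x a = x b)"
    if "a \<in> insert i I" "b \<in> insert i I" for a b
    unfolding pred_def using that by (intro borel_measurable_eq measurable_component_unit_uniform)
  have Q: "Measurable.pred (PiM (insert i I) (\<lambda>_. unit_uniform)) ?Q"
    unfolding inj_on_def using insert.hyps
    by (intro pred_intros_finite pred_intros_logic eq) auto
  have h: "?h \<in> borel_measurable (PiM (insert i I) (\<lambda>_. unit_uniform))"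
    using Q by (intro measurable_If) (simp_all add: pred_def)
  have "(\<integral>\<^sup>+x. ?h x \<partial>PiM (insert i I) (\<lambda>_. unit_uniform)) =
     (\<integral>\<^sup>+x. \<integral>\<^sup>+y. ?h (x(i := y)) \<partial>unit_uniform \<partial>PiM I (\<lambda>_. unit_uniform))"
    using insert.hyps by (intro unit_uniform_product.product_nn_integral_insert h)
  also have "\<dots> = (\<integral>\<^sup>+x. 0 \<partial>PiM I (\<lambda>_. unit_uniform))"
  proof (rule nn_integral_cong_AE, use insert.IH in eventually_elim)
    fix x :: "nat \<Rightarrow> real" assume x: "inj_on x I"
    have "AE y in unit_uniform. y \<notin> x ` I" using insert by (intro AE_unit_uniform_notin) auto
    then have "AE y in unit_uniform. ?h (x(i := y)) = (0 :: ennreal)"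
    proof eventually_elim
      case (elim y)
      then have "?Q (x(i := y))" using x insert.hyps by (auto simp: inj_on_def)
      then show ?case by simp
    qed
    then have "(\<integral>\<^sup>+y. ?h (x(i := y)) \<partial>unit_uniform) = (\<integral>\<^sup>+y. 0 \<partial>unit_uniform)"
      by (rule nn_integral_cong_AE)
    then show "(\<integral>\<^sup>+y. ?h (x(i := y)) \<partial>unit_uniform) = 0" by simp
  qed
  finally have "(\<integral>\<^sup>+x. ?h x \<partial>PiM (insert i I) (\<lambda>_. unit_uniform)) = 0" by simp
  then have "AE x in PiM (insert i I) (\<lambda>_. unit_uniform). ?h x = (0::ennreal)"
    by (subst (asm) nn_integral_0_iff_AE[OF h])
  then show ?case by eventually_elim (auto split: if_splits)
qed auto

text \<open>The multinomial distribution, by conditioning on the cell that receives the new point.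
  The cells must cover [0,1] so that there always is one.\<close>

lemma binomial_law_count_event:
  assumes J: "finite J" and A: "\<And>i. i \<in> J \<Longrightarrow> A i \<in> sets unit_borel"
    and disj: "disjoint_family_on A J" and cover: "(\<Union>i\<in>J. A i) = {0..1}"
    and I: "finite I"
  shows "emeasure (binomial_law I) (count_event J A k) =
    ennreal (if sum k J = card I
      then fact (card I) * (\<Prod>i\<in>J. measure lborel (A i) ^ k i / fact (k i)) else 0)"
  using I
proof (induction I arbitrary: k)
  case empty
  interpret P: prob_space "binomial_law {}" by (rule prob_space_binomial_law) simp
  have em: "emeasure (config_of {}) (A i) = 0" if "i \<in> J" for i
    using that A by (simp add: emeasure_config_of)
  have "emeasure (binomial_law {}) (count_event J A k) = indicator (count_event J A k) (config_of {})"
    unfolding binomial_law_def using J A measurable_config_of_image[of "{}"]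
    by (subst emeasure_distr) (auto simp: indicator_def vimage_def space_PiM emeasure_PiM_empty)
  also have "\<dots> = (if sum k J = 0 then 1 else 0)"
    using J em by (auto simp: count_event_def indicator_def)
  finally show ?case using J by (auto simp: ennreal_1[symmetric] simp del: ennreal_1)
next
  case (insert m I)
  define a where "a i = measure lborel (A i)" for i
  have a_nonneg: "a i \<ge> 0" for i by (simp add: a_def)
  have em_a: "emeasure unit_uniform (A i) = ennreal (a i)" if "i \<in> J" for i
    using A[OF that] by (simp add: a_def measure_unit_uniform unit_uniform.emeasure_eq_measure)
  \<comment> \<open>What the other points must satisfy if the new point falls into
    \<open>A i\<close>. The case \<open>k i = 0\<close> is impossible and is split off because
    natural subtraction would truncate.\<close>
  define G where "G i = (if k i = 0 then {} else count_event J A (k(i := k i - 1)))" for i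
  have G_sets [measurable]: "G i \<in> sets configurations" for i
    using J A by (auto simp: G_def)
  have pointwise: "indicator (count_event J A k) (config_of (insert y R)) =
      (\<Sum>i\<in>J. indicator (A i) y * indicator (G i) (config_of R) :: ennreal)"
    if R: "finite R" "R \<subseteq> {0..1}" and y: "y \<notin> R" "y \<in> {0..1}" for R y
  proof -
    obtain i where i: "i \<in> J" "y \<in> A i" using cover y by blast
    have other: "y \<notin> A l" if "l \<in> J" "l \<noteq> i" for l
      using disj that i by (auto simp: disjoint_family_on_def)
    have 1: "card (insert y R \<inter> A i) = Suc (card (R \<inter> A i))" using i R y by simp
    have 2: "card (insert y R \<inter> A l) = card (R \<inter> A l)" if "l \<in> J" "l \<noteq> i" for l
      using other[OF that] by simp
    have "config_of (insert y R) \<in> count_event J A k \<longleftrightarrow> (\<forall>l\<in>J. card (insert y R \<inter> A l) = k l)"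
      using R y A by (auto simp: count_event_def emeasure_config_of simp del: of_nat_Suc Int_insert_left)
    also have "\<dots> \<longleftrightarrow> k i \<noteq> 0 \<and> (\<forall>l\<in>J. card (R \<inter> A l) = (k(i := k i - 1)) l)"
      using 1 2 i by (auto split: if_splits; fastforce)
    also have "\<dots> \<longleftrightarrow> config_of R \<in> G i"
      using R A by (auto simp: G_def count_event_def emeasure_config_of)
    finally have "indicator (count_event J A k) (config_of (insert y R)) =
      (indicator (A i) y * indicator (G i) (config_of R) :: ennreal)"
      using i by (auto simp: indicator_def)
    moreover have "(\<Sum>l\<in>J - {i}. indicator (A l) y * indicator (G l) (config_of R) :: ennreal) = 0"
      using other by (intro sum.neutral) auto
    ultimately show ?thesis
      using sum.remove[OF J i(1), of "\<lambda>l. indicator (A l) y * indicator (G l) (config_of R) :: ennreal"]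
      by simp
  qed
  have "emeasure (binomial_law (insert m I)) (count_event J A k) =
      (\<integral>\<^sup>+x. \<integral>\<^sup>+y. indicator (count_event J A k) (config_of (insert y (x ` I)))
        \<partial>unit_uniform \<partial>PiM I (\<lambda>_. unit_uniform))"
    using J A insert by (subst nn_integral_indicator[symmetric]; (subst nn_integral_binomial_law_insert)?) auto
  also have "\<dots> = (\<integral>\<^sup>+x. (\<Sum>i\<in>J. ennreal (a i) * indicator (G i) (config_of (x ` I))) \<partial>PiM I (\<lambda>_. unit_uniform))"
  proof (rule nn_integral_cong)
    fix x assume "x \<in> space (PiM I (\<lambda>_. unit_uniform))"
    then have R: "x ` I \<subseteq> {0..1}" "finite (x ` I)"
      using space_PiM_unit_uniform_image insert by auto
    have "(\<integral>\<^sup>+y. indicator (count_event J A k) (config_of (insert y (x ` I))) \<partial>unit_uniform) =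
      (\<integral>\<^sup>+y. (\<Sum>i\<in>J. indicator (A i) y * indicator (G i) (config_of (x ` I))) \<partial>unit_uniform)"
      using AE_unit_uniform_notin[OF R(2)] AE_space[of unit_uniform]
      by (intro nn_integral_cong_AE, eventually_elim) (use pointwise[OF R(2,1)] in simp)
    also have "\<dots> = (\<Sum>i\<in>J. ennreal (a i) * indicator (G i) (config_of (x ` I)))"
      using A em_a by (subst nn_integral_sum) (auto simp: nn_integral_multc intro!: sum.cong)
    finally show "(\<integral>\<^sup>+y. indicator (count_event J A k) (config_of (insert y (x ` I))) \<partial>unit_uniform) =
      (\<Sum>i\<in>J. ennreal (a i) * indicator (G i) (config_of (x ` I)))" .
  qed
  also have "\<dots> = (\<Sum>i\<in>J. ennreal (a i) * (\<integral>\<^sup>+x. indicator (G i) (config_of (x ` I)) \<partial>PiM I (\<lambda>_. unit_uniform)))"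
    using insert by (subst nn_integral_sum)
      (auto simp: nn_integral_cmult intro!: sum.cong nn_integral_cmult
        measurable_compose[OF measurable_config_of_image] borel_measurable_indicator)
  also have "\<dots> = (\<Sum>i\<in>J. ennreal (a i) * emeasure (binomial_law I) (G i))"
    using insert unfolding binomial_law_def
    by (intro sum.cong refl arg_cong2[where f="(*)"])
      (subst nn_integral_indicator[symmetric], simp, subst nn_integral_distr, auto)
  \<comment> \<open>Every summand is the common product weighted with \<open>k i\<close>; these
    weights add up to the new number of points and raise the factorial by one.\<close>
  also have "\<dots> = (\<Sum>i\<in>J. ennreal (if sum k J = Suc (card I)
      then real (k i) * (fact (card I) * (\<Prod>l\<in>J. a l ^ k l / fact (k l))) else 0))"
  proof (rule sum.cong[OF refl])
    fix i assume i: "i \<in> J"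
    show "ennreal (a i) * emeasure (binomial_law I) (G i) = ennreal (if sum k J = Suc (card I)
      then real (k i) * (fact (card I) * (\<Prod>l\<in>J. a l ^ k l / fact (k l))) else 0)"
    proof (cases "k i")
      case 0 then show ?thesis by (simp add: G_def)
    next
      case (Suc n)
      let ?k = "k(i := n)"
      have "sum k J = k i + sum k (J - {i})" "sum ?k J = n + sum ?k (J - {i})"
        using sum.remove[OF J i, of k] sum.remove[OF J i, of ?k] by auto
      moreover have "sum ?k (J - {i}) = sum k (J - {i})" by (rule sum.cong) auto
      ultimately have s: "sum ?k J = card I \<longleftrightarrow> sum k J = Suc (card I)" using Suc by auto
      have "(\<Prod>l\<in>J. a l ^ ?k l / fact (?k l)) = a i ^ n / fact n * (\<Prod>l\<in>J-{i}. a l ^ ?k l / fact (?k l))"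
        using prod.remove[OF J i, of "\<lambda>l. a l ^ ?k l / fact (?k l)"] by simp
      also have "(\<Prod>l\<in>J-{i}. a l ^ ?k l / fact (?k l)) = (\<Prod>l\<in>J-{i}. a l ^ k l / fact (k l))"
        by (rule prod.cong) auto
      finally have e: "(\<Prod>l\<in>J. a l ^ ?k l / fact (?k l)) =
        a i ^ n / fact n * (\<Prod>l\<in>J-{i}. a l ^ k l / fact (k l))" .
      have "a i * (\<Prod>l\<in>J. a l ^ ?k l / fact (?k l)) =
         real (k i) * (a i ^ k i / fact (k i)) * (\<Prod>l\<in>J-{i}. a l ^ k l / fact (k l))"
        unfolding e by (simp add: Suc del: of_nat_Suc)
      also have "\<dots> = real (k i) * (\<Prod>l\<in>J. a l ^ k l / fact (k l))"
        using prod.remove[OF J i, of "\<lambda>l. a l ^ k l / fact (k l)"] by simp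
      finally have p: "a i * (\<Prod>l\<in>J. a l ^ ?k l / fact (?k l)) = real (k i) * (\<Prod>l\<in>J. a l ^ k l / fact (k l))" .
      have "ennreal (a i) * emeasure (binomial_law I) (G i) = ennreal (a i) * ennreal (if sum ?k J = card I
        then fact (card I) * (\<Prod>l\<in>J. a l ^ ?k l / fact (?k l)) else 0)"
        using insert.IH[of ?k] Suc by (simp add: G_def a_def del: fun_upd_apply)
      also have "\<dots> = ennreal (if sum ?k J = card I
        then fact (card I) * (a i * (\<Prod>l\<in>J. a l ^ ?k l / fact (?k l))) else 0)"
        using a_nonneg by (subst ennreal_mult[symmetric])
          (auto simp: mult.left_commute simp del: fun_upd_apply intro!: mult_nonneg_nonneg prod_nonneg)
      finally show ?thesis unfolding p s by (simp add: mult_ac)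
    qed
  qed
  also have "\<dots> = ennreal (\<Sum>i\<in>J. if sum k J = Suc (card I)
      then real (k i) * (fact (card I) * (\<Prod>l\<in>J. a l ^ k l / fact (k l))) else 0)"
    using a_nonneg by (intro sum_ennreal) (auto intro!: mult_nonneg_nonneg prod_nonneg)
  also have "(\<Sum>i\<in>J. if sum k J = Suc (card I)
      then real (k i) * (fact (card I) * (\<Prod>l\<in>J. a l ^ k l / fact (k l))) else 0) =
    (if sum k J = Suc (card I)
      then fact (Suc (card I)) * (\<Prod>l\<in>J. a l ^ k l / fact (k l)) else 0)"
    by (auto simp flip: sum_distrib_right of_nat_sum)
  finally show ?case using insert by (simp add: a_def)
qed

section \<open>Existence of the Poisson law\<close>

text \<open>The Poisson process as a mixed binomial process: a Poisson number of independent uniform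
  points.\<close>

definition poisson_law :: "real \<Rightarrow> real measure measure" where
  "poisson_law lam = measure_pmf (poisson_pmf lam) \<bind> (\<lambda>n. binomial_law {..<n})"

lemma measurable_binomial_law:
  "(\<lambda>n. binomial_law {..<n}) \<in> measurable (measure_pmf p) (subprob_algebra configurations)"
  unfolding measurable_pmf_measure1
  by (auto simp: space_subprob_algebra intro!: prob_space_imp_subprob_space prob_space_binomial_law)

lemma sets_poisson_law [measurable_cong, simp]: "sets (poisson_law lam) = sets configurations"
  unfolding poisson_law_def by (rule sets_bind[where N=configurations]) auto

lemma space_poisson_law [simp]: "space (poisson_law lam) = simple_point_measures"
  using sets_eq_imp_space_eq[OF sets_poisson_law] by simp

lemma prob_space_poisson_law: "prob_space (poisson_law lam)"
  unfolding poisson_law_def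
  by (rule measure_pmf.prob_space_bind[OF _ measurable_binomial_law])
    (auto intro!: AE_I2 prob_space_binomial_law)

lemma emeasure_poisson_law:
  assumes lam: "lam > 0" and E: "E \<in> sets configurations"
  shows "emeasure (poisson_law lam) E =
    (\<Sum>n. ennreal (poisson_weight lam n) * emeasure (binomial_law {..<n}) E)"
proof -
  have "emeasure (poisson_law lam) E = (\<integral>\<^sup>+n. emeasure (binomial_law {..<n}) E \<partial>measure_pmf (poisson_pmf lam))"
    unfolding poisson_law_def using E by (intro emeasure_bind[OF _ measurable_binomial_law]) auto
  also have "\<dots> = (\<integral>\<^sup>+n. ennreal (poisson_weight lam n) * emeasure (binomial_law {..<n}) E \<partial>count_space UNIV)"
    using lam by (simp add: nn_integral_measure_pmf poisson_weight_def mult_ac)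
  also have "\<dots> = (\<Sum>n. ennreal (poisson_weight lam n) * emeasure (binomial_law {..<n}) E)"
    by (rule nn_integral_count_space_nat)
  finally show ?thesis .
qed

text \<open>On a partition the counts fix the total, so one term of the mixture survives. Its
  factorial cancels the multinomial one, and the exponential splits because the lengths of the cells
  add up to 1.\<close>

lemma poisson_law_count_event_partition:
  assumes lam: "lam > 0" and J: "finite J" and A: "\<And>i. i \<in> J \<Longrightarrow> A i \<in> sets unit_borel"
    and disj: "disjoint_family_on A J" and cover: "(\<Union>i\<in>J. A i) = {0..1}"
  shows "emeasure (poisson_law lam) (count_event J A k) =
    ennreal (\<Prod>i\<in>J. poisson_weight (lam * measure lborel (A i)) (k i))"
proof -
  define a where "a i = measure lborel (A i)" for i
  define c where "c = (\<Prod>i\<in>J. a i ^ k i / fact (k i))"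
  define N where "N = sum k J"
  have a_nonneg: "a i \<ge> 0" for i by (simp add: a_def)
  have "emeasure (poisson_law lam) (count_event J A k) =
      (\<Sum>n. ennreal (poisson_weight lam n) * emeasure (binomial_law {..<n}) (count_event J A k))"
    using J A by (intro emeasure_poisson_law lam) auto
  also have "\<dots> = (\<Sum>n\<in>{N}. ennreal (poisson_weight lam n) * emeasure (binomial_law {..<n}) (count_event J A k))"
    by (rule suminf_finite) (use J A disj cover in \<open>auto simp: binomial_law_count_event N_def\<close>)
  also have "\<dots> = ennreal (poisson_weight lam N) * ennreal (fact N * c)"
    using J A disj cover by (simp add: binomial_law_count_event N_def c_def a_def)
  also have "\<dots> = ennreal (poisson_weight lam N * (fact N * c))"
    using lam a_nonneg by (intro ennreal_mult[symmetric])
      (auto simp: c_def intro!: poisson_weight_nonneg mult_nonneg_nonneg prod_nonneg)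
  also have "poisson_weight lam N * (fact N * c) = exp (- lam) * lam ^ N * c"
    by (simp add: poisson_weight_def)
  also have "\<dots> = (\<Prod>i\<in>J. exp (- (lam * a i))) * (\<Prod>i\<in>J. lam ^ k i) * c"
  proof -
    have "(\<Sum>i\<in>J. a i) = measure unit_uniform (\<Union>i\<in>J. A i)"
      unfolding a_def using J A disj
      by (subst unit_uniform.finite_measure_finite_Union) (auto simp: measure_unit_uniform)
    then have "(\<Sum>i\<in>J. a i) = 1" using cover unit_uniform.prob_space by simp
    then have "(\<Prod>i\<in>J. exp (- (lam * a i))) = exp (- lam)"
      using J by (simp add: exp_sum[symmetric] sum_negf flip: sum_distrib_left)
    then show ?thesis by (simp add: N_def power_sum)
  qed
  also have "\<dots> = (\<Prod>i\<in>J. poisson_weight (lam * a i) (k i))"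
    unfolding c_def poisson_weight_def prod.distrib[symmetric]
    by (intro prod.cong) (simp_all add: power_mult_distrib)
  finally show ?thesis by (simp add: a_def)
qed

lemma poisson_law_count_event:
  assumes lam: "lam > 0" and J: "finite J" and A: "\<And>i. i \<in> J \<Longrightarrow> A i \<in> sets unit_borel"
    and disj: "disjoint_family_on A J"
  shows "emeasure (poisson_law lam) (count_event J A k) =
    ennreal (\<Prod>i\<in>J. poisson_weight (lam * measure lborel (A i)) (k i))"
proof -
  obtain m where m: "m \<notin> J" using ex_new_if_finite[OF infinite_UNIV_nat J] by auto
  \<comment> \<open>The uncovered rest becomes one more cell. Its count is then summed out, and its
    Poisson weights add up to 1.\<close>
  define B where "B = A(m := {0..1} - (\<Union>i\<in>J. A i))"
  have BA: "B i = A i" if "i \<in> J" for i using that m by (auto simp: B_def)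
  have B: "B i \<in> sets unit_borel" if "i \<in> insert m J" for i
  proof (cases "i = m")
    case True
    have "space unit_borel - (\<Union>i\<in>J. A i) \<in> sets unit_borel"
      using A J by (intro sets.compl_sets sets.finite_UN)
    then show ?thesis using True by (simp add: B_def space_restrict_space)
  qed (use that A BA in auto)
  have Bdisj: "disjoint_family_on B (insert m J)"
    using disj m by (auto simp: disjoint_family_on_def B_def)
  have Bcover: "(\<Union>i\<in>insert m J. B i) = {0..1}"
  proof -
    have "(\<Union>i\<in>J. A i) \<subseteq> {0..1}" using A by (auto simp: sets_unit_borel_iff)
    moreover have "(\<Union>i\<in>J. B i) = (\<Union>i\<in>J. A i)" using BA by simp
    moreover have "B m = {0..1} - (\<Union>i\<in>J. A i)" by (simp add: B_def)
    ultimately show ?thesis by (simp add: Un_absorb2)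
  qed
  define E where "E l = count_event (insert m J) B (k(m := l))" for l
  have eq: "count_event J A k = (\<Union>l. E l)"
  proof (intro equalityI subsetI)
    fix \<nu> assume \<nu>: "\<nu> \<in> count_event J A k"
    then have "\<nu> \<in> simple_point_measures" by (simp add: count_event_def)
    then have "emeasure \<nu> (B m) = of_nat (card (points \<nu> \<inter> B m))"
      using B[of m] by (intro emeasure_eq_card_points) auto
    then have "\<nu> \<in> E (card (points \<nu> \<inter> B m))"
      using \<nu> BA m by (auto simp: count_event_def E_def)
    then show "\<nu> \<in> (\<Union>l. E l)" by blast
  qed (use BA m in \<open>force simp: count_event_def E_def\<close>)
  define c where "c = (\<Prod>i\<in>J. poisson_weight (lam * measure lborel (A i)) (k i))"
  have c: "c \<ge> 0" unfolding c_def using lam by (intro prod_nonneg ballI poisson_weight_nonneg) auto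
  have EE: "emeasure (poisson_law lam) (E l) = ennreal (c * poisson_weight (lam * measure lborel (B m)) l)" for l
  proof -
    have "(\<Prod>i\<in>J. poisson_weight (lam * measure lborel (B i)) ((k(m := l)) i)) = c"
      unfolding c_def by (rule prod.cong) (use BA m in auto)
    then show ?thesis
      unfolding E_def using J B Bdisj Bcover lam m
      by (subst poisson_law_count_event_partition) (auto simp: mult_ac)
  qed
  have "emeasure (poisson_law lam) (count_event J A k) = (\<Sum>l. emeasure (poisson_law lam) (E l))"
    unfolding eq
  proof (rule suminf_emeasure[symmetric])
    show "range E \<subseteq> sets (poisson_law lam)" using J B by (auto simp: E_def intro!: sets_count_event)
    show "disjoint_family E" by (auto simp: disjoint_family_on_def E_def count_event_def)
  qed
  also have "\<dots> = ennreal c"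
  proof -
    have "(\<lambda>l. c * poisson_weight (lam * measure lborel (B m)) l) sums (c * 1)"
      by (intro sums_mult poisson_weight_sums)
    then show ?thesis
      unfolding EE using c lam by (intro suminf_ennreal_eq) (auto intro!: mult_nonneg_nonneg poisson_weight_nonneg)
  qed
  finally show ?thesis by (simp add: c_def)
qed

text \<open>Existence (the identity on \<open>poisson_law\<close>) and uniqueness together turn the
  definition by counts into an equation between laws, the form used from here on.\<close>

lemma poisson_process_iff_law:
  assumes lam: "lam > 0"
  shows "poisson_process lam M X \<longleftrightarrow> prob_space M \<and> X \<in> measurable M configurations \<and>
    distr M configurations X = poisson_law lam"
proof
  assume *: "prob_space M \<and> X \<in> measurable M configurations \<and> distr M configurations X = poisson_law lam"
  show "poisson_process lam M X"
    using * lam by (intro poisson_processI) (auto simp: poisson_law_count_event)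
next
  have id: "distr (poisson_law lam) configurations (\<lambda>\<nu>. \<nu>) = poisson_law lam"
    by (rule distr_id2) simp
  have "poisson_process lam (poisson_law lam) (\<lambda>\<nu>. \<nu>)"
    using lam prob_space_poisson_law
    by (intro poisson_processI) (auto simp: id poisson_law_count_event intro!: measurable_ident_sets)
  moreover assume "poisson_process lam M X"
  ultimately show "prob_space M \<and> X \<in> measurable M configurations \<and> distr M configurations X = poisson_law lam"
    using poisson_process_law_unique[of lam M X "poisson_law lam" "\<lambda>\<nu>. \<nu>"] id
    by (auto simp: poisson_process_def)
qed

section \<open>Deleting one of several uniform points\<close>

text \<open>The least level at which the points occupy different dyadic intervals of length
  \<open>2 ^ -k\<close>. It can be read off the configuration, yet it does not change while a point
  moves inside its interval.\<close>

definition sep_level :: "real set \<Rightarrow> nat" where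
  "sep_level C = (LEAST k. inj_on (\<lambda>x. \<lfloor>2 ^ k * x\<rfloor>) C)"

definition phase :: "real set \<Rightarrow> real" where
  "phase C = frac (2 ^ sep_level C * \<Sum>C)"

text \<open>For a uniform phase, \<open>slot\<close> and \<open>seed\<close> are independent and
  uniform, on the n ranks and on [0,1).\<close>

definition slot :: "real set \<Rightarrow> nat" where
  "slot C = nat \<lfloor>real (card C) * phase C\<rfloor>"

definition seed :: "real set \<Rightarrow> real" where
  "seed C = frac (real (card C) * phase C)"

definition rank_in :: "real set \<Rightarrow> real \<Rightarrow> nat" where
  "rank_in C c = card {d \<in> C. d < c}"

text \<open>Unspecified for the empty set, where no rank exists. Deleting is harmless there, but
  measurability needs an explicit default.\<close>

definition victim :: "real set \<Rightarrow> real" where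
  "victim C = (THE c. c \<in> C \<and> rank_in C c = slot C)"

lemma phase_bounds: "0 \<le> phase C" "phase C < 1"
  by (simp_all add: phase_def frac_lt_1)

lemma slot_less: "card C > 0 \<Longrightarrow> slot C < card C"
proof -
  assume C: "card C > 0"
  have "real (card C) * phase C < real (card C)"
    using C phase_bounds[of C] by simp
  then have "\<lfloor>real (card C) * phase C\<rfloor> < int (card C)" by (simp add: floor_less_iff)
  then show ?thesis unfolding slot_def using C by linarith
qed

lemma rank_in_bij_betw:
  assumes "finite C" shows "bij_betw (rank_in C) C {..<card C}"
proof -
  have less: "rank_in C c < rank_in C d" if "c \<in> C" "c < d" for c d
    unfolding rank_in_def using assms that by (intro psubset_card_mono) auto
  have inj: "inj_on (rank_in C) C"
    by (rule linorder_inj_onI) (use less in \<open>force+\<close>)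
  have "rank_in C c < card C" if "c \<in> C" for c
    unfolding rank_in_def using assms that by (intro psubset_card_mono) auto
  then have "rank_in C ` C \<subseteq> {..<card C}" by auto
  moreover have "card (rank_in C ` C) = card {..<card C}" using card_image[OF inj] by simp
  ultimately have "rank_in C ` C = {..<card C}" by (intro card_subset_eq) auto
  with inj show ?thesis by (simp add: bij_betw_def)
qed

lemma victim_unique:
  assumes "finite C" "c \<in> C" "rank_in C c = slot C" shows "victim C = c"
  unfolding victim_def
proof (rule the_equality)
  fix d assume "d \<in> C \<and> rank_in C d = slot C"
  then show "d = c"
    using assms inj_onD[OF bij_betw_imp_inj_on[OF rank_in_bij_betw[OF assms(1)]], of d c] by simp
qed (use assms in simp)

lemma victim:
  assumes "finite C" "C \<noteq> {}" shows "victim C \<in> C" "rank_in C (victim C) = slot C"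
proof -
  have "slot C \<in> rank_in C ` C"
    using slot_less[of C] rank_in_bij_betw[OF assms(1)] assms by (auto simp: bij_betw_def card_gt_0_iff)
  then obtain c where "c \<in> C" "rank_in C c = slot C" by auto
  then show "victim C \<in> C" "rank_in C (victim C) = slot C" using victim_unique[OF assms(1)] by auto
qed

lemma victim_eq_iff:
  "finite C \<Longrightarrow> c \<in> C \<Longrightarrow> victim C = c \<longleftrightarrow> rank_in C c = slot C"
  using victim victim_unique by blast

text \<open>The cell at a fine level determines the cells at all coarser ones: separation passes to
  finer levels, sharing a cell to coarser ones.\<close>

lemma floor_dyadic_coarsen:
  assumes "j \<le> k" shows "\<lfloor>2 ^ j * (y::real)\<rfloor> = \<lfloor>2 ^ k * y\<rfloor> div 2 ^ (k - j)"
proof -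
  have "(2::real) ^ k = 2 ^ j * 2 ^ (k - j)" using assms by (simp flip: power_add)
  then have "2 ^ j * y = 2 ^ k * y / real_of_int (2 ^ (k - j))" by simp
  then show ?thesis by (metis floor_divide_real_eq_div zero_le_numeral zero_le_power)
qed

lemma ex_dyadic_inj_on:
  assumes "finite C" shows "\<exists>k. inj_on (\<lambda>x::real. \<lfloor>2 ^ k * x\<rfloor>) C"
  using assms
proof induction
  case (insert c C)
  then obtain k where k: "inj_on (\<lambda>x. \<lfloor>2 ^ k * x\<rfloor>) C" by auto
  \<comment> \<open>A lower bound for the distance of \<open>c\<close> to the other points; the
    element 1 only keeps the minimum defined when there are none.\<close>
  define \<delta> where "\<delta> = Min (insert 1 ((\<lambda>x. \<bar>x - c\<bar>) ` C))"
  have \<delta>: "\<delta> > 0" "\<And>x. x \<in> C \<Longrightarrow> \<delta> \<le> \<bar>x - c\<bar>"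
    using insert by (auto simp: \<delta>_def)
  obtain m where m: "1 / \<delta> < 2 ^ m" using real_arch_pow[of 2 "1 / \<delta>"] by auto
  define K where "K = max k m"
  have "inj_on (\<lambda>x. \<lfloor>2 ^ K * x\<rfloor>) C"
  proof (rule inj_onI)
    fix x y assume xy: "x \<in> C" "y \<in> C" "\<lfloor>2 ^ K * x\<rfloor> = \<lfloor>2 ^ K * y\<rfloor>"
    then have "\<lfloor>2 ^ k * x\<rfloor> = \<lfloor>2 ^ k * y\<rfloor>" by (simp add: floor_dyadic_coarsen[of k K] K_def)
    then show "x = y" using k xy by (auto dest: inj_onD)
  qed
  moreover have "\<lfloor>2 ^ K * c\<rfloor> \<noteq> \<lfloor>2 ^ K * x\<rfloor>" if "x \<in> C" for x
  proof
    assume "\<lfloor>2 ^ K * c\<rfloor> = \<lfloor>2 ^ K * x\<rfloor>"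
    then have "\<bar>2 ^ K * x - 2 ^ K * c\<bar> < 1" by linarith
    then have "2 ^ K * \<bar>x - c\<bar> < 1" by (simp add: abs_mult flip: right_diff_distrib)
    moreover have "1 < 2 ^ m * \<delta>" using m \<delta>(1) by (simp add: field_simps)
    moreover have "2 ^ m * \<delta> \<le> 2 ^ K * \<bar>x - c\<bar>"
      using \<delta> that by (intro mult_mono) (auto simp: K_def)
    ultimately show False by linarith
  qed
  ultimately show ?case by (intro exI[of _ K]) auto
qed auto

lemma sep_level_inj_on: "finite C \<Longrightarrow> inj_on (\<lambda>x. \<lfloor>2 ^ sep_level C * x\<rfloor>) C"
  unfolding sep_level_def using ex_dyadic_inj_on by (rule LeastI_ex)

text \<open>Points that share a cell at level \<open>k\<close> share it at all coarser levels, so no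
  level up to \<open>k\<close> can tell them apart, and the least separating level is the same. This
  is what allows a decomposition of [0,1) into cells of constant level.\<close>

lemma sep_level_insert_cong:
  assumes R: "finite R" and y: "y \<notin> R"
    and cell: "\<lfloor>2 ^ sep_level (insert y R) * z\<rfloor> = \<lfloor>2 ^ sep_level (insert y R) * y\<rfloor>"
  shows "z \<notin> R" "sep_level (insert z R) = sep_level (insert y R)"
proof -
  define k where "k = sep_level (insert y R)"
  have inj: "inj_on (\<lambda>x. \<lfloor>2 ^ k * x\<rfloor>) (insert y R)" unfolding k_def using R by (intro sep_level_inj_on) simp
  show z: "z \<notin> R"
  proof
    assume "z \<in> R"
    then have "z = y" using inj_onD[OF inj, of z y] cell by (simp add: k_def)
    then show False using \<open>z \<in> R\<close> y by simp
  qed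
  have eq: "\<lfloor>2 ^ j * z\<rfloor> = \<lfloor>2 ^ j * y\<rfloor>" if "j \<le> k" for j
    using cell that by (simp add: floor_dyadic_coarsen[of j k] k_def)
  have iff: "inj_on (\<lambda>x. \<lfloor>2 ^ j * x\<rfloor>) (insert z R) \<longleftrightarrow> inj_on (\<lambda>x. \<lfloor>2 ^ j * x\<rfloor>) (insert y R)"
    if "j \<le> k" for j
    using y z by (simp add: eq[OF that])
  have not: "\<not> inj_on (\<lambda>x. \<lfloor>2 ^ j * x\<rfloor>) (insert y R)" if "j < k" for j
    using that not_less_Least unfolding k_def sep_level_def by blast
  have "(LEAST j. inj_on (\<lambda>x. \<lfloor>2 ^ j * x\<rfloor>) (insert z R)) = k"
  proof (rule Least_equality)
    show "inj_on (\<lambda>x. \<lfloor>2 ^ k * x\<rfloor>) (insert z R)" using iff[of k] inj by blast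
    show "k \<le> j" if "inj_on (\<lambda>x. \<lfloor>2 ^ j * x\<rfloor>) (insert z R)" for j
      using that iff[of j] not[of j] by (metis le_cases not_less)
  qed
  then show "sep_level (insert z R) = sep_level (insert y R)" by (simp add: sep_level_def k_def)
qed

section \<open>Lengths inside a dyadic cell\<close>

lemma emeasure_lborel_affine_vimage:
  fixes t c :: real
  assumes S: "S \<in> sets borel" and c: "c > 0"
  shows "emeasure lborel {x. t + c * x \<in> S} = emeasure lborel S / ennreal c"
proof -
  have "{x. t + c * x \<in> S} = (\<lambda>x. t + c * x) -` S \<inter> space borel" by auto
  also have "\<dots> \<in> sets borel" using S by (intro measurable_sets[of _ borel borel]) auto
  finally have [measurable]: "{x. t + c * x \<in> S} \<in> sets borel" .
  have "emeasure lborel S = (\<integral>\<^sup>+x. indicator S x \<partial>lborel)" using S by simp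
  also have "\<dots> = ennreal c * (\<integral>\<^sup>+x. indicator S (t + c * x) \<partial>lborel)"
    using S c by (subst nn_integral_real_affine[where t=t and c=c]) auto
  also have "(\<integral>\<^sup>+x. indicator S (t + c * x) \<partial>lborel) = (\<integral>\<^sup>+x. indicator {x. t + c * x \<in> S} x \<partial>lborel)"
    by (intro nn_integral_cong) (auto simp: indicator_def)
  also have "\<dots> = emeasure lborel {x. t + c * x \<in> S}" by (subst nn_integral_indicator) auto
  finally have "emeasure lborel S = emeasure lborel {x. t + c * x \<in> S} * ennreal c"
    by (simp only: mult.commute)
  then show ?thesis using c by (simp add: mult_divide_eq_ennreal)
qed

text \<open>On the cell, \<open>m * y - q\<close> runs once through [0,1), and adding
  \<open>c\<close> modulo 1 is a rotation, which preserves length. \<open>X\<close> is the part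
  before the rotation wraps around, \<open>Y\<close> the part after.\<close>

lemma emeasure_frac_cell:
  fixes m c :: real and q :: int
  assumes S: "S \<in> sets borel" "S \<subseteq> {0..<1}" and m: "m > 0"
  shows "{y. \<lfloor>m * y\<rfloor> = q \<and> frac (m * y + c) \<in> S} \<in> sets borel"
    "emeasure lborel {y. \<lfloor>m * y\<rfloor> = q \<and> frac (m * y + c) \<in> S} = emeasure lborel S / ennreal m"
proof -
  define d where "d = frac c"
  have d: "0 \<le> d" "d < 1" by (simp_all add: d_def frac_lt_1)
  define X where "X = {y. (d - q) + m * y \<in> S \<inter> {d..<1}}"
  define Y where "Y = {y. (d - 1 - q) + m * y \<in> S \<inter> {0..<d}}"
  have X: "y \<in> X \<longleftrightarrow> m * y - q + d \<in> S \<and> d \<le> m * y - q + d \<and> m * y - q + d < 1" for y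
  proof -
    have "(d - q) + m * y = m * y - q + d" by simp
    then show ?thesis unfolding X_def by (simp only: mem_Collect_eq Int_iff atLeastLessThan_iff)
  qed
  have Y: "y \<in> Y \<longleftrightarrow> m * y - q + d - 1 \<in> S \<and> 0 \<le> m * y - q + d - 1 \<and> m * y - q + d - 1 < d" for y
  proof -
    have "(d - 1 - q) + m * y = m * y - q + d - 1" by simp
    then show ?thesis unfolding Y_def by (simp only: mem_Collect_eq Int_iff atLeastLessThan_iff)
  qed
  have [measurable]: "X \<in> sets borel" "Y \<in> sets borel"
  proof -
    have "X = (\<lambda>y. (d - q) + m * y) -` (S \<inter> {d..<1}) \<inter> space borel"
      "Y = (\<lambda>y. (d - 1 - q) + m * y) -` (S \<inter> {0..<d}) \<inter> space borel" by (auto simp: X_def Y_def)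
    moreover have "(\<lambda>y. (d - q) + m * y) -` (S \<inter> {d..<1}) \<inter> space borel \<in> sets borel"
      using S by (intro measurable_sets[of _ borel borel]) auto
    moreover have "(\<lambda>y. (d - 1 - q) + m * y) -` (S \<inter> {0..<d}) \<inter> space borel \<in> sets borel"
      using S by (intro measurable_sets[of _ borel borel]) auto
    ultimately show "X \<in> sets borel" "Y \<in> sets borel" by simp_all
  qed
  have frac1: "frac (m * y + c) = m * y - q + d" if "\<lfloor>m * y\<rfloor> = q" "m * y - q + d < 1" for y
  proof -
    have "m * y + c = (m * y - q + d) + of_int (q + \<lfloor>c\<rfloor>)" by (simp add: d_def frac_def)
    moreover have "0 \<le> m * y - q + d" using that d by linarith
    ultimately show ?thesis using that(2) by (metis frac_unique_iff Ints_of_int add_diff_cancel_left' add.commute)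
  qed
  have frac2: "frac (m * y + c) = m * y - q + d - 1" if "\<lfloor>m * y\<rfloor> = q" "m * y - q + d \<ge> 1" for y
  proof -
    have "m * y + c = (m * y - q + d - 1) + of_int (q + 1 + \<lfloor>c\<rfloor>)" by (simp add: d_def frac_def)
    moreover have "m * y - q + d - 1 < 1" using that d by linarith
    ultimately show ?thesis using that(2) by (metis frac_unique_iff Ints_of_int add_diff_cancel_left' add.commute diff_ge_0_iff_ge)
  qed
  have eq: "{y. \<lfloor>m * y\<rfloor> = q \<and> frac (m * y + c) \<in> S} = X \<union> Y"
  proof (intro equalityI subsetI)
    fix y assume "y \<in> {y. \<lfloor>m * y\<rfloor> = q \<and> frac (m * y + c) \<in> S}"
    then have y: "\<lfloor>m * y\<rfloor> = q" "frac (m * y + c) \<in> S" by auto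
    then have "0 \<le> m * y - q" "m * y - q < 1" by linarith+
    then show "y \<in> X \<union> Y"
      using y frac1[OF y(1)] frac2[OF y(1)] d
      by (cases "m * y - q + d < 1") (simp_all add: X Y)
  next
    fix y assume "y \<in> X \<union> Y"
    then show "y \<in> {y. \<lfloor>m * y\<rfloor> = q \<and> frac (m * y + c) \<in> S}"
    proof
      assume "y \<in> X"
      then have *: "m * y - q + d \<in> S" "d \<le> m * y - q + d" "m * y - q + d < 1"
        by (simp_all add: X)
      then have "\<lfloor>m * y\<rfloor> = q" using d by (intro floor_unique) linarith+
      then show ?thesis using frac1[of y] * by simp
    next
      assume "y \<in> Y"
      then have *: "m * y - q + d - 1 \<in> S" "0 \<le> m * y - q + d - 1" "m * y - q + d - 1 < d"
        by (simp_all add: Y)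
      then have "\<lfloor>m * y\<rfloor> = q" using d by (intro floor_unique) linarith+
      then show ?thesis using frac2[of y] * by simp
    qed
  qed
  show "{y. \<lfloor>m * y\<rfloor> = q \<and> frac (m * y + c) \<in> S} \<in> sets borel" unfolding eq by measurable
  have "X \<inter> Y = {}"
  proof -
    have "False" if "y \<in> X" "y \<in> Y" for y using that d by (simp add: X Y)
    then show ?thesis by blast
  qed
  then have "emeasure lborel (X \<union> Y) = emeasure lborel X + emeasure lborel Y"
    by (intro plus_emeasure[symmetric]) auto
  also have "\<dots> = emeasure lborel (S \<inter> {d..<1}) / ennreal m + emeasure lborel (S \<inter> {0..<d}) / ennreal m"
    unfolding X_def Y_def using S m by (intro arg_cong2[where f="(+)"] emeasure_lborel_affine_vimage) auto
  also have "\<dots> = (emeasure lborel (S \<inter> {d..<1}) + emeasure lborel (S \<inter> {0..<d})) / ennreal m"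
    by (simp add: add_divide_distrib_ennreal)
  also have "emeasure lborel (S \<inter> {d..<1}) + emeasure lborel (S \<inter> {0..<d}) = emeasure lborel S"
    using S d by (subst plus_emeasure) (auto intro!: arg_cong[where f="emeasure lborel"])
  finally show "emeasure lborel {y. \<lfloor>m * y\<rfloor> = q \<and> frac (m * y + c) \<in> S} = emeasure lborel S / ennreal m"
    by (simp add: eq)
qed

text \<open>Inside a dyadic cell the rank of the new point and the separation level are constant, while the
  phase sweeps the circle uniformly; so the new point is chosen with probability \<open>1/n\<close>.\<close>

lemma emeasure_victim_insert_cell:
  fixes q :: int
  assumes R: "finite R" and y0: "y0 \<notin> R" "sep_level (insert y0 R) = k" "\<lfloor>2 ^ k * y0\<rfloor> = q"
    and B: "B \<in> sets borel" "B \<subseteq> {0..<1}"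
  defines "D \<equiv> {y. \<lfloor>2 ^ k * y\<rfloor> = q \<and> victim (insert y R) = y \<and> seed (insert y R) \<in> B}"
  shows "D \<in> sets borel"
    "emeasure lborel D = emeasure lborel {y::real. \<lfloor>2 ^ k * y\<rfloor> = q} * (emeasure lborel B / of_nat (Suc (card R)))"
proof -
  define n where "n = Suc (card R)"
  \<comment> \<open>\<open>j\<close> is the rank of any new point in cell \<open>q\<close>, and
    \<open>S\<close> is the set of phases with slot \<open>j\<close> and seed in \<open>B\<close>.
    Since \<open>B\<close> lies in [0,1), \<open>n * p - j \<in> B\<close> already forces the slot
    to be \<open>j\<close>.\<close>
  define j where "j = card {r\<in>R. \<lfloor>2 ^ k * r\<rfloor> < q}"
  define S where "S = {p. - real j + real n * p \<in> B}"
  have jn: "j < n"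
    unfolding j_def n_def less_Suc_eq_le using R by (intro card_mono) auto
  have S_bd: "0 \<le> p \<and> p < 1" if "p \<in> S" for p
  proof -
    have p: "real j \<le> real n * p" "real n * p < real j + 1" using B(2) that by (auto simp: S_def)
    have "real n * p < real n" using p(2) jn by linarith
    moreover have "0 \<le> real n * p" using p(1) by (smt (verit) of_nat_0_le_iff)
    ultimately show ?thesis using jn by (simp add: zero_le_mult_iff)
  qed
  have S: "S \<in> sets borel" "S \<subseteq> {0..<1}"
  proof -
    have "S = (\<lambda>p. - real j + real n * p) -` B \<inter> space borel" by (auto simp: S_def)
    also have "\<dots> \<in> sets borel" using B by (intro measurable_sets[of _ borel borel]) auto
    finally show "S \<in> sets borel" .
  qed (use S_bd in auto)
  have Siff: "p \<in> S \<longleftrightarrow> nat \<lfloor>real n * p\<rfloor> = j \<and> frac (real n * p) \<in> B" if "0 \<le> p" for p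
  proof
    assume "p \<in> S"
    then have *: "real n * p - real j \<in> B" "0 \<le> real n * p - real j" "real n * p - real j < 1"
      using B(2) by (auto simp: S_def)
    then have "\<lfloor>real n * p\<rfloor> = int j" by (intro floor_unique) auto
    then show "nat \<lfloor>real n * p\<rfloor> = j \<and> frac (real n * p) \<in> B" using * by (simp add: frac_def)
  next
    assume *: "nat \<lfloor>real n * p\<rfloor> = j \<and> frac (real n * p) \<in> B"
    then have "\<lfloor>real n * p\<rfloor> = int j" using that by auto
    then show "p \<in> S" using * by (simp add: S_def frac_def)
  qed
  have D: "D = {y. \<lfloor>2 ^ k * y\<rfloor> = q \<and> frac (2 ^ k * y + 2 ^ k * \<Sum>R) \<in> S}"
  proof -
    have "victim (insert y R) = y \<and> seed (insert y R) \<in> B \<longleftrightarrow> frac (2 ^ k * y + 2 ^ k * \<Sum>R) \<in> S"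
      if y: "\<lfloor>2 ^ k * y\<rfloor> = q" for y
    proof -
      have c: "y \<notin> R" "sep_level (insert y R) = k"
        using sep_level_insert_cong[OF R y0(1), of y] y0 y by auto
      have inj: "inj_on (\<lambda>x. \<lfloor>2 ^ k * x\<rfloor>) (insert y R)"
        using sep_level_inj_on[of "insert y R"] R c by simp
      have "r < y \<longleftrightarrow> \<lfloor>2 ^ k * r\<rfloor> < q" if "r \<in> R" for r
      proof -
        have ne: "\<lfloor>2 ^ k * r\<rfloor> \<noteq> \<lfloor>2 ^ k * y\<rfloor>" using inj_onD[OF inj, of r y] that c(1) by auto
        show ?thesis
        proof
          assume "r < y"
          then have "\<lfloor>2 ^ k * r\<rfloor> \<le> \<lfloor>2 ^ k * y\<rfloor>" by (intro floor_mono) simp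
          then show "\<lfloor>2 ^ k * r\<rfloor> < q" using ne y by simp
        next
          assume "\<lfloor>2 ^ k * r\<rfloor> < q"
          then have "2 ^ k * r < 2 ^ k * y" using y floor_less_cancel by blast
          then show "r < y" by simp
        qed
      qed
      then have "{d \<in> insert y R. d < y} = {r\<in>R. \<lfloor>2 ^ k * r\<rfloor> < q}" by auto
      then have rank: "rank_in (insert y R) y = j" by (simp add: rank_in_def j_def)
      have card: "card (insert y R) = n" using R c by (simp add: n_def)
      have phase: "phase (insert y R) = frac (2 ^ k * y + 2 ^ k * \<Sum>R)"
        unfolding phase_def c(2) using R c(1) by (simp add: distrib_left)
      have "victim (insert y R) = y \<and> seed (insert y R) \<in> B \<longleftrightarrow>
        slot (insert y R) = j \<and> seed (insert y R) \<in> B"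
        using victim_eq_iff[of "insert y R" y] R rank by auto
      also have "\<dots> \<longleftrightarrow> frac (2 ^ k * y + 2 ^ k * \<Sum>R) \<in> S"
        using Siff[of "phase (insert y R)"] phase_bounds(1) by (simp add: slot_def seed_def card flip: phase)
      finally show ?thesis .
    qed
    then show ?thesis unfolding D_def by auto
  qed
  show "D \<in> sets borel" unfolding D using S by (intro emeasure_frac_cell) auto
  have "emeasure lborel D = emeasure lborel S / ennreal (2 ^ k)"
    unfolding D using S by (intro emeasure_frac_cell) auto
  also have "emeasure lborel S = emeasure lborel B / ennreal (real n)"
    unfolding S_def using B by (intro emeasure_lborel_affine_vimage) (auto simp: n_def)
  also have "emeasure lborel B / ennreal (real n) / ennreal (2 ^ k) =
      (1 / ennreal (2 ^ k)) * (emeasure lborel B / ennreal (real n))"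
    by (simp add: divide_ennreal_def mult_ac)
  also have "1 / ennreal (2 ^ k) = emeasure lborel {y::real. \<lfloor>2 ^ k * y\<rfloor> = q}"
  proof -
    have "{y::real. \<lfloor>2 ^ k * y\<rfloor> = q} = {y. \<lfloor>2 ^ k * y\<rfloor> = q \<and> frac (2 ^ k * y + 0) \<in> {0..<1}}"
      by (auto simp: frac_lt_1)
    then show ?thesis using emeasure_frac_cell(2)[of "{0..<1}" "2 ^ k" q 0] by simp
  qed
  finally show "emeasure lborel D = emeasure lborel {y::real. \<lfloor>2 ^ k * y\<rfloor> = q} * (emeasure lborel B / of_nat (Suc (card R)))"
    by (simp only: n_def ennreal_of_nat_eq_real_of_nat)
qed

text \<open>The positions outside \<open>R\<close> split into countably many disjoint cells of
  constant level, in each of which the wanted proportion is the same. The endpoint 1 is left out so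
  that cells fit exactly into the interval.\<close>

lemma emeasure_victim_insert:
  assumes R: "finite R" and B: "B \<in> sets borel" "B \<subseteq> {0..<1}"
  defines "D \<equiv> {y \<in> {0..<1} - R. victim (insert y R) = y \<and> seed (insert y R) \<in> B}"
  shows "D \<in> sets borel" "emeasure lborel D = emeasure lborel B / of_nat (Suc (card R))"
proof -
  define cell where "cell = (\<lambda>(k::nat, q::int). {y::real. \<lfloor>2 ^ k * y\<rfloor> = q})"
  define D' where "D' v = {y \<in> cell v. victim (insert y R) = y \<and> seed (insert y R) \<in> B}" for v
  define level where "level y = sep_level (insert y R)" for y
  \<comment> \<open>Only the pairs of level and cell that occur. By
    \<open>sep_level_insert_cong\<close> one occurring position makes its whole cell occur.\<close>
  define V where "V = (\<lambda>y. (level y, \<lfloor>2 ^ level y * y\<rfloor>)) ` ({0..<1} - R)"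
  have V: "\<exists>y. y \<in> {0..<1} - R \<and> level y = k \<and> \<lfloor>2 ^ k * y\<rfloor> = q" if "(k, q) \<in> V" for k q
    using that by (auto simp: V_def)
  have cell_V: "z \<in> {0..<1} - R \<and> level z = k" if kq: "(k, q) \<in> V" and z: "z \<in> cell (k, q)" for k q z
  proof -
    obtain y where y: "y \<in> {0..<1} - R" "level y = k" "\<lfloor>2 ^ k * y\<rfloor> = q" using V[OF kq] by auto
    have "0 \<le> q" "q < 2 ^ k"
    proof -
      show "0 \<le> q" using y by auto
      have "2 ^ k * y < 2 ^ k" using y by simp
      then show "q < 2 ^ k" using y(3) by (simp add: floor_less_iff flip: y(3))
    qed
    have "\<lfloor>2 ^ k * z\<rfloor> = q" using z by (simp add: cell_def)
    with \<open>0 \<le> q\<close> have "0 \<le> 2 ^ k * z" by linarith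
    moreover have "2 ^ k * z < 2 ^ k"
    proof -
      have "2 ^ k * z < real_of_int q + 1" using \<open>\<lfloor>2 ^ k * z\<rfloor> = q\<close> by linarith
      also have "\<dots> \<le> real_of_int (2 ^ k)" using \<open>q < 2 ^ k\<close> by (metis of_int_1 of_int_add of_int_le_iff zless_imp_add1_zle)
      finally show ?thesis by simp
    qed
    ultimately have "z \<in> {0..<1}" using zero_le_mult_iff[of "2 ^ k" z] by (auto simp flip: not_less)
    moreover have "z \<notin> R" "level z = k"
      using sep_level_insert_cong[OF R, of y z] y z by (auto simp: level_def cell_def)
    ultimately show ?thesis by simp
  qed
  have cover: "{0..<1} - R = (\<Union>v\<in>V. cell v)"
  proof (intro equalityI subsetI)
    fix y assume "y \<in> {0..<1} - R"
    then show "y \<in> (\<Union>v\<in>V. cell v)" unfolding V_def by (auto simp: cell_def)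
  next
    fix z assume "z \<in> (\<Union>v\<in>V. cell v)"
    then show "z \<in> {0..<1} - R" using cell_V by (metis UN_E surj_pair)
  qed
  have disj: "disjoint_family_on cell V"
    unfolding disjoint_family_on_def
  proof (intro ballI impI)
    fix v w assume vw: "v \<in> V" "w \<in> V" "v \<noteq> w"
    obtain k q l r where [simp]: "v = (k, q)" "w = (l, r)" by fastforce
    have False if z: "z \<in> cell v" "z \<in> cell w" for z
    proof -
      have "level z = k" "level z = l" using cell_V[of k q z] cell_V[of l r z] vw z by simp_all
      then show False using z vw by (simp add: cell_def)
    qed
    then show "cell v \<inter> cell w = {}" by blast
  qed
  have countable: "countable V" by (rule countableI_type)
  have D_eq: "D = (\<Union>v\<in>V. D' v)"
  proof -
    have "D = (\<Union>v\<in>V. cell v) \<inter> {y. victim (insert y R) = y \<and> seed (insert y R) \<in> B}"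
      unfolding D_def cover[symmetric] by auto
    also have "\<dots> = (\<Union>v\<in>V. D' v)" by (auto simp: D'_def)
    finally show ?thesis .
  qed
  have D': "D' v \<in> sets borel \<and>
      emeasure lborel (D' v) = emeasure lborel (cell v) * (emeasure lborel B / of_nat (Suc (card R)))"
    if v: "v \<in> V" for v
  proof -
    obtain k q where kq: "v = (k, q)" by (cases v)
    obtain y where y: "y \<notin> R" "sep_level (insert y R) = k" "\<lfloor>2 ^ k * y\<rfloor> = q"
      using V[of k q] v unfolding kq level_def by blast
    have "D' v = {y. \<lfloor>2 ^ k * y\<rfloor> = q \<and> victim (insert y R) = y \<and> seed (insert y R) \<in> B}"
      unfolding D'_def kq cell_def by simp
    moreover have "cell v = {y. \<lfloor>2 ^ k * y\<rfloor> = q}" unfolding kq cell_def by simp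
    ultimately show ?thesis using emeasure_victim_insert_cell[OF R y B] by (simp only:)
  qed
  have cell: "cell v \<in> sets borel" for v
  proof (cases v)
    case (Pair k q)
    have "cell v = {y. \<lfloor>2 ^ k * y\<rfloor> = q \<and> frac (2 ^ k * y + 0) \<in> {0..<1}}"
      by (auto simp: cell_def Pair frac_lt_1)
    also have "\<dots> \<in> sets borel" by (rule emeasure_frac_cell(1)) simp_all
    finally show ?thesis .
  qed
  have "D' v \<in> sets borel" if "v \<in> V" for v using D'[OF that] by simp
  then show "D \<in> sets borel" unfolding D_eq by (rule sets.countable_UN''[OF countable])
  have "emeasure lborel D = (\<integral>\<^sup>+v. emeasure lborel (D' v) \<partial>count_space V)"
    unfolding D_eq
  proof (intro emeasure_UN_countable countable)
    show "disjoint_family_on D' V"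
      by (rule disjoint_family_on_bisimulation[OF disj]) (auto simp: D'_def)
  qed (use D' in simp)
  also have "\<dots> = (\<integral>\<^sup>+v. emeasure lborel (cell v) * (emeasure lborel B / of_nat (Suc (card R))) \<partial>count_space V)"
    by (rule nn_integral_cong) (use D' in simp)
  also have "\<dots> = (\<integral>\<^sup>+v. emeasure lborel (cell v) \<partial>count_space V) * (emeasure lborel B / of_nat (Suc (card R)))"
    by (rule nn_integral_multc) simp
  also have "(\<integral>\<^sup>+v. emeasure lborel (cell v) \<partial>count_space V) = emeasure lborel ({0..<1} - R)"
    unfolding cover using cell countable disj by (intro emeasure_UN_countable[symmetric]) auto
  also have "\<dots> = 1"
  proof -
    have "R \<in> null_sets lborel"
      using R by (intro null_setsI emeasure_lborel_countable) (auto simp: countable_finite finite_imp_closed)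
    then show ?thesis by (subst emeasure_Diff_null_set) auto
  qed
  finally show "emeasure lborel D = emeasure lborel B / of_nat (Suc (card R))" by simp
qed

section \<open>Measurability of the deletion rule\<close>

lemma sets_borel_Int_unit_borel [simp]: "A \<in> sets borel \<Longrightarrow> {0..1} \<inter> A \<in> sets unit_borel"
  by (auto simp: sets_unit_borel_iff)

lemma card_points_Int:
  assumes "\<nu> \<in> simple_point_measures" "A \<in> sets borel"
  shows "emeasure \<nu> ({0..1} \<inter> A) = of_nat (card (points \<nu> \<inter> A))"
proof -
  have "points \<nu> \<inter> ({0..1} \<inter> A) = points \<nu> \<inter> A" using finite_points[OF assms(1)] by auto
  then show ?thesis using assms by (simp add: emeasure_eq_card_points)
qed

lemma measurable_card_points_Int [measurable]:
  assumes A: "A \<in> sets borel"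
  shows "(\<lambda>\<nu>. card (points \<nu> \<inter> A)) \<in> measurable configurations (count_space UNIV)"
proof (rule measurable_count_space_eq2_countable[THEN iffD2], intro conjI ballI)
  fix n :: nat
  have "(\<lambda>\<nu>. emeasure \<nu> ({0..1} \<inter> A)) -` {of_nat n} \<inter> space configurations \<in> sets configurations"
    using A by (intro measurable_sets[OF measurable_emeasure_configurations]) auto
  also have "(\<lambda>\<nu>. emeasure \<nu> ({0..1} \<inter> A)) -` {of_nat n} \<inter> space configurations =
      (\<lambda>\<nu>. card (points \<nu> \<inter> A)) -` {n} \<inter> space configurations"
    using A by (auto simp: card_points_Int)
  finally show "(\<lambda>\<nu>. card (points \<nu> \<inter> A)) -` {n} \<inter> space configurations \<in> sets configurations" .
qed simp_all

lemma measurable_card_points [measurable]: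
  "(\<lambda>\<nu>. card (points \<nu>)) \<in> measurable configurations (count_space UNIV)"
  using measurable_card_points_Int[of UNIV] by simp

lemma measurable_sep_level [measurable]:
  "(\<lambda>\<nu>. sep_level (points \<nu>)) \<in> measurable configurations (count_space UNIV)"
  unfolding sep_level_def
proof (rule measurable_Least)
  fix k
  define cell where "cell q = {x::real. \<lfloor>2 ^ k * x\<rfloor> = q}" for q :: int
  have cell: "cell q \<in> sets borel" for q
  proof -
    have "(\<lambda>x::real. \<lfloor>2 ^ k * x\<rfloor>) \<in> measurable borel (count_space UNIV)" by measurable
    then have "(\<lambda>x::real. \<lfloor>2 ^ k * x\<rfloor>) -` {q} \<inter> space borel \<in> sets borel"
      by (rule measurable_sets) simp
    then show ?thesis by (simp add: cell_def vimage_def)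
  qed
  \<comment> \<open>Separation at level k says that each of countably many cells holds at most one
    point, a condition on counts.\<close>
  have iff: "inj_on (\<lambda>x. \<lfloor>2 ^ k * x\<rfloor>) C \<longleftrightarrow> (\<forall>q. card (C \<inter> cell q) \<le> 1)" if C: "finite C" for C
  proof
    assume inj: "inj_on (\<lambda>x. \<lfloor>2 ^ k * x\<rfloor>) C"
    have "x = y" if "x \<in> C \<inter> cell q" "y \<in> C \<inter> cell q" for x y q
      using inj_onD[OF inj, of x y] that by (auto simp: cell_def)
    then show "\<forall>q. card (C \<inter> cell q) \<le> 1" using C by (auto simp: card_le_Suc0_iff_eq)
  next
    assume *: "\<forall>q. card (C \<inter> cell q) \<le> 1"
    show "inj_on (\<lambda>x. \<lfloor>2 ^ k * x\<rfloor>) C"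
    proof (rule inj_onI)
      fix x y assume "x \<in> C" "y \<in> C" "\<lfloor>2 ^ k * x\<rfloor> = \<lfloor>2 ^ k * y\<rfloor>"
      then have "x \<in> C \<inter> cell \<lfloor>2 ^ k * x\<rfloor>" "y \<in> C \<inter> cell \<lfloor>2 ^ k * x\<rfloor>" by (auto simp: cell_def)
      then show "x = y" using * C by (metis One_nat_def card_le_Suc0_iff_eq finite_Int)
    qed
  qed
  have "{\<nu> \<in> space configurations. \<forall>q. card (points \<nu> \<inter> cell q) \<le> 1} \<in> sets configurations"
    using measurable_card_points_Int[OF cell] by measurable
  also have "{\<nu> \<in> space configurations. \<forall>q. card (points \<nu> \<inter> cell q) \<le> 1} =
      {\<nu> \<in> space configurations. inj_on (\<lambda>x. \<lfloor>2 ^ k * x\<rfloor>) (points \<nu>)}"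
    by (intro Collect_cong conj_cong refl iff[symmetric] finite_points) simp
  finally show "Measurable.pred configurations (\<lambda>\<nu>. inj_on (\<lambda>x. \<lfloor>2 ^ k * x\<rfloor>) (points \<nu>))"
    unfolding pred_def .
qed

text \<open>Induction over Borel functions; for indicators the sum is a count.\<close>

lemma measurable_sum_points:
  fixes f :: "real \<Rightarrow> ennreal"
  assumes "f \<in> borel_measurable borel"
  shows "(\<lambda>\<nu>. \<Sum>x\<in>points \<nu>. f x) \<in> borel_measurable configurations"
  using assms
proof induction
  case (cong f g)
  then show ?case by simp
next
  case (set A)
  have "(\<Sum>x\<in>points \<nu>. indicator A x :: ennreal) = of_nat (card (points \<nu> \<inter> A))"
    if "\<nu> \<in> space configurations" for \<nu>
    using finite_points(1) that by (simp add: indicator_def sum.If_cases Int_def)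
  moreover have "(\<lambda>\<nu>. of_nat (card (points \<nu> \<inter> A)) :: ennreal) \<in> borel_measurable configurations"
    using set by measurable
  ultimately show ?case by (rule measurable_cong[THEN iffD2])
next
  case (mult u c)
  then show ?case by (simp flip: sum_distrib_left)
next
  case (add u v)
  then show ?case by (simp add: sum.distrib)
next
  case (seq U)
  have "(\<Sum>x\<in>C. (SUP i. U i) x) = (SUP i. \<Sum>x\<in>C. U i x)" for C
    unfolding SUP_apply using seq by (intro ennreal_SUP_sum[symmetric]) (auto simp: incseq_def le_fun_def)
  then show ?case using seq by simp
qed

lemma measurable_sum_points_real [measurable]: "(\<lambda>\<nu>. \<Sum>(points \<nu>)) \<in> borel_measurable configurations"
proof -
  have meas: "(\<lambda>\<nu>. enn2real (\<Sum>x\<in>points \<nu>. ennreal x)) \<in> borel_measurable configurations"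
    using measurable_sum_points[of ennreal] by measurable
  have "\<Sum>(points \<nu>) = enn2real (\<Sum>x\<in>points \<nu>. ennreal x)" if "\<nu> \<in> space configurations" for \<nu>
  proof -
    have "\<And>x. x \<in> points \<nu> \<Longrightarrow> 0 \<le> x" using finite_points[of \<nu>] that by auto
    then show ?thesis by (simp add: sum_ennreal sum_nonneg)
  qed
  then show ?thesis using meas by (rule measurable_cong[THEN iffD2])
qed

lemma borel_measurable_frac [measurable]: "(frac :: real \<Rightarrow> real) \<in> borel_measurable borel"
  unfolding frac_def[abs_def]
  by (intro borel_measurable_diff borel_measurable_real_floor measurable_ident_sets) simp_all

lemma measurable_real_card_points [measurable]:
  "(\<lambda>\<nu>. real (card (points \<nu>))) \<in> borel_measurable configurations"
  by (rule measurable_compose[OF measurable_card_points]) simp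

lemma measurable_phase [measurable]: "(\<lambda>\<nu>. phase (points \<nu>)) \<in> borel_measurable configurations"
proof -
  have "(\<lambda>\<nu>. frac (2 ^ k * \<Sum>(points \<nu>))) \<in> borel_measurable configurations" for k :: nat
    by (rule measurable_compose[OF _ borel_measurable_frac]) (intro borel_measurable_times
      measurable_sum_points_real borel_measurable_const)
  then show ?thesis unfolding phase_def by (rule measurable_compose_countable[OF _ measurable_sep_level])
qed

lemma measurable_card_times_phase:
  "(\<lambda>\<nu>. real (card (points \<nu>)) * phase (points \<nu>)) \<in> borel_measurable configurations"
  by (intro borel_measurable_times measurable_real_card_points measurable_phase)

lemma measurable_slot [measurable]:
  "(\<lambda>\<nu>. slot (points \<nu>)) \<in> measurable configurations (count_space UNIV)"
proof -
  have "(\<lambda>x::real. nat \<lfloor>x\<rfloor>) \<in> measurable borel (count_space UNIV)" by measurable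
  then show ?thesis unfolding slot_def by (rule measurable_compose[OF measurable_card_times_phase])
qed

lemma measurable_seed [measurable]: "(\<lambda>\<nu>. seed (points \<nu>)) \<in> borel_measurable configurations"
  unfolding seed_def by (rule measurable_compose[OF measurable_card_times_phase borel_measurable_frac])

text \<open>The victim is an order statistic: it is at most t exactly when more than
  \<open>slot C\<close> points are. This expresses its distribution function through counts and the
  slot, whence its measurability.\<close>

lemma victim_le_iff:
  assumes C: "finite C" "C \<noteq> {}"
  shows "victim C \<le> t \<longleftrightarrow> slot C < card (C \<inter> {..t})"
proof
  assume t: "victim C \<le> t"
  have "insert (victim C) {d\<in>C. d < victim C} \<subseteq> C \<inter> {..t}"
  proof
    fix d assume "d \<in> insert (victim C) {d\<in>C. d < victim C}"
    then have "d \<in> C" "d \<le> victim C" using victim(1)[OF C] by auto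
    then show "d \<in> C \<inter> {..t}" using t by simp
  qed
  then have "card (insert (victim C) {d\<in>C. d < victim C}) \<le> card (C \<inter> {..t})"
    using C(1) by (intro card_mono) simp_all
  moreover have "card (insert (victim C) {d\<in>C. d < victim C}) = Suc (slot C)"
    using C(1) victim(2)[OF C] by (subst card_insert_disjoint) (simp_all add: rank_in_def)
  ultimately show "slot C < card (C \<inter> {..t})" by simp
next
  assume *: "slot C < card (C \<inter> {..t})"
  show "victim C \<le> t"
  proof (rule ccontr)
    assume "\<not> victim C \<le> t"
    then have "C \<inter> {..t} \<subseteq> {d\<in>C. d < victim C}" by auto
    then have "card (C \<inter> {..t}) \<le> card {d\<in>C. d < victim C}" using C(1) by (intro card_mono) simp_all
    then show False using * victim(2)[OF C] by (simp add: rank_in_def)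
  qed
qed

lemma measurable_victim [measurable]:
  "(\<lambda>\<nu>. if points \<nu> = {} then 0 else victim (points \<nu>)) \<in> borel_measurable configurations"
proof (rule borel_measurableI_le)
  fix t :: real
  have nat: "(\<lambda>\<nu>. real (g \<nu>)) \<in> borel_measurable configurations"
    if "g \<in> measurable configurations (count_space UNIV)" for g :: "real measure \<Rightarrow> nat"
    by (rule measurable_compose[OF that]) simp
  have "{\<nu> \<in> space configurations. real (slot (points \<nu>)) < real (card (points \<nu> \<inter> {..t}))} \<in> sets configurations"
    by (intro borel_measurable_less nat measurable_slot measurable_card_points_Int) simp
  then have 1: "{\<nu> \<in> space configurations. slot (points \<nu>) < card (points \<nu> \<inter> {..t})} \<in> sets configurations"
    by simp
  have 2: "{\<nu> \<in> space configurations. card (points \<nu>) = 0} \<in> sets configurations"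
    using measurable_sets[OF measurable_card_points, of "{0}"] by (simp add: vimage_def Collect_conj_eq Int_commute)
  have "{\<nu> \<in> space configurations. if card (points \<nu>) = 0 then 0 \<le> t else slot (points \<nu>) < card (points \<nu> \<inter> {..t})}
      \<in> sets configurations"
    unfolding if_bool_eq_conj imp_conv_disj
    by (intro sets.sets_Collect_conj sets.sets_Collect_disj sets.sets_Collect_neg sets.sets_Collect_const 1 2)
  also have "{\<nu> \<in> space configurations. if card (points \<nu>) = 0 then 0 \<le> t else slot (points \<nu>) < card (points \<nu> \<inter> {..t})} =
      {\<nu> \<in> space configurations. (if points \<nu> = {} then 0 else victim (points \<nu>)) \<le> t}"
  proof (intro Collect_cong conj_cong refl)
    fix \<nu> assume "\<nu> \<in> space configurations"
    then have fin: "finite (points \<nu>)" using finite_points by simp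
    then show "(if card (points \<nu>) = 0 then 0 \<le> t else slot (points \<nu>) < card (points \<nu> \<inter> {..t})) =
      ((if points \<nu> = {} then 0 else victim (points \<nu>)) \<le> t)"
      using victim_le_iff[OF fin] by simp
  qed
  finally show "{\<nu> \<in> space configurations. (if points \<nu> = {} then 0 else victim (points \<nu>)) \<le> t}
      \<in> sets configurations" .
qed

definition delete :: "real measure \<Rightarrow> real measure" where
  "delete \<nu> = config_of (points \<nu> - {victim (points \<nu>)})"

lemma delete_in_simple: "\<nu> \<in> simple_point_measures \<Longrightarrow> delete \<nu> \<in> simple_point_measures"
  unfolding delete_def using finite_points[of \<nu>] by (intro config_of_in_simple) auto

lemma points_delete:
  "\<nu> \<in> simple_point_measures \<Longrightarrow> points (delete \<nu>) = points \<nu> - {victim (points \<nu>)}"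
  unfolding delete_def using finite_points[of \<nu>] by (intro points_config_of) auto

lemma measurable_delete [measurable]: "delete \<in> measurable configurations configurations"
proof (rule measurable_configurationsI)
  fix A assume A: "A \<in> sets unit_borel"
  have [measurable]: "A \<in> sets borel" using A by (simp add: sets_unit_borel_iff)
  let ?v = "\<lambda>\<nu>. if points \<nu> = {} then 0 else victim (points \<nu>)"
  let ?P = "\<lambda>\<nu>. card (points \<nu>) \<noteq> 0 \<and> ?v \<nu> \<in> A"
  let ?g = "\<lambda>\<nu>. if ?P \<nu> then of_nat (card (points \<nu> \<inter> A) - 1) else of_nat (card (points \<nu> \<inter> A)) :: ennreal"
  have of_nat_if: "of_nat (c - (if Q then 1 else 0)) = (if Q then of_nat (c - 1) else of_nat c :: ennreal)" for c Q
    by simp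
  have "emeasure (delete \<nu>) A = ?g \<nu>" if "\<nu> \<in> space configurations" for \<nu>
  proof -
    have \<nu>: "\<nu> \<in> simple_point_measures" using that by simp
    note fin = finite_points[OF \<nu>]
    have "emeasure (delete \<nu>) A = of_nat (card ((points \<nu> - {victim (points \<nu>)}) \<inter> A))"
      using emeasure_eq_card_points[OF delete_in_simple[OF \<nu>] A] points_delete[OF \<nu>] by simp
    also have "(points \<nu> - {victim (points \<nu>)}) \<inter> A = (points \<nu> \<inter> A) - {victim (points \<nu>)}" by auto
    also have "card \<dots> = card (points \<nu> \<inter> A) - (if ?P \<nu> then 1 else 0)"
    proof (cases "points \<nu> = {}")
      case False
      have "victim (points \<nu>) \<in> points \<nu>" using victim(1)[OF fin(1) False] .
      then show ?thesis using fin False by (simp add: card_Diff_singleton_if)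
    qed simp
    also have "of_nat (card (points \<nu> \<inter> A) - (if ?P \<nu> then 1 else 0)) = ?g \<nu>"
      by (rule of_nat_if)
    finally show ?thesis .
  qed
  moreover have "?g \<in> borel_measurable configurations"
  proof (rule measurable_If)
    show "(\<lambda>\<nu>. of_nat (card (points \<nu> \<inter> A) - 1) :: ennreal) \<in> borel_measurable configurations"
      by (rule measurable_compose[OF measurable_card_points_Int[of A]]) simp_all
    show "(\<lambda>\<nu>. of_nat (card (points \<nu> \<inter> A)) :: ennreal) \<in> borel_measurable configurations"
      by (rule measurable_compose[OF measurable_card_points_Int[of A]]) simp_all
    have "{\<nu> \<in> space configurations. ?v \<nu> \<in> A} \<in> sets configurations"
      using measurable_sets[OF measurable_victim, of A] by (simp add: vimage_def Collect_conj_eq Int_commute)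
    moreover have "{\<nu> \<in> space configurations. card (points \<nu>) \<noteq> 0} \<in> sets configurations"
      using measurable_sets[OF measurable_card_points, of "- {0}"]
      by (simp add: vimage_def Collect_conj_eq Int_commute)
    ultimately show "{\<nu> \<in> space configurations. ?P \<nu>} \<in> sets configurations"
      by (intro sets.sets_Collect_conj)
  qed
  ultimately show "(\<lambda>\<nu>. emeasure (delete \<nu>) A) \<in> borel_measurable configurations"
    by (rule measurable_cong[THEN iffD2])
qed (simp add: delete_in_simple)

lemma measurable_delete_power [measurable]: "(delete ^^ i) \<in> measurable configurations configurations"
proof (induction i)
  case (Suc i)
  show ?case unfolding funpow.simps by (rule measurable_comp[OF Suc measurable_delete])
qed (simp add: id_def)

lemma sets_delete_seed_event:
  assumes E: "E \<in> sets configurations" and B: "B \<in> sets borel"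
  shows "{\<nu> \<in> simple_point_measures. delete \<nu> \<in> E \<and> seed (points \<nu>) \<in> B} \<in> sets configurations"
proof -
  have "{\<nu> \<in> simple_point_measures. delete \<nu> \<in> E \<and> seed (points \<nu>) \<in> B} =
      (delete -` E \<inter> space configurations) \<inter> ((\<lambda>\<nu>. seed (points \<nu>)) -` B \<inter> space configurations)"
    by auto
  also have "\<dots> \<in> sets configurations"
    by (intro sets.Int measurable_sets[OF measurable_delete E] measurable_sets[OF measurable_seed B])
  finally show ?thesis .
qed

section \<open>The law of the configuration after a deletion\<close>

lemma delete_config_of_insert:
  assumes "finite R" "insert y R \<subseteq> {0..1}" "y \<notin> R" "victim (insert y R) = y"
  shows "delete (config_of (insert y R)) = config_of R"
  using assms by (simp add: delete_def)

text \<open>The product on the right says that the survivors are again uniform and independent of a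
  uniform seed. Given the other points, each coordinate is the victim with seed in \<open>B\<close>
  with the same probability \<open>c\<close>, whatever these points are; summing over the
  coordinates gives the length of \<open>B\<close>.\<close>

lemma binomial_law_delete_seed:
  assumes I: "finite I" "I \<noteq> {}" and E: "E \<in> sets configurations"
    and B: "B \<in> sets borel" "B \<subseteq> {0..<1}"
  shows "emeasure (binomial_law I) {\<nu> \<in> simple_point_measures. delete \<nu> \<in> E \<and> seed (points \<nu>) \<in> B} =
    emeasure (binomial_law {..<card I - 1}) E * emeasure lborel B"
proof -
  define W where "W = {\<nu> \<in> simple_point_measures. delete \<nu> \<in> E \<and> seed (points \<nu>) \<in> B}"
  have W: "W \<in> sets configurations" unfolding W_def by (rule sets_delete_seed_event[OF E B(1)])
  define P where "P J = PiM J (\<lambda>_::nat. unit_uniform)" for J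
  \<comment> \<open>The share of \<open>W\<close> on which coordinate \<open>i\<close> is the
    victim. Almost surely the coordinates differ, so exactly one index is responsible.\<close>
  define g :: "nat \<Rightarrow> (nat \<Rightarrow> real) \<Rightarrow> ennreal" where
    "g i x = (if victim (x ` I) = x i then indicator W (config_of (x ` I)) else 0)" for i x
  define c where "c = emeasure lborel B / of_nat (card I)"
  have W_meas: "(\<lambda>x. indicator W (config_of (x ` I)) :: ennreal) \<in> borel_measurable (P I)"
    unfolding P_def
    by (rule measurable_compose[OF measurable_config_of_image[OF I(1)] borel_measurable_indicator[OF W]])
  have pts: "points (config_of (x ` J)) = x ` J" "config_of (x ` J) \<in> simple_point_measures"
    if "x \<in> space (P J)" "finite J" for x J
    using space_PiM_unit_uniform_image[of x J] that unfolding P_def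
    by (auto intro!: points_config_of config_of_in_simple)
  have g_meas: "g i \<in> borel_measurable (P I)" if i: "i \<in> I" for i
    unfolding g_def
  proof (rule measurable_If[OF W_meas])
    let ?v = "\<lambda>\<nu>. if points \<nu> = {} then 0 else victim (points \<nu>)"
    have "(\<lambda>x. ?v (config_of (x ` I))) \<in> borel_measurable (P I)"
      unfolding P_def by (rule measurable_compose[OF measurable_config_of_image[OF I(1)] measurable_victim])
    then have "{x \<in> space (P I). ?v (config_of (x ` I)) = x i} \<in> sets (P I)"
      unfolding P_def by (rule borel_measurable_eq[OF _ measurable_component_unit_uniform[OF i]])
    also have "{x \<in> space (P I). ?v (config_of (x ` I)) = x i} = {x \<in> space (P I). victim (x ` I) = x i}"
      using I by (intro Collect_cong conj_cong refl) (simp add: pts)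
    finally show "{x \<in> space (P I). victim (x ` I) = x i} \<in> sets (P I)" .
  qed simp
  have g_sum: "AE x in P I. indicator W (config_of (x ` I)) = (\<Sum>i\<in>I. g i x)"
    using AE_PiM_unit_uniform_inj[OF I(1)] unfolding P_def[symmetric]
  proof eventually_elim
    case (elim x)
    have "victim (x ` I) \<in> x ` I" using I by (intro victim) auto
    then obtain j where j: "j \<in> I" "victim (x ` I) = x j" by auto
    have "g i x = 0" if "i \<in> I - {j}" for i
      using inj_onD[OF elim, of i j] that j by (auto simp: g_def)
    then have "(\<Sum>i\<in>I. g i x) = g j x"
      using sum.remove[OF I(1) j(1), of "\<lambda>i. g i x"] by simp
    then show ?case using j by (simp add: g_def)
  qed
  have g_int: "(\<integral>\<^sup>+x. g i x \<partial>P I) = emeasure (binomial_law {..<card I - 1}) E * c" if i: "i \<in> I" for i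
  proof -
    define J where "J = I - {i}"
    have J: "finite J" "i \<notin> J" "insert i J = I" "card J = card I - 1" "Suc (card J) = card I"
      using I i card_Suc_Diff1[OF I(1) i] by (auto simp: J_def)
    have "(\<integral>\<^sup>+x. g i x \<partial>P I) = (\<integral>\<^sup>+x. \<integral>\<^sup>+y. g i (x(i := y)) \<partial>unit_uniform \<partial>P J)"
      using g_meas[OF i] unfolding P_def J(3)[symmetric]
      by (rule unit_uniform_product.product_nn_integral_insert[OF J(1,2)])
    also have "\<dots> = (\<integral>\<^sup>+x. indicator E (config_of (x ` J)) * c \<partial>P J)"
    proof (rule nn_integral_cong_AE)
      show "AE x in P J. (\<integral>\<^sup>+y. g i (x(i := y)) \<partial>unit_uniform) = indicator E (config_of (x ` J)) * c"
        using AE_PiM_unit_uniform_inj[OF J(1)] AE_space unfolding P_def[symmetric]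
      proof eventually_elim
        case (elim x)
        let ?R = "x ` J"
        have R: "finite ?R" "?R \<subseteq> {0..1}" "card ?R = card J"
          using J(1) elim(1) space_PiM_unit_uniform_image[of x J] elim(2) card_image[OF elim(1)]
          by (auto simp: P_def)
        define D where "D = {y \<in> {0..<1} - ?R. victim (insert y ?R) = y \<and> seed (insert y ?R) \<in> B}"
        have D: "D \<in> sets borel" "emeasure lborel D = c"
          unfolding D_def c_def
          using emeasure_victim_insert[OF R(1) B] unfolding R(3) J(5) by (simp_all only:)
        have "D \<subseteq> {0..1}" unfolding D_def by auto
        with D(1) have D_sets: "D \<in> sets unit_uniform"
          unfolding sets_unit_uniform sets_unit_borel_iff by blast
        \<comment> \<open>The endpoint 1 is discarded together with the occupied positions, because
          \<open>D\<close> lives in [0,1).\<close>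
        have "AE y in unit_uniform. g i (x(i := y)) = indicator E (config_of ?R) * indicator D y"
          using AE_unit_uniform_notin[OF finite.insertI[OF R(1), of 1]] AE_space
        proof eventually_elim
          case (elim y)
          then have y: "y \<notin> ?R" "y \<in> {0..<1}" by auto
          have img: "(x(i := y)) ` I = insert y ?R"
            unfolding J(3)[symmetric] using J(2) by auto
          have g_y: "g i (x(i := y)) =
              (if victim (insert y ?R) = y then indicator W (config_of (insert y ?R)) else 0)"
            unfolding g_def img by (simp only: fun_upd_same)
          have sub: "insert y ?R \<subseteq> {0..1}" "finite (insert y ?R)" using R y by auto
          have simple: "config_of (insert y ?R) \<in> simple_point_measures"
            "points (config_of (insert y ?R)) = insert y ?R"
            using sub by simp_all
          show ?case
          proof (cases "victim (insert y ?R) = y")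
            case True
            then have "delete (config_of (insert y ?R)) = config_of ?R"
              using delete_config_of_insert[OF R(1) sub(1) y(1)] by simp
            then have "config_of (insert y ?R) \<in> W \<longleftrightarrow> config_of ?R \<in> E \<and> y \<in> D"
              using simple True y by (simp add: W_def D_def)
            then show ?thesis using True unfolding g_y by (simp add: indicator_def)
          next
            case False
            then show ?thesis unfolding g_y by (simp add: D_def)
          qed
        qed
        then have "(\<integral>\<^sup>+y. g i (x(i := y)) \<partial>unit_uniform) =
            (\<integral>\<^sup>+y. indicator E (config_of ?R) * indicator D y \<partial>unit_uniform)"
          by (rule nn_integral_cong_AE)
        also have "\<dots> = indicator E (config_of ?R) * emeasure unit_uniform D"
          by (rule nn_integral_cmult_indicator[OF D_sets])
        also have "emeasure unit_uniform D = c"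
          using D D_sets emeasure_unit_uniform[of D] unfolding sets_unit_uniform by simp
        finally show ?case .
      qed
    qed
    also have "\<dots> = (\<integral>\<^sup>+x. indicator E (config_of (x ` J)) \<partial>P J) * c"
      unfolding P_def by (rule nn_integral_multc)
        (rule measurable_compose[OF measurable_config_of_image[OF J(1)] borel_measurable_indicator[OF E]])
    also have "(\<integral>\<^sup>+x. indicator E (config_of (x ` J)) \<partial>P J) = (\<integral>\<^sup>+\<nu>. indicator E \<nu> \<partial>binomial_law J)"
      unfolding P_def binomial_law_def
      by (rule nn_integral_distr[symmetric, OF measurable_config_of_image[OF J(1)]])
        (rule borel_measurable_indicator, simp only: sets_distr E)
    also have "\<dots> = emeasure (binomial_law J) E"
      by (rule nn_integral_indicator) (simp only: sets_binomial_law E)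
    also have "binomial_law J = binomial_law {..<card I - 1}"
      using J by (intro binomial_law_cong_card) auto
    finally show ?thesis .
  qed
  have "emeasure (binomial_law I) W = (\<integral>\<^sup>+\<nu>. indicator W \<nu> \<partial>binomial_law I)"
    by (rule nn_integral_indicator[symmetric]) (simp only: sets_binomial_law W)
  also have "\<dots> = (\<integral>\<^sup>+x. indicator W (config_of (x ` I)) \<partial>P I)"
    unfolding P_def binomial_law_def
    by (rule nn_integral_distr[OF measurable_config_of_image[OF I(1)]])
      (rule borel_measurable_indicator, simp only: sets_distr W)
  also have "\<dots> = (\<integral>\<^sup>+x. (\<Sum>i\<in>I. g i x) \<partial>P I)"
    by (rule nn_integral_cong_AE[OF g_sum])
  also have "\<dots> = (\<Sum>i\<in>I. \<integral>\<^sup>+x. g i x \<partial>P I)"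
    by (rule nn_integral_sum[OF g_meas])
  also have "\<dots> = of_nat (card I) * (emeasure (binomial_law {..<card I - 1}) E * c)"
    using g_int by simp
  also have "\<dots> = emeasure (binomial_law {..<card I - 1}) E * (of_nat (card I) * c)"
    by (simp only: mult.left_commute)
  also have "of_nat (card I) * c = emeasure lborel B"
  proof -
    have "of_nat (card I) * c = emeasure lborel B * of_nat (card I) / of_nat (card I)"
      unfolding c_def by (simp only: ennreal_times_divide mult.commute)
    also have "\<dots> = emeasure lborel B"
      using I by (intro mult_divide_eq_ennreal) auto
    finally show ?thesis .
  qed
  finally show ?thesis unfolding W_def .
qed

lemma binomial_law_delete:
  assumes "n > 0" "E \<in> sets configurations"
  shows "emeasure (binomial_law {..<n}) (delete -` E \<inter> simple_point_measures) =
    emeasure (binomial_law {..<n - 1}) E"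
proof -
  have "seed C \<in> {0..<1}" for C by (simp add: seed_def frac_lt_1)
  then have "delete -` E \<inter> simple_point_measures =
      {\<nu> \<in> simple_point_measures. delete \<nu> \<in> E \<and> seed (points \<nu>) \<in> {0..<1}}"
    by blast
  moreover have "{..<n} \<noteq> {}" using assms(1) by blast
  ultimately show ?thesis using binomial_law_delete_seed[of "{..<n}" E "{0..<1}"] assms(2) by simp
qed

lemma binomial_law_delete_power:
  assumes "i \<le> n" "E \<in> sets configurations"
  shows "emeasure (binomial_law {..<n}) ((delete ^^ i) -` E \<inter> simple_point_measures) =
    emeasure (binomial_law {..<n - i}) E"
  using assms(1)
proof (induction i arbitrary: n)
  case 0
  have "E \<subseteq> simple_point_measures" using sets.sets_into_space[OF assms(2)] by simp
  then show ?case by (simp add: Int_absorb2)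
next
  case (Suc i)
  let ?F = "(delete ^^ i) -` E \<inter> simple_point_measures"
  have F: "?F \<in> sets configurations"
    using measurable_sets[OF measurable_delete_power assms(2), of i] by simp
  have "(delete ^^ Suc i) -` E \<inter> simple_point_measures = delete -` ?F \<inter> simple_point_measures"
    using delete_in_simple by (auto simp: funpow_swap1)
  then have "emeasure (binomial_law {..<n}) ((delete ^^ Suc i) -` E \<inter> simple_point_measures) =
      emeasure (binomial_law {..<n}) (delete -` ?F \<inter> simple_point_measures)"
    by (rule arg_cong)
  also have "\<dots> = emeasure (binomial_law {..<n - 1}) ?F"
    using Suc.prems by (intro binomial_law_delete F) simp
  also have "\<dots> = emeasure (binomial_law {..<n - 1 - i}) E"
    using Suc.prems by (intro Suc.IH) simp
  also have "n - 1 - i = n - Suc i" by simp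
  finally show ?case .
qed

section \<open>Coupling the numbers of points\<close>

lemma AE_binomial_law_card:
  assumes I: "finite I"
  shows "AE \<nu> in binomial_law I. card (points \<nu>) = card I"
proof -
  have set: "{\<nu> \<in> space configurations. card (points \<nu>) = card I} \<in> sets configurations"
    using measurable_sets[OF measurable_card_points, of "{card I}"]
    by (simp add: vimage_def Collect_conj_eq Int_commute)
  have "AE x in PiM I (\<lambda>_. unit_uniform). card (points (config_of (x ` I))) = card I"
    using AE_PiM_unit_uniform_inj[OF I] AE_space
  proof eventually_elim
    case (elim x)
    then show ?case
      using I space_PiM_unit_uniform_image[of x I] by (simp add: card_image)
  qed
  then show ?thesis
    unfolding binomial_law_def AE_distr_iff[OF measurable_config_of_image[OF I] set] .
qed

lemma suminf_ennreal_swap: "(\<Sum>i. \<Sum>j. f i j) = (\<Sum>j. \<Sum>i. f i j :: ennreal)"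
  using nn_integral_suminf[of "\<lambda>i j. f i j" "count_space (UNIV :: nat set)"]
  by (simp add: nn_integral_count_space_nat)

text \<open>The two conditions the construction needs: up to \<open>K\<close> points the target law
  has room for everything the source offers, and beyond \<open>K\<close> the source distribution
  function, read one place ahead, stays below that of the target.\<close>

locale thinning_coupling =
  fixes lam \<mu> :: real and K :: nat
  assumes \<mu>_pos: "0 < \<mu>" and \<mu>_less: "\<mu> < lam"
    and keep: "\<And>n. n \<le> K \<Longrightarrow> poisson_weight lam n \<le> poisson_weight \<mu> n"
    and drop: "\<And>m. K \<le> m \<Longrightarrow> (\<Sum>i\<le>Suc m. poisson_weight lam i) \<le> (\<Sum>i\<le>m. poisson_weight \<mu> i)"
begin

definition p :: "nat \<Rightarrow> real" where "p = poisson_weight lam"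

definition q :: "nat \<Rightarrow> real" where "q = poisson_weight \<mu>"

text \<open>\<open>p n\<close> is the length of \<open>[P n, P (n + 1))\<close>; the mass of \<open>q\<close> that is not used by the
  configurations with at most \<open>K\<close> points is spread over the intervals \<open>[G j, G (j + 1))\<close>.\<close>

definition P :: "nat \<Rightarrow> real" where "P n = (\<Sum>i<n. p i)"

definition r :: "nat \<Rightarrow> real" where "r j = (if j \<le> K then q j - p j else q j)"

definition G :: "nat \<Rightarrow> real" where "G j = P (Suc K) + (\<Sum>i<j. r i)"

text \<open>Inverse distribution function of the residual masses \<open>r\<close>, laid out from
  \<open>P (Suc K)\<close> up to 1.\<close>

definition target :: "real \<Rightarrow> nat" where "target t = (LEAST j. t < G (Suc j))"

text \<open>Given n points, \<open>P n + p n * seed\<close> is uniform on the interval that belongs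
  to n, so its quantile is the desired number of points. The subtraction never truncates: beyond
  \<open>K\<close> the target is below n.\<close>

definition thin :: "real measure \<Rightarrow> real measure" where
  "thin \<nu> = (let n = card (points \<nu>) in
    if n \<le> K then \<nu> else (delete ^^ (n - target (P n + p n * seed (points \<nu>)))) \<nu>)"

lemma p_pos: "p n > 0" and q_pos: "q n > 0"
  using \<mu>_pos \<mu>_less by (simp_all add: p_def q_def poisson_weight_def)

lemma P_Suc: "P (Suc n) = P n + p n" by (simp add: P_def)

lemma G_Suc: "G (Suc j) = G j + r j" by (simp add: G_def)

lemma G_0: "G 0 = P (Suc K)" by (simp add: G_def)

lemma r_nonneg: "r j \<ge> 0"
  using keep[of j] q_pos[of j] by (auto simp: r_def p_def q_def)

lemma mono_P: "i \<le> j \<Longrightarrow> P i \<le> P j"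
  by (rule lift_Suc_mono_le[of P]) (simp_all add: P_Suc less_imp_le[OF p_pos])

lemma mono_G: "i \<le> j \<Longrightarrow> G i \<le> G j"
  by (rule lift_Suc_mono_le[of G]) (simp_all add: G_Suc r_nonneg)

lemma P_LIMSEQ: "P \<longlonglongrightarrow> 1"
  using poisson_weight_sums[of lam] by (simp add: sums_def P_def[abs_def] p_def)

lemma P_le_1: "P n \<le> 1"
  using mono_P P_LIMSEQ by (intro LIMSEQ_le_const[OF P_LIMSEQ] exI[of _ n]) auto

text \<open>At \<open>Suc K\<close> the kept mass and the residuals \<open>q - p\<close> recombine
  to the distribution function of \<open>q\<close>; later residuals are \<open>q\<close>
  itself.\<close>

lemma G_eq: "K < j \<Longrightarrow> G j = (\<Sum>i<j. q i)"
proof (induction j)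
  case (Suc j)
  show ?case
  proof (cases "K < j")
    case True
    then show ?thesis using Suc by (simp add: G_Suc r_def)
  next
    case False
    then have "j = K" using Suc by simp
    moreover have "(\<Sum>i<Suc K. r i) = (\<Sum>i<Suc K. q i - p i)"
      by (rule sum.cong) (auto simp: r_def)
    ultimately show ?thesis by (simp only: G_def P_def sum_subtractf)
  qed
qed simp

lemma G_LIMSEQ: "G \<longlonglongrightarrow> 1"
proof -
  have "(\<lambda>j. \<Sum>i<j. q i) \<longlonglongrightarrow> 1"
    using poisson_weight_sums[of \<mu>] by (simp add: sums_def q_def)
  then show ?thesis
    by (rule Lim_transform_eventually)
      (auto simp: G_eq eventually_sequentially intro!: exI[of _ "Suc K"])
qed

lemma G_le_1: "G n \<le> 1"
  using mono_G G_LIMSEQ by (intro LIMSEQ_le_const[OF G_LIMSEQ] exI[of _ n]) auto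

text \<open>The hypothesis \<open>drop\<close> in terms of intervals: the one for n points ends
  before the masses of n and more target points begin. Hence at least one point is deleted, which
  entitles the construction to a seed.\<close>

lemma P_le_G: "K < n \<Longrightarrow> P (Suc n) \<le> G n"
  using drop[of "n - 1"]
  by (cases n) (simp_all add: G_eq P_def p_def q_def flip: lessThan_Suc_atMost)

lemma ex_less_G: "t < 1 \<Longrightarrow> \<exists>j. t < G (Suc j)"
  using order_tendstoD(1)[OF LIMSEQ_Suc[OF G_LIMSEQ], of t] by (auto simp: eventually_sequentially)

lemma target_eq_iff:
  assumes "P (Suc K) \<le> t" "t < 1"
  shows "target t = j \<longleftrightarrow> G j \<le> t \<and> t < G (Suc j)"
proof
  assume j: "target t = j"
  have "t < G (Suc j)" using LeastI_ex[OF ex_less_G[OF assms(2)]] j by (simp add: target_def)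
  moreover have "G j \<le> t"
  proof (cases j)
    case (Suc i)
    then show ?thesis using not_less_Least[of i "\<lambda>j. t < G (Suc j)"] j by (simp add: target_def)
  qed (use assms in \<open>simp add: G_0\<close>)
  ultimately show "G j \<le> t \<and> t < G (Suc j)" by simp
next
  assume j: "G j \<le> t \<and> t < G (Suc j)"
  show "target t = j" unfolding target_def
  proof (rule Least_equality)
    fix i assume "t < G (Suc i)"
    then have "G j < G (Suc i)" using j by simp
    then show "j \<le> i" using mono_G[of "Suc i" j] by (metis not_less not_less_eq_eq)
  qed (use j in simp)
qed

text \<open>The region where n source points are turned into j target points. Its length is the mass
  of the pair (n, j) in the coupling.\<close>

definition piece :: "nat \<Rightarrow> nat \<Rightarrow> real set" where
  "piece n j = (if n \<le> K then {} else {P n..<P (Suc n)} \<inter> {G j..<G (Suc j)})"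

lemma piece_empty: "n \<le> j \<Longrightarrow> piece n j = {}"
  using P_le_G[of n] mono_G[of n j] by (auto simp: piece_def)

text \<open>The intervals of the counts above \<open>K\<close> tile the stretch from
  \<open>P (Suc K)\<close> to 1, which contains the interval of j.\<close>

lemma suminf_piece: "(\<Sum>n. emeasure lborel (piece n j)) = ennreal (r j)"
proof -
  have disj: "piece m j \<inter> piece n j = {}" if "m < n" for m n
    using mono_P[of "Suc m" n] that by (auto simp: piece_def)
  have "disjoint_family (\<lambda>n. piece n j)"
    unfolding disjoint_family_on_def
  proof (intro ballI impI)
    fix m n :: nat assume "m \<noteq> n"
    then show "piece m j \<inter> piece n j = {}"
      using disj[of m n] disj[of n m] by (cases "m < n") auto
  qed
  then have "(\<Sum>n. emeasure lborel (piece n j)) = emeasure lborel (\<Union>n. piece n j)"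
    by (intro suminf_emeasure) (auto simp: piece_def)
  also have "(\<Union>n. piece n j) = {G j..<G (Suc j)}"
  proof (intro equalityI subsetI)
    fix t assume t: "t \<in> {G j..<G (Suc j)}"
    define n where "n = (LEAST n. t < P (Suc n))"
    have "t < 1" using t G_le_1[of "Suc j"] by simp
    then have "\<exists>n. t < P (Suc n)"
      using order_tendstoD(1)[OF LIMSEQ_Suc[OF P_LIMSEQ], of t] by (auto simp: eventually_sequentially)
    then have n: "t < P (Suc n)" unfolding n_def by (rule LeastI_ex)
    have "P (Suc K) \<le> t" using t mono_G[of 0 j] by (simp add: G_0)
    then have "K < n" using n mono_P[of "Suc n" "Suc K"] by (metis not_less not_less_eq_eq order.strict_trans2)
    then obtain m where m: "n = Suc m" by (cases n) auto
    have "P n \<le> t" using not_less_Least[of m "\<lambda>n. t < P (Suc n)"] m by (simp add: n_def)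
    then show "t \<in> (\<Union>n. piece n j)" using n t \<open>K < n\<close> by (auto simp: piece_def intro!: exI[of _ n])
  qed (auto simp: piece_def split: if_splits)
  also have "emeasure lborel {G j..<G (Suc j)} = ennreal (r j)"
    using r_nonneg by (simp add: G_Suc)
  finally show ?thesis .
qed

lemma measurable_target: "target \<in> measurable borel (count_space UNIV)"
  unfolding target_def[abs_def]
proof (rule measurable_Least)
  fix j
  have "{t \<in> space borel. t < G (Suc j)} \<in> sets borel" by simp
  then show "Measurable.pred borel (\<lambda>t. t < G (Suc j))" unfolding pred_def .
qed

lemma measurable_thin: "thin \<in> measurable configurations configurations"
proof -
  have "(\<lambda>\<nu>. if n \<le> K then \<nu> else (delete ^^ (n - target (P n + p n * seed (points \<nu>)))) \<nu>)
      \<in> measurable configurations configurations" for n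
  proof (cases "n \<le> K")
    case False
    have "(\<lambda>\<nu>. P n + p n * seed (points \<nu>)) \<in> borel_measurable configurations"
      by (intro borel_measurable_add borel_measurable_times borel_measurable_const measurable_seed)
    from measurable_compose[OF this measurable_target]
    have "(\<lambda>\<nu>. (delete ^^ (n - target (P n + p n * seed (points \<nu>)))) \<nu>) \<in> measurable configurations configurations"
      by (rule measurable_compose_countable[where f="\<lambda>j \<nu>. (delete ^^ (n - j)) \<nu>", rotated])
        (rule measurable_delete_power)
    with False show ?thesis by simp
  qed (simp add: measurable_ident_sets)
  then show ?thesis
    unfolding thin_def[abs_def] Let_def by (rule measurable_compose_countable[OF _ measurable_card_points])
qed

lemma points_thin: "\<nu> \<in> simple_point_measures \<Longrightarrow> points (thin \<nu>) \<subseteq> points \<nu>"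
proof -
  assume \<nu>: "\<nu> \<in> simple_point_measures"
  have "(delete ^^ i) \<nu> \<in> simple_point_measures \<and> points ((delete ^^ i) \<nu>) \<subseteq> points \<nu>" for i
    by (induction i) (use \<nu> in \<open>auto simp: points_delete delete_in_simple\<close>)
  then show "points (thin \<nu>) \<subseteq> points \<nu>" by (auto simp: thin_def Let_def)
qed

lemma binomial_law_thin_le:
  assumes n: "n \<le> K" and E: "E \<in> sets configurations"
  shows "emeasure (binomial_law {..<n}) (thin -` E \<inter> simple_point_measures) = emeasure (binomial_law {..<n}) E"
proof (rule emeasure_eq_AE)
  show "AE \<nu> in binomial_law {..<n}. \<nu> \<in> thin -` E \<inter> simple_point_measures \<longleftrightarrow> \<nu> \<in> E"
    using AE_binomial_law_card[OF finite_lessThan, of n] AE_space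
    by eventually_elim (use n in \<open>simp add: thin_def\<close>)
qed (use E measurable_sets[OF measurable_thin E] in simp_all)

text \<open>The seed selects j. It is independent of the configuration after the first deletion, so
  the further deletions still see uniform points and leave j of them.\<close>

lemma binomial_law_thin_gt:
  assumes n: "K < n" and E: "E \<in> sets configurations"
  shows "ennreal (p n) * emeasure (binomial_law {..<n}) (thin -` E \<inter> simple_point_measures) =
    (\<Sum>j. emeasure lborel (piece n j) * emeasure (binomial_law {..<j}) E)"
proof -
  define B where "B j = {u \<in> {0..<1}. target (P n + p n * u) = j}" for j
  \<comment> \<open>The exponent is one less than the number of deletions, because the first one is
    the deletion that releases the seed.\<close>
  define F where "F j = (delete ^^ (n - 1 - j)) -` E \<inter> simple_point_measures" for j
  define V where "V j = {\<nu> \<in> simple_point_measures. delete \<nu> \<in> F j \<and> seed (points \<nu>) \<in> B j}" for j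
  have F: "F j \<in> sets configurations" for j
    unfolding F_def using measurable_sets[OF measurable_delete_power E] by simp
  have B_eq: "B j = {u. P n + p n * u \<in> piece n j}" for j
  proof -
    have "u \<in> B j \<longleftrightarrow> P n + p n * u \<in> piece n j" for u
    proof (cases "u \<in> {0..<1}")
      case True
      have "P (Suc K) \<le> P n" using n by (intro mono_P) simp
      also have "P n \<le> P n + p n * u" using True p_pos[of n] by simp
      finally have "P (Suc K) \<le> P n + p n * u" .
      moreover have less: "P n + p n * u < P (Suc n)" using True p_pos[of n] by (simp add: P_Suc)
      then have "P n + p n * u < 1" using P_le_1[of "Suc n"] by simp
      ultimately have "target (P n + p n * u) = j \<longleftrightarrow> G j \<le> P n + p n * u \<and> P n + p n * u < G (Suc j)"
        by (rule target_eq_iff)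
      then show ?thesis using True n less p_pos[of n] by (simp add: B_def piece_def)
    next
      case False
      have "\<not> (P n \<le> P n + p n * u \<and> P n + p n * u < P (Suc n))"
        using False p_pos[of n] by (auto simp: P_Suc zero_le_mult_iff mult_less_cancel_left1)
      then show ?thesis using False n by (auto simp: B_def piece_def)
    qed
    then show ?thesis by blast
  qed
  have B_empty: "B j = {}" if "n \<le> j" for j
    using piece_empty[OF that] by (simp add: B_eq)
  have B: "B j \<in> sets borel" "B j \<subseteq> {0..<1}" for j
  proof -
    have "target -` {j} \<inter> space borel \<in> sets borel" by (rule measurable_sets[OF measurable_target]) simp
    moreover have "(\<lambda>u. P n + p n * u) \<in> borel_measurable borel" by simp
    ultimately have "(\<lambda>u. P n + p n * u) -` (target -` {j} \<inter> space borel) \<inter> space borel \<in> sets borel"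
      by (rule measurable_sets[rotated])
    then have "{0..<1} \<inter> ((\<lambda>u. P n + p n * u) -` (target -` {j} \<inter> space borel) \<inter> space borel) \<in> sets borel"
      by (rule sets.Int[rotated]) simp
    also have "{0..<1} \<inter> ((\<lambda>u. P n + p n * u) -` (target -` {j} \<inter> space borel) \<inter> space borel) = B j"
      by (auto simp: B_def)
    finally show "B j \<in> sets borel" .
  qed (auto simp: B_def)
  have V: "V j \<in> sets configurations" for j
    unfolding V_def by (rule sets_delete_seed_event[OF F B(1)])
  have law_V: "ennreal (p n) * emeasure (binomial_law {..<n}) (V j) =
      emeasure lborel (piece n j) * emeasure (binomial_law {..<j}) E" for j
  proof (cases "j < n")
    case True
    have "emeasure (binomial_law {..<n}) (V j) = emeasure (binomial_law {..<card {..<n} - 1}) (F j) * emeasure lborel (B j)"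
      unfolding V_def using n by (intro binomial_law_delete_seed F B) auto
    also have "emeasure (binomial_law {..<card {..<n} - 1}) (F j) = emeasure (binomial_law {..<j}) E"
      using binomial_law_delete_power[OF _ E, of "n - 1 - j" "n - 1"] True by (simp add: F_def)
    also have "emeasure lborel (B j) = emeasure lborel (piece n j) / ennreal (p n)"
      unfolding B_eq using p_pos by (intro emeasure_lborel_affine_vimage) (auto simp: piece_def)
    finally have "ennreal (p n) * emeasure (binomial_law {..<n}) (V j) =
        emeasure (binomial_law {..<j}) E * (emeasure lborel (piece n j) * ennreal (p n) / ennreal (p n))"
      by (simp add: ennreal_times_divide mult_ac)
    also have "emeasure lborel (piece n j) * ennreal (p n) / ennreal (p n) = emeasure lborel (piece n j)"
      using p_pos[of n] by (intro mult_divide_eq_ennreal) auto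
    finally show ?thesis by (simp add: mult.commute)
  next
    case False
    then have "V j = {}" "piece n j = {}" using B_empty[of j] piece_empty[of n j] by (auto simp: V_def)
    then show ?thesis by simp
  qed
  have "emeasure (binomial_law {..<n}) (thin -` E \<inter> simple_point_measures) =
      emeasure (binomial_law {..<n}) (\<Union>j. V j)"
  proof (rule emeasure_eq_AE)
    show "AE \<nu> in binomial_law {..<n}. \<nu> \<in> thin -` E \<inter> simple_point_measures \<longleftrightarrow> \<nu> \<in> (\<Union>j. V j)"
      using AE_binomial_law_card[OF finite_lessThan, of n] AE_space
    proof eventually_elim
      case (elim \<nu>)
      then have \<nu>: "\<nu> \<in> simple_point_measures" and card: "card (points \<nu>) = n" by simp_all
      define j where "j = target (P n + p n * seed (points \<nu>))"
      have "seed (points \<nu>) \<in> {0..<1}" by (simp add: seed_def frac_lt_1)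
      then have B_iff: "seed (points \<nu>) \<in> B i \<longleftrightarrow> i = j" for i by (auto simp: B_def j_def)
      then have "j < n" using B_empty[of j] by (metis empty_iff not_less)
      then have "n - j = Suc (n - 1 - j)" by simp
      then have "thin \<nu> = (delete ^^ (n - 1 - j)) (delete \<nu>)"
        using n by (simp add: thin_def card funpow_swap1 flip: j_def)
      then have "thin \<nu> \<in> E \<longleftrightarrow> delete \<nu> \<in> F j" using delete_in_simple[OF \<nu>] by (simp add: F_def)
      then show ?case using \<nu> B_iff by (auto simp: V_def)
    qed
    show "(\<Union>j. V j) \<in> sets (binomial_law {..<n})"
      unfolding sets_binomial_law using V by (intro sets.countable_UN) auto
  qed (use measurable_sets[OF measurable_thin E] in simp)
  also have "\<dots> = (\<Sum>j. emeasure (binomial_law {..<n}) (V j))"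
  proof (rule suminf_emeasure[symmetric])
    show "disjoint_family V" unfolding disjoint_family_on_def by (auto simp: V_def B_def)
    show "range V \<subseteq> sets (binomial_law {..<n})" unfolding sets_binomial_law using V by blast
  qed
  finally show ?thesis by (simp add: law_V flip: ennreal_suminf_cmult)
qed

lemma poisson_law_thin: "distr (poisson_law lam) configurations thin = poisson_law \<mu>"
proof (rule measure_eqI)
  fix E assume "E \<in> sets (distr (poisson_law lam) configurations thin)"
  then have E: "E \<in> sets configurations" by simp
  let ?T = "thin -` E \<inter> simple_point_measures"
  let ?b = "\<lambda>n. emeasure (binomial_law {..<n})"
  have lam: "lam > 0" using \<mu>_pos \<mu>_less by simp
  have T: "?T \<in> sets configurations" using measurable_sets[OF measurable_thin E] by simp
  \<comment> \<open>Mass that stays at n points and mass that arrives from larger counts add up to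
    the target weight.\<close>
  have kept: "(if n \<le> K then ennreal (p n) else 0) * ?b n E + ennreal (r n) * ?b n E = ennreal (q n) * ?b n E" for n
  proof -
    have "(if n \<le> K then ennreal (p n) else 0) + ennreal (r n) = ennreal (q n)"
      using p_pos[of n] r_nonneg[of n] by (auto simp: r_def simp flip: ennreal_plus)
    then show ?thesis by (simp flip: distrib_right)
  qed
  have "emeasure (distr (poisson_law lam) configurations thin) E = emeasure (poisson_law lam) ?T"
    using E measurable_thin by (subst emeasure_distr) (simp_all cong: measurable_cong_sets)
  also have "\<dots> = (\<Sum>n. ennreal (p n) * ?b n ?T)"
    unfolding p_def by (rule emeasure_poisson_law[OF lam T])
  also have "\<dots> = (\<Sum>n. (if n \<le> K then ennreal (p n) else 0) * ?b n E + (\<Sum>j. emeasure lborel (piece n j) * ?b j E))"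
  proof (rule suminf_cong)
    fix n
    show "ennreal (p n) * ?b n ?T =
      (if n \<le> K then ennreal (p n) else 0) * ?b n E + (\<Sum>j. emeasure lborel (piece n j) * ?b j E)"
    proof (cases "n \<le> K")
      case True
      then show ?thesis using binomial_law_thin_le[OF True E] by (simp add: piece_def)
    next
      case False
      then show ?thesis using binomial_law_thin_gt[OF _ E, of n] by simp
    qed
  qed
  also have "\<dots> = (\<Sum>n. (if n \<le> K then ennreal (p n) else 0) * ?b n E) +
      (\<Sum>n. \<Sum>j. emeasure lborel (piece n j) * ?b j E)"
    by (rule suminf_add[symmetric]) auto
  also have "(\<Sum>n. \<Sum>j. emeasure lborel (piece n j) * ?b j E) = (\<Sum>j. ennreal (r j) * ?b j E)"
    by (subst suminf_ennreal_swap) (simp add: ennreal_suminf_multc suminf_piece)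
  also have "(\<Sum>n. (if n \<le> K then ennreal (p n) else 0) * ?b n E) + (\<Sum>j. ennreal (r j) * ?b j E) =
      (\<Sum>n. (if n \<le> K then ennreal (p n) else 0) * ?b n E + ennreal (r n) * ?b n E)"
    by (rule suminf_add) auto
  also have "\<dots> = emeasure (poisson_law \<mu>) E"
    unfolding kept q_def by (rule emeasure_poisson_law[OF \<mu>_pos E, symmetric])
  finally show "emeasure (distr (poisson_law lam) configurations thin) E = emeasure (poisson_law \<mu>) E" .
qed simp

lemma thinning_thin: "thinning lam \<mu> thin"
  unfolding thinning_def
proof (intro conjI allI impI measurable_thin)
  fix M :: "real measure measure" and X assume "poisson_process lam M X"
  then have X: "prob_space M" "X \<in> measurable M configurations" "distr M configurations X = poisson_law lam"
    using poisson_process_iff_law[of lam M X] \<mu>_pos \<mu>_less by auto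
  have "distr M configurations (\<lambda>\<omega>. thin (X \<omega>)) = distr (distr M configurations X) configurations thin"
    using distr_distr[OF measurable_thin X(2)] by (simp add: comp_def)
  also have "\<dots> = poisson_law \<mu>" unfolding X(3) by (rule poisson_law_thin)
  finally show "poisson_process \<mu> M (\<lambda>\<omega>. thin (X \<omega>))"
    unfolding poisson_process_iff_law[OF \<mu>_pos] using X(1) measurable_compose[OF X(2) measurable_thin] by blast
  show "AE \<omega> in M. points (thin (X \<omega>)) \<subseteq> points (X \<omega>)"
    using measurable_space[OF X(2)] by (intro AE_I2 points_thin) simp
qed

end

section \<open>The upper bound\<close>

lemma poisson_weight_Suc: "poisson_weight a (Suc n) = poisson_weight a n * a / real (Suc n)"
  by (simp add: poisson_weight_def field_simps)

text \<open>The derivative of each weight is the previous weight minus itself, so the sum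
  telescopes.\<close>

lemma poisson_cdf_has_derivative:
  "((\<lambda>t. \<Sum>i\<le>m. poisson_weight t i) has_real_derivative - poisson_weight t m) (at t)"
proof (induction m)
  case 0
  show ?case by (auto simp: poisson_weight_def intro!: derivative_eq_intros)
next
  case (Suc m)
  have "((\<lambda>t. poisson_weight t (Suc m)) has_real_derivative
      poisson_weight t m - poisson_weight t (Suc m)) (at t)"
  proof -
    have exp: "((\<lambda>t. exp (- t)) has_real_derivative - exp (- t)) (at t)"
      by (auto intro!: derivative_eq_intros)
    have pow: "((\<lambda>t. t ^ Suc m) has_real_derivative real (Suc m) * t ^ m) (at t)"
      using DERIV_pow[of "Suc m" t] by simp
    have "((\<lambda>t. exp (- t) * t ^ Suc m / fact (Suc m)) has_real_derivative
        (exp (- t) * (real (Suc m) * t ^ m) - exp (- t) * t ^ Suc m) / fact (Suc m)) (at t)"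
      using DERIV_cdivide[OF DERIV_mult[OF exp pow], of "fact (Suc m)"]
      by (simp only: mult_minus_left mult.commute minus_add_distrib uminus_add_conv_diff)
    also have "(exp (- t) * (real (Suc m) * t ^ m) - exp (- t) * t ^ Suc m) / fact (Suc m) =
        real (Suc m) * (exp (- t) * t ^ m) / (real (Suc m) * fact m) - exp (- t) * t ^ Suc m / fact (Suc m)"
      by (simp add: diff_divide_distrib mult_ac del: of_nat_Suc)
    also have "\<dots> = poisson_weight t m - poisson_weight t (Suc m)"
      unfolding poisson_weight_def by (subst mult_divide_mult_cancel_left) simp_all
    finally show ?thesis by (simp only: poisson_weight_def)
  qed
  from DERIV_add[OF Suc this] show ?case by simp
qed

text \<open>Logarithms after cancelling the factorial. For intensities \<mu> + 1 and \<mu> it yields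
  the threshold \<open>1 / ln (1 + 1 / \<mu>)\<close>.\<close>

lemma poisson_weight_le_iff:
  assumes "0 < \<mu>" "0 < lam"
  shows "poisson_weight lam n \<le> poisson_weight \<mu> n \<longleftrightarrow> real n * ln (lam / \<mu>) \<le> lam - \<mu>"
proof -
  have "poisson_weight lam n \<le> poisson_weight \<mu> n \<longleftrightarrow> exp (- lam) * lam ^ n \<le> exp (- \<mu>) * \<mu> ^ n"
    by (simp add: poisson_weight_def divide_le_cancel)
  also have "\<dots> \<longleftrightarrow> ln (exp (- lam) * lam ^ n) \<le> ln (exp (- \<mu>) * \<mu> ^ n)"
    using assms by (subst ln_le_cancel_iff) auto
  also have "\<dots> \<longleftrightarrow> real n * ln (lam / \<mu>) \<le> lam - \<mu>"
    using assms by (simp add: ln_mult ln_realpow ln_div algebra_simps)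
  finally show ?thesis .
qed

text \<open>The derivative of the difference is the square of
  \<open>exp (y / 2) - exp (- y / 2)\<close>.\<close>

lemma exp_minus_exp_ge: "0 \<le> x \<Longrightarrow> 2 * x \<le> exp x - exp (- x :: real)"
proof -
  assume x: "0 \<le> x"
  define f where "f x = exp x - exp (- x) - 2 * x" for x :: real
  have "f 0 \<le> f x"
  proof (rule DERIV_nonneg_imp_nondecreasing[OF x])
    fix y :: real
    have "0 \<le> (exp (y / 2) - exp (- y / 2))\<^sup>2" by simp
    also have "\<dots> = exp y + exp (- y) - 2"
      by (simp add: power2_diff power2_eq_square mult_exp_exp algebra_simps flip: exp_add)
    finally have "0 \<le> exp y + exp (- y) - 2" .
    moreover have "(f has_real_derivative exp y + exp (- y) - 2) (at y)"
      unfolding f_def by (auto intro!: derivative_eq_intros)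
    ultimately show "\<exists>d. (f has_real_derivative d) (at y) \<and> 0 \<le> d" by blast
  qed
  then show ?thesis by (simp add: f_def)
qed

text \<open>As \<open>L \<le> 1\<close>, the difference of the two sides is concave in \<open>z\<close>, so the endpoints suffice.\<close>

lemma exp_chord_bound:
  fixes z L :: real
  assumes L: "0 < L" "L \<le> 1" and z: "0 \<le> z" "z \<le> L"
  shows "z * (L / (1 - exp (- L))) \<le> (exp z - 1) * (1 + L - z)"
proof -
  define c where "c = L / (1 - exp (- L))"
  define H where "H z = c * z - (exp z - 1) * (1 + L - z)" for z
  have pos: "0 < 1 - exp (- L)" using L by simp
  have "convex_on {0..L} H"
  proof (rule f''_ge0_imp_convex)
    show "(H has_real_derivative c - (exp x * (1 + L - x) - (exp x - 1))) (at x)" for x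
      unfolding H_def by (auto intro!: derivative_eq_intros simp: algebra_simps)
    show "((\<lambda>x. c - (exp x * (1 + L - x) - (exp x - 1))) has_real_derivative exp x * (1 - L + x)) (at x)" for x
      by (auto intro!: derivative_eq_intros simp: algebra_simps)
    show "0 \<le> exp x * (1 - L + x)" if "x \<in> {0..L}" for x
      using that L by (intro mult_nonneg_nonneg) auto
  qed simp
  \<comment> \<open>At z = L the claim is
    \<open>L\<^sup>2 \<le> (exp L - 1) * (1 - exp (- L))\<close>, whose right side is the square of
    \<open>exp (L / 2) - exp (- L / 2)\<close>.\<close>
  have HL: "H L \<le> 0"
  proof -
    have "L\<^sup>2 \<le> (exp (L / 2) - exp (- (L / 2)))\<^sup>2"
      using exp_minus_exp_ge[of "L / 2"] L by (intro power_mono) auto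
    also have "\<dots> = (exp L - 1) * (1 - exp (- L))"
      by (simp add: power2_diff power2_eq_square algebra_simps flip: exp_add)
    finally have "L * L / (1 - exp (- L)) \<le> exp L - 1"
      using pos by (simp add: pos_divide_le_eq power2_eq_square)
    then show ?thesis by (simp add: H_def c_def)
  qed
  have "H z = H ((1 - z / L) *\<^sub>R 0 + (z / L) *\<^sub>R L)" using L by simp
  also have "\<dots> \<le> (1 - z / L) * H 0 + (z / L) * H L"
    using L z by (intro convex_onD[OF \<open>convex_on {0..L} H\<close>]) auto
  also have "\<dots> \<le> 0" using HL L z by (simp add: H_def mult_nonneg_nonpos divide_nonpos_pos)
  finally show ?thesis by (simp add: H_def c_def mult.commute)
qed

lemma exp_one_ge: "exp (1 :: real) \<ge> 2.64"
proof -
  have "1 + 1 / 2 + (1 / 2)\<^sup>2 / 2 \<le> exp (1 / 2 :: real)" by (rule exp_lower_Taylor_quadratic) simp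
  then have "(1.625 :: real)\<^sup>2 \<le> (exp (1 / 2))\<^sup>2" by (intro power_mono) (auto simp: power2_eq_square)
  also have "\<dots> = exp 1" by (simp add: power2_eq_square flip: exp_add)
  finally show ?thesis by (simp add: power2_eq_square)
qed

section \<open>The coupling conditions for the intensities \<mu> + 1 and \<mu>\<close>

locale unit_gap =
  fixes \<mu> :: real assumes \<mu>_pos: "0 < \<mu>"
begin

definition L :: real where "L = ln (1 + 1 / \<mu>)"

definition K :: nat where "K = nat \<lfloor>1 / L\<rfloor>"

lemma L_pos: "0 < L"
  unfolding L_def using \<mu>_pos by (intro ln_gt_zero) simp

lemma exp_L: "exp L = (\<mu> + 1) / \<mu>" "exp (- L) = \<mu> / (\<mu> + 1)"
proof -
  show 1: "exp L = (\<mu> + 1) / \<mu>" using \<mu>_pos by (simp add: L_def add_pos_pos field_simps)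
  show "exp (- L) = \<mu> / (\<mu> + 1)" unfolding exp_minus 1 by simp
qed

lemma K_bounds: "real K * L \<le> 1" "1 < (real K + 1) * L"
proof -
  have "0 \<le> 1 / L" using L_pos by simp
  then have "real K \<le> 1 / L" "1 / L < real K + 1" unfolding K_def by linarith+
  then show "real K * L \<le> 1" "1 < (real K + 1) * L"
    using L_pos by (simp_all add: field_simps)
qed

lemma \<mu>_less_K: "\<mu> < real K + 1"
proof -
  have "L \<le> 1 / \<mu>" unfolding L_def using \<mu>_pos by (intro ln_add_one_self_le_self) simp
  then have "(real K + 1) * L \<le> (real K + 1) * (1 / \<mu>)" by (intro mult_left_mono) auto
  with K_bounds(2) have "1 < (real K + 1) * (1 / \<mu>)" by simp
  then show ?thesis using \<mu>_pos by (simp add: field_simps)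
qed

lemma keep: "n \<le> K \<Longrightarrow> poisson_weight (\<mu> + 1) n \<le> poisson_weight \<mu> n"
proof -
  assume "n \<le> K"
  then have "real n * L \<le> real K * L" using L_pos by simp
  also have "\<dots> \<le> 1" by (rule K_bounds)
  finally have "real n * ln ((\<mu> + 1) / \<mu>) \<le> (\<mu> + 1) - \<mu>"
    using \<mu>_pos by (simp add: L_def add_divide_distrib)
  then show ?thesis using \<mu>_pos by (subst poisson_weight_le_iff) auto
qed

text \<open>The ratio of the weights is \<open>exp s * (1 - s / (\<mu> + 1)) ^ K\<close>. The base
  of the power is the chord of the convex function \<open>exp (- L * s)\<close> over [0,1], hence
  lies above it; the resulting exponential can be integrated in closed form.\<close>

lemma weight_drop_ge:
  assumes s: "0 \<le> s" "s \<le> 1"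
  shows "poisson_weight (\<mu> + 1) K * exp (s * (1 - real K * L)) \<le> poisson_weight (\<mu> + 1 - s) K"
proof -
  have "exp (- (L * s)) \<le> 1 - s / (\<mu> + 1)"
  proof -
    have "exp (- (L * s)) = exp ((1 - s) *\<^sub>R 0 + s *\<^sub>R (- L))" by (simp add: mult.commute)
    also have "\<dots> \<le> (1 - s) * exp 0 + s * exp (- L)"
      using s by (intro convex_onD[OF exp_convex]) auto
    also have "\<dots> = 1 - s / (\<mu> + 1)" using \<mu>_pos by (simp add: exp_L field_simps)
    finally show ?thesis .
  qed
  then have "exp (- (L * s)) ^ K \<le> (1 - s / (\<mu> + 1)) ^ K" by (intro power_mono) auto
  then have "exp (- (real K * L * s)) \<le> (1 - s / (\<mu> + 1)) ^ K"
    by (simp add: mult_ac flip: exp_of_nat_mult)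
  then have "poisson_weight (\<mu> + 1) K * exp s * exp (- (real K * L * s)) \<le>
      poisson_weight (\<mu> + 1) K * exp s * (1 - s / (\<mu> + 1)) ^ K"
    using \<mu>_pos by (intro mult_left_mono mult_nonneg_nonneg poisson_weight_nonneg) auto
  also have "\<dots> = poisson_weight (\<mu> + 1 - s) K"
  proof -
    have "1 - s / (\<mu> + 1) = (\<mu> + 1 - s) / (\<mu> + 1)" using \<mu>_pos by (simp add: field_simps)
    moreover have "exp (- (\<mu> + 1)) * exp s = exp (- (\<mu> + 1 - s))" by (simp flip: exp_add)
    ultimately show ?thesis
      using \<mu>_pos by (simp add: poisson_weight_def power_divide mult_ac)
  qed
  also have "poisson_weight (\<mu> + 1) K * exp s * exp (- (real K * L * s)) =
      poisson_weight (\<mu> + 1) K * exp (s * (1 - real K * L))"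
    by (simp add: algebra_simps flip: exp_add)
  finally show ?thesis .
qed

text \<open>The claim is that the distribution function at K falls, between \<mu> and \<mu> + 1, by
  at least the weight \<open>w * (\<mu> + 1) / (K + 1)\<close> of K + 1 points. The fall is the
  integral of the weights in between, which \<open>weight_drop_ge\<close> bounds below by
  \<open>w * (exp z - 1) / z\<close>.\<close>

lemma drop_K: "(\<Sum>i\<le>Suc K. poisson_weight (\<mu> + 1) i) \<le> (\<Sum>i\<le>K. poisson_weight \<mu> i)"
proof (cases "L \<le> 1")
  case L_le_1: True
  define z where "z = 1 - real K * L"
  define w where "w = poisson_weight (\<mu> + 1) K"
  define F where "F x = (\<Sum>i\<le>K. poisson_weight x i)" for x
  have z: "0 \<le> z" "z \<le> L" using K_bounds by (simp_all add: z_def algebra_simps)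
  have w: "0 < w" using \<mu>_pos by (simp add: w_def poisson_weight_def)
  \<comment> \<open>With \<open>K + 1\<close> and \<mu> + 1 expressed by \<open>L\<close> and
    \<open>z\<close>, what remains is the inequality \<open>exp_chord_bound\<close> in two real
    variables.\<close>
  have K1: "real K + 1 = (1 + L - z) / L" using L_pos by (simp add: z_def field_simps)
  have lam: "1 / (1 - exp (- L)) = \<mu> + 1" using \<mu>_pos by (simp add: exp_L field_simps)
  have F_deriv: "((\<lambda>s. F (\<mu> + 1 - s)) has_real_derivative poisson_weight (\<mu> + 1 - s) K) (at s)" for s
  proof -
    have "((\<lambda>s. \<mu> + 1 - s) has_real_derivative - 1) (at s)" by (auto intro!: derivative_eq_intros)
    from DERIV_chain2[OF poisson_cdf_has_derivative[of K "\<mu> + 1 - s"] this]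
    show ?thesis by (simp add: F_def)
  qed
  have "w * (\<mu> + 1) / (real K + 1) \<le> F \<mu> - F (\<mu> + 1)"
  \<comment> \<open>For z = 0 the factor \<open>(exp z - 1) / z\<close> degenerates to 1 and the
    lower bound for the weights is the constant \<open>w\<close>.\<close>
  proof (cases "z = 0")
    case True
    have "F (\<mu> + 1 - 0) - w * 0 \<le> F (\<mu> + 1 - 1) - w * 1"
    proof (rule DERIV_nonneg_imp_nondecreasing[where f="\<lambda>s. F (\<mu> + 1 - s) - w * s"])
      fix s :: real assume s: "0 \<le> s" "s \<le> 1"
      have "((\<lambda>s. F (\<mu> + 1 - s) - w * s) has_real_derivative poisson_weight (\<mu> + 1 - s) K - w) (at s)"
        by (rule derivative_eq_intros F_deriv refl | simp)+
      moreover have "0 \<le> poisson_weight (\<mu> + 1 - s) K - w"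
        using weight_drop_ge[OF s] True by (simp add: z_def w_def)
      ultimately show "\<exists>d. ((\<lambda>s. F (\<mu> + 1 - s) - w * s) has_real_derivative d) (at s) \<and> 0 \<le> d" by blast
    qed simp
    then have "w \<le> F \<mu> - F (\<mu> + 1)" by simp
    moreover have "\<mu> + 1 \<le> real K + 1"
    proof -
      have "(1 + L) * exp (- L) \<le> exp L * exp (- L)" by (intro mult_right_mono exp_ge_add_one_self) auto
      then have "(1 + L) * exp (- L) \<le> 1" by (simp flip: exp_add)
      then have "L \<le> (1 + L) * (1 - exp (- L))" by (simp add: algebra_simps)
      moreover have "0 < 1 - exp (- L)" using L_pos by simp
      ultimately have "L * (1 / (1 - exp (- L))) \<le> 1 + L" by (simp add: pos_divide_le_eq)
      then show ?thesis unfolding K1 lam True using L_pos by (simp add: pos_le_divide_eq mult.commute)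
    qed
    then have "w * ((\<mu> + 1) / (real K + 1)) \<le> w * 1" using w \<mu>_pos by (intro mult_left_mono) auto
    ultimately show ?thesis by simp
  next
    case False
    then have z_pos: "0 < z" using z by simp
    have "F (\<mu> + 1 - 0) - w * exp (0 * z) / z \<le> F (\<mu> + 1 - 1) - w * exp (1 * z) / z"
    proof (rule DERIV_nonneg_imp_nondecreasing[where f="\<lambda>s. F (\<mu> + 1 - s) - w * exp (s * z) / z"])
      fix s :: real assume s: "0 \<le> s" "s \<le> 1"
      have "((\<lambda>s. F (\<mu> + 1 - s) - w * exp (s * z) / z) has_real_derivative
          poisson_weight (\<mu> + 1 - s) K - w * exp (s * z)) (at s)"
        by (rule derivative_eq_intros F_deriv refl | use z_pos in simp)+
      moreover have "0 \<le> poisson_weight (\<mu> + 1 - s) K - w * exp (s * z)"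
        using weight_drop_ge[OF s] by (simp add: z_def w_def)
      ultimately show "\<exists>d. ((\<lambda>s. F (\<mu> + 1 - s) - w * exp (s * z) / z) has_real_derivative d) (at s) \<and> 0 \<le> d"
        by blast
    qed simp
    then have "w * ((exp z - 1) / z) \<le> F \<mu> - F (\<mu> + 1)" by (simp add: diff_divide_distrib algebra_simps)
    moreover have "(\<mu> + 1) / (real K + 1) \<le> (exp z - 1) / z"
    proof -
      have "z * (L * (\<mu> + 1)) \<le> (exp z - 1) * (1 + L - z)"
        using exp_chord_bound[OF L_pos L_le_1 z] by (simp flip: lam)
      then show ?thesis
        unfolding K1 using z_pos z L_pos by (simp add: divide_le_eq pos_le_divide_eq mult_ac)
    qed
    then have "w * ((\<mu> + 1) / (real K + 1)) \<le> w * ((exp z - 1) / z)" using w by (intro mult_left_mono) auto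
    ultimately show ?thesis by simp
  qed
  then show ?thesis by (simp add: F_def poisson_weight_Suc w_def add.commute)
next
  case False
  then have "1 / L < 1" "0 \<le> 1 / L" using L_pos by auto
  then have K0: "K = 0" unfolding K_def by linarith
  have "exp 1 < exp L" using False by simp
  then have "exp 1 * \<mu> < \<mu> + 1" using \<mu>_pos by (simp add: exp_L pos_less_divide_eq)
  moreover have "2.64 * \<mu> \<le> exp 1 * \<mu>" using exp_one_ge \<mu>_pos by (intro mult_right_mono) auto
  ultimately have "\<mu> < 1 / 1.64" by simp
  then have "2 + \<mu> \<le> exp 1" using exp_one_ge by simp
  then have "exp (- (\<mu> + 1)) * (2 + \<mu>) \<le> exp (- (\<mu> + 1)) * exp 1" by (intro mult_left_mono) auto
  also have "\<dots> = exp (- \<mu>)" by (simp flip: exp_add)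
  finally show ?thesis by (simp add: K0 poisson_weight_def algebra_simps)
qed

text \<open>The slack in \<open>drop\<close> increases in \<open>m\<close> up to some point, then decreases, and tends to zero.\<close>

lemma drop:
  assumes m: "K \<le> m"
  shows "(\<Sum>i\<le>Suc m. poisson_weight (\<mu> + 1) i) \<le> (\<Sum>i\<le>m. poisson_weight \<mu> i)"
proof -
  define D where "D m = (\<Sum>i\<le>m. poisson_weight \<mu> i) - (\<Sum>i\<le>Suc m. poisson_weight (\<mu> + 1) i)" for m
  \<comment> \<open>Says that the slack decreases in the step that arrives at
    \<open>m\<close>.\<close>
  define neg where "neg m \<longleftrightarrow> poisson_weight \<mu> m < poisson_weight (\<mu> + 1) (Suc m)" for m
  have D_Suc: "D (Suc m) = D m + (poisson_weight \<mu> (Suc m) - poisson_weight (\<mu> + 1) (Suc (Suc m)))" for m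
    by (simp add: D_def)
  \<comment> \<open>A decrease persists because the source weights shrink no faster:
    \<open>\<mu> / (i + 1) \<le> (\<mu> + 1) / (i + 2)\<close> amounts to
    \<open>\<mu> \<le> i + 1\<close>, and \<open>\<mu>_less_K\<close> supplies it beyond
    \<open>K\<close>.\<close>
  have neg_Suc: "neg (Suc i)" if "neg i" "K < i" for i
  proof -
    have i: "\<mu> < real i" using \<mu>_less_K that(2) by linarith
    have "\<mu> / real (Suc i) \<le> (\<mu> + 1) / real (Suc (Suc i))"
      using i \<mu>_pos by (simp add: divide_le_eq pos_le_divide_eq field_simps)
    then have "poisson_weight \<mu> i * (\<mu> / real (Suc i)) \<le> poisson_weight \<mu> i * ((\<mu> + 1) / real (Suc (Suc i)))"
      using \<mu>_pos by (intro mult_left_mono poisson_weight_nonneg) auto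
    also have "\<dots> < poisson_weight (\<mu> + 1) (Suc i) * ((\<mu> + 1) / real (Suc (Suc i)))"
      using that(1) \<mu>_pos by (intro mult_strict_right_mono) (auto simp: neg_def)
    finally show ?thesis unfolding neg_def by (simp only: poisson_weight_Suc times_divide_eq_right)
  qed
  have neg_mono: "neg j" if "i \<le> j" "neg i" "K < i" for i j
    using that by (induction j rule: dec_induct) (auto intro: neg_Suc)
  have D_lim: "D \<longlonglongrightarrow> 0"
  proof -
    have *: "(\<lambda>m. \<Sum>i\<le>m. poisson_weight a i) \<longlonglongrightarrow> 1" for a
      using poisson_weight_sums[of a] by (simp add: sums_def_le)
    have "D \<longlonglongrightarrow> 1 - 1"
      unfolding D_def[abs_def] by (intro tendsto_diff * LIMSEQ_Suc[OF *])
    then show ?thesis by simp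
  qed
  have "0 \<le> D m"
  proof (cases "neg (Suc m)")
    case True
    have "D (Suc j) \<le> D j" if "m \<le> j" for j
      using neg_mono[of "Suc m" "Suc j"] True that m by (simp add: D_Suc neg_def)
    note dec = this
    have "D j \<le> D m" if "m \<le> j" for j
      using that
    proof (induction j rule: dec_induct)
      case (step j)
      then show ?case using dec[of j] by simp
    qed simp
    then show ?thesis by (intro LIMSEQ_le_const2[OF D_lim] exI[of _ m]) auto
  next
    case False
    have "D j \<le> D (Suc j)" if "K \<le> j" "j < m" for j
    proof -
      have "\<not> neg (Suc j)" using neg_mono[of "Suc j" "Suc m"] False that by auto
      then show ?thesis by (simp add: D_Suc neg_def)
    qed
    note inc = this
    have "D K \<le> D j" if "K \<le> j" "j \<le> m" for j
      using that
    proof (induction j rule: dec_induct)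
      case (step j)
      then show ?case using inc[of j] by simp
    qed simp
    then have "D K \<le> D m" using m by simp
    moreover have "0 \<le> D K" using drop_K by (simp add: D_def)
    ultimately show ?thesis by simp
  qed
  then show ?thesis by (simp add: D_def)
qed

lemma ex_thinning: "\<exists>f. thinning (\<mu> + 1) \<mu> f"
proof -
  interpret thinning_coupling "\<mu> + 1" \<mu> K
    by unfold_locales (use \<mu>_pos keep drop in auto)
  show ?thesis using thinning_thin by blast
qed

end

section \<open>The lower bound\<close>

lemma sets_card_event: "{\<nu> \<in> simple_point_measures. card (points \<nu>) \<in> A} \<in> sets configurations"
proof -
  have "{\<nu> \<in> simple_point_measures. card (points \<nu>) \<in> A} =
      (\<lambda>\<nu>. card (points \<nu>)) -` A \<inter> space configurations" by auto
  also have "\<dots> \<in> sets configurations" by (rule measurable_sets[OF measurable_card_points]) simp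
  finally show ?thesis .
qed

lemma poisson_law_card_le:
  assumes "lam > 0"
  shows "emeasure (poisson_law lam) {\<nu> \<in> simple_point_measures. card (points \<nu>) \<le> m} =
    ennreal (\<Sum>i\<le>m. poisson_weight lam i)"
proof -
  define A where "A = {\<nu> \<in> simple_point_measures. card (points \<nu>) \<le> m}"
  have A: "A \<in> sets configurations" using sets_card_event[of "{..m}"] by (simp add: A_def)
  have law: "emeasure (binomial_law {..<n}) A = (if n \<le> m then 1 else 0)" for n
  proof -
    have "emeasure (binomial_law {..<n}) A =
        emeasure (binomial_law {..<n}) (if n \<le> m then simple_point_measures else {})"
    proof (rule emeasure_eq_AE)
      show "AE \<nu> in binomial_law {..<n}. \<nu> \<in> A \<longleftrightarrow> \<nu> \<in> (if n \<le> m then simple_point_measures else {})"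
        using AE_binomial_law_card[OF finite_lessThan, of n] AE_space
        by eventually_elim (simp add: A_def)
    qed (use A sets.top[of configurations] in auto)
    then show ?thesis
      using prob_space.emeasure_space_1[OF prob_space_binomial_law, of "{..<n}"] by simp
  qed
  have "emeasure (poisson_law lam) A = (\<Sum>n. ennreal (poisson_weight lam n) * emeasure (binomial_law {..<n}) A)"
    by (rule emeasure_poisson_law[OF assms A])
  also have "\<dots> = (\<Sum>n\<le>m. ennreal (poisson_weight lam n) * emeasure (binomial_law {..<n}) A)"
    by (rule suminf_finite) (simp_all add: law)
  also have "\<dots> = (\<Sum>n\<le>m. ennreal (poisson_weight lam n))" by (simp add: law)
  also have "\<dots> = ennreal (\<Sum>i\<le>m. poisson_weight lam i)"
    using assms by (intro sum_ennreal poisson_weight_nonneg) simp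
  finally show ?thesis by (simp add: A_def)
qed

text \<open>An event that fixes the number of points sees one term of the mixture. For such an
  event, two intensities differ only by the Poisson weight in front.\<close>

lemma poisson_law_card_eq:
  assumes lam: "lam > 0" and E: "E \<in> sets configurations"
    and sub: "\<And>\<nu>. \<nu> \<in> E \<Longrightarrow> card (points \<nu>) = n"
  shows "emeasure (poisson_law lam) E = ennreal (poisson_weight lam n) * emeasure (binomial_law {..<n}) E"
proof -
  have "emeasure (binomial_law {..<i}) E = 0" if "i \<noteq> n" for i
  proof -
    have "emeasure (binomial_law {..<i}) E = emeasure (binomial_law {..<i}) {}"
    proof (rule emeasure_eq_AE)
      show "AE \<nu> in binomial_law {..<i}. \<nu> \<in> E \<longleftrightarrow> \<nu> \<in> {}"
        using AE_binomial_law_card[OF finite_lessThan, of i]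
        by eventually_elim (use sub that in auto)
    qed (use E in auto)
    then show ?thesis by simp
  qed
  then have "(\<Sum>i. ennreal (poisson_weight lam i) * emeasure (binomial_law {..<i}) E) =
      (\<Sum>i\<in>{n}. ennreal (poisson_weight lam i) * emeasure (binomial_law {..<i}) E)"
    by (intro suminf_finite) auto
  then show ?thesis using emeasure_poisson_law[OF lam E] by simp
qed

text \<open>Keeping all points of a configuration reproduces it, so \<open>f\<close> cannot keep all of \<open>n\<close> points with
  positive probability when \<open>n\<close> points are less likely under the target law.\<close>

lemma thinning_imp_cdf_le:
  assumes f: "thinning lam \<mu> f" and \<mu>: "0 < \<mu>" "\<mu> < lam"
    and less: "poisson_weight \<mu> (Suc k) < poisson_weight lam (Suc k)"
  shows "(\<Sum>i\<le>Suc k. poisson_weight lam i) \<le> (\<Sum>i\<le>k. poisson_weight \<mu> i)"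
proof -
  let ?P = "poisson_law lam"
  have lam: "0 < lam" using \<mu> by simp
  have f_meas: "f \<in> measurable configurations configurations" using f by (simp add: thinning_def)
  have f_meas_P: "f \<in> measurable ?P configurations"
    using f_meas by (simp cong: measurable_cong_sets)
  have "poisson_process lam ?P (\<lambda>\<nu>. \<nu>)"
    unfolding poisson_process_iff_law[OF lam]
    using prob_space_poisson_law distr_id2[OF sets_poisson_law[symmetric]] by (simp add: measurable_ident_sets)
  then have "poisson_process \<mu> ?P f" and AE_sub: "AE \<nu> in ?P. points (f \<nu>) \<subseteq> points \<nu>"
    using f unfolding thinning_def by auto
  then have law: "distr ?P configurations f = poisson_law \<mu>"
    using poisson_process_iff_law[OF \<mu>(1)] by blast
  have f_simple: "f \<nu> \<in> simple_point_measures" if "\<nu> \<in> simple_point_measures" for \<nu>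
    using measurable_space[OF f_meas] that by simp
  have law_f: "emeasure ?P (f -` E \<inter> simple_point_measures) = emeasure (poisson_law \<mu>) E"
    if "E \<in> sets configurations" for E
    using emeasure_distr[OF f_meas_P that] by (simp add: law)
  have vimage: "f -` E \<inter> simple_point_measures \<in> sets configurations" if "E \<in> sets configurations" for E
    using measurable_sets[OF f_meas that] by simp
  define E where "E = {\<nu> \<in> simple_point_measures. card (points \<nu>) = Suc k \<and> card (points (f \<nu>)) = Suc k}"
  have E: "E \<in> sets configurations"
  proof -
    let ?C = "{\<nu> \<in> simple_point_measures. card (points \<nu>) \<in> {Suc k}}"
    have "E = ?C \<inter> (f -` ?C \<inter> simple_point_measures)" unfolding E_def using f_simple by blast
    also have "\<dots> \<in> sets configurations" by (intro sets.Int sets_card_event vimage)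
    finally show ?thesis .
  qed
  \<comment> \<open>On \<open>E\<close> all points are kept, so \<open>f\<close> acts there as the
    identity almost surely and \<open>E\<close> lies in its own preimage, whose probability is given
    by the target law.\<close>
  have "emeasure ?P E \<le> emeasure ?P (f -` E \<inter> simple_point_measures)"
  proof (rule emeasure_mono_AE)
    show "AE \<nu> in ?P. \<nu> \<in> E \<longrightarrow> \<nu> \<in> f -` E \<inter> simple_point_measures"
      using AE_sub
    proof eventually_elim
      case (elim \<nu>)
      show ?case
      proof
        assume \<nu>: "\<nu> \<in> E"
        then have s: "\<nu> \<in> simple_point_measures" by (simp add: E_def)
        have "points (f \<nu>) = points \<nu>"
          using \<nu> elim finite_points(1)[OF s] by (intro card_subset_eq) (auto simp: E_def)
        then have "f \<nu> = \<nu>" using config_of_points[OF s] config_of_points[OF f_simple[OF s]] by simp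
        then show "\<nu> \<in> f -` E \<inter> simple_point_measures" using \<nu> s by simp
      qed
    qed
  qed (use vimage[OF E] in simp)
  also have "\<dots> = emeasure (poisson_law \<mu>) E" by (rule law_f[OF E])
  finally have "ennreal (poisson_weight lam (Suc k)) * emeasure (binomial_law {..<Suc k}) E \<le>
      ennreal (poisson_weight \<mu> (Suc k)) * emeasure (binomial_law {..<Suc k}) E"
    using poisson_law_card_eq[OF lam E, of "Suc k"] poisson_law_card_eq[OF \<mu>(1) E, of "Suc k"]
    by (simp add: E_def)
  moreover obtain u where u: "emeasure (binomial_law {..<Suc k}) E = ennreal u" "0 \<le> u"
    using finite_measure.emeasure_finite[OF prob_space.finite_measure[OF prob_space_binomial_law[OF finite_lessThan]], of "Suc k" E]
    by (metis ennreal_enn2real enn2real_nonneg top.not_eq_extremum infinity_ennreal_def)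
  ultimately have "ennreal (poisson_weight lam (Suc k) * u) \<le> ennreal (poisson_weight \<mu> (Suc k) * u)"
    using \<mu> lam by (simp add: ennreal_mult poisson_weight_nonneg)
  then have "poisson_weight lam (Suc k) * u \<le> poisson_weight \<mu> (Suc k) * u"
    using \<mu> u by (subst (asm) ennreal_le_iff) (auto intro!: mult_nonneg_nonneg poisson_weight_nonneg)
  then have "u = 0" using less u(2) by (metis mult_le_cancel_right not_less order_antisym)
  then have "emeasure ?P E = 0"
    using poisson_law_card_eq[OF lam E, of "Suc k"] u by (simp add: E_def)
  then have AE_E: "AE \<nu> in ?P. \<nu> \<notin> E" using E by (intro AE_not_in) (auto simp: null_sets_def)
  let ?A = "\<lambda>m. {\<nu> \<in> simple_point_measures. card (points \<nu>) \<le> m}"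
  have A: "?A m \<in> sets configurations" for m using sets_card_event[of "{..m}"] by simp
  \<comment> \<open>With \<open>E\<close> null, a configuration of exactly k + 1 points loses one,
    and one of fewer points gains none.\<close>
  have "emeasure ?P (?A (Suc k)) \<le> emeasure ?P (f -` ?A k \<inter> simple_point_measures)"
  proof (rule emeasure_mono_AE)
    show "AE \<nu> in ?P. \<nu> \<in> ?A (Suc k) \<longrightarrow> \<nu> \<in> f -` ?A k \<inter> simple_point_measures"
      using AE_sub AE_E
    proof eventually_elim
      case (elim \<nu>)
      show ?case
      proof
        assume \<nu>: "\<nu> \<in> ?A (Suc k)"
        then have s: "\<nu> \<in> simple_point_measures" by simp
        have "card (points (f \<nu>)) \<le> card (points \<nu>)"
          using elim(1) finite_points(1)[OF s] by (intro card_mono)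
        moreover have "\<not> (card (points \<nu>) = Suc k \<and> card (points (f \<nu>)) = Suc k)"
          using elim(2) s by (simp add: E_def)
        ultimately have "card (points (f \<nu>)) \<le> k" using \<nu> by auto
        then show "\<nu> \<in> f -` ?A k \<inter> simple_point_measures" using s f_simple by simp
      qed
    qed
  qed (use vimage[OF A] in simp)
  also have "\<dots> = emeasure (poisson_law \<mu>) (?A k)" by (rule law_f[OF A])
  finally have "ennreal (\<Sum>i\<le>Suc k. poisson_weight lam i) \<le> ennreal (\<Sum>i\<le>k. poisson_weight \<mu> i)"
    by (simp only: poisson_law_card_le[OF lam] poisson_law_card_le[OF \<mu>(1)])
  moreover have "0 \<le> (\<Sum>i\<le>k. poisson_weight \<mu> i)"
    using \<mu> by (intro sum_nonneg poisson_weight_nonneg) simp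
  ultimately show ?thesis by (simp only: ennreal_le_iff)
qed

text \<open>The map \<open>exp (- t) * t ^ n\<close> increases up to its mode t = n; the strict
  inequality \<open>ln x < x - 1\<close> replaces a derivative argument.\<close>

lemma poisson_weight_strict_mono:
  assumes "0 < a" "a < b" "b \<le> real n"
  shows "poisson_weight a n < poisson_weight b n"
proof -
  have "ln (a / b) < a / b - 1"
    using ln_le_minus_one[of "a / b"] ln_eq_minus_one[of "a / b"] assms by (auto simp: less_le)
  then have "b * ln (a / b) < b * (a / b - 1)" using assms by (intro mult_strict_left_mono) auto
  then have "b * ln (a / b) < a - b" using assms by (simp add: right_diff_distrib)
  moreover have "real n * ln (a / b) \<le> b * ln (a / b)"
    using assms by (intro mult_right_mono_neg) (auto simp: ln_div)
  ultimately have "real n * ln (a / b) < a - b" by simp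
  then have "\<not> real n * ln (b / a) \<le> b - a" using assms by (simp add: ln_div algebra_simps)
  then show ?thesis using poisson_weight_le_iff[of a b n] assms by simp
qed

lemma poisson_weight_le_mode:
  assumes "0 < t" "0 < n"
  shows "poisson_weight t n \<le> poisson_weight (real n) n"
proof -
  have "ln (t / real n) \<le> t / real n - 1" using assms by (intro ln_le_minus_one) simp
  then have "real n * ln (t / real n) \<le> real n * (t / real n - 1)" by (intro mult_left_mono) auto
  then have "real n * ln (t / real n) \<le> t - real n" using assms by (simp add: right_diff_distrib)
  then show ?thesis using assms by (subst poisson_weight_le_iff) auto
qed

text \<open>The weight of k + 1 under \<open>lam\<close> is at least its value at intensity k, which
  is \<open>w * k / (k + 1)\<close>. By the mean value theorem it is at most
  \<open>lam - \<mu>\<close> times a weight of k, and no weight of k exceeds its value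
  \<open>w\<close> at the mode.\<close>

lemma thinning_imp_lam_ge:
  assumes f: "thinning lam \<mu> f" and \<mu>: "1 < \<mu>" "\<mu> < lam"
  shows "\<mu> + 1 - 1 / \<mu> \<le> lam"
proof -
  \<comment> \<open>The choice \<open>k < lam \<le> k + 1\<close> puts \<mu>, \<open>lam\<close> and
    k below the mode k + 1. There the weight of k + 1 increases in the intensity, which both
    excludes keeping all k + 1 points and gives the lower bound at intensity k.\<close>
  define k where "k = nat (\<lceil>lam\<rceil> - 1)"
  have k: "real k < lam" "lam \<le> real (Suc k)" "0 < k" using \<mu> unfolding k_def by linarith+
  define w where "w = poisson_weight (real k) k"
  have w: "0 < w" using k by (simp add: w_def poisson_weight_def)
  have cdf: "(\<Sum>i\<le>Suc k. poisson_weight lam i) \<le> (\<Sum>i\<le>k. poisson_weight \<mu> i)"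
    using \<mu> k by (intro thinning_imp_cdf_le[OF f] poisson_weight_strict_mono) auto
  obtain \<xi> where \<xi>: "\<mu> < \<xi>" "\<xi> < lam"
    "(\<Sum>i\<le>k. poisson_weight lam i) - (\<Sum>i\<le>k. poisson_weight \<mu> i) = (lam - \<mu>) * (- poisson_weight \<xi> k)"
    using MVT2[OF \<mu>(2), of "\<lambda>t. \<Sum>i\<le>k. poisson_weight t i" "\<lambda>t. - poisson_weight t k"]
      poisson_cdf_has_derivative by blast
  have "w * (real k / real (Suc k)) = poisson_weight (real k) (Suc k)"
    by (simp add: w_def poisson_weight_Suc)
  also have "\<dots> \<le> poisson_weight lam (Suc k)"
    by (rule less_imp_le, rule poisson_weight_strict_mono) (use k in auto)
  also have "\<dots> \<le> (lam - \<mu>) * poisson_weight \<xi> k" using cdf \<xi>(3) by simp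
  also have "\<dots> \<le> (lam - \<mu>) * w"
    unfolding w_def using \<mu> \<xi> k by (intro mult_left_mono poisson_weight_le_mode) auto
  finally have "w * (real k / real (Suc k)) \<le> w * (lam - \<mu>)" by (simp only: mult.commute)
  then have "real k / real (Suc k) \<le> lam - \<mu>" using w by (simp only: mult_le_cancel_left_pos)
  moreover have "1 - 1 / \<mu> \<le> real k / real (Suc k)"
  proof -
    \<comment> \<open>Since \<open>\<mu> < lam \<le> k + 1\<close>.\<close>
    have "1 / real (Suc k) \<le> 1 / \<mu>" using \<mu> k by (intro divide_left_mono) auto
    moreover have "real k / real (Suc k) = 1 - 1 / real (Suc k)" by (simp add: field_simps)
    ultimately show ?thesis by simp
  qed
  ultimately show ?thesis by simp
qed

theorem corollary4:
  shows "(\<forall>\<mu>>0. lambda_c \<mu> \<le> ereal (\<mu> + 1)) \<and>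
    (\<exists>r :: real \<Rightarrow> real. r \<in> o[at_top](\<lambda>_. 1) \<and>
       (\<forall>\<^sub>F \<mu> in at_top. lambda_c \<mu> \<ge> ereal (\<mu> + 1 - r \<mu>)))"
proof (intro conjI allI impI exI)
  fix \<mu> :: real assume "0 < \<mu>"
  then interpret unit_gap \<mu> by unfold_locales
  show "lambda_c \<mu> \<le> ereal (\<mu> + 1)"
    unfolding lambda_c_def using ex_thinning by (intro INF_lower) auto
next
  \<comment> \<open>The error term is explicit: \<open>1 / \<mu>\<close>, valid for all \<mu> > 1 by
    \<open>thinning_imp_lam_ge\<close>.\<close>
  show "(\<lambda>\<mu>::real. 1 / \<mu>) \<in> o[at_top](\<lambda>_. 1)"
    by (rule smalloI_tendsto) (simp_all add: tendsto_divide_0[OF tendsto_const filterlim_at_top_imp_at_infinity[OF filterlim_ident]])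
  show "\<forall>\<^sub>F \<mu> in at_top. lambda_c \<mu> \<ge> ereal (\<mu> + 1 - 1 / \<mu>)"
    using eventually_gt_at_top[of 1]
  proof eventually_elim
    case (elim \<mu>)
    then show ?case
      unfolding lambda_c_def using thinning_imp_lam_ge by (intro INF_greatest) auto
  qed
qed

end
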